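(* Let $G$ be a non-Hausdorff étale groupoid. Assume that the source map (or equivalently the range map) restricts to a finite-to-one map $\overline{G^{(0)}}\to G^{(0)}$, where $\overline{G^{(0)}}$ denotes the closure of $G^{(0)}$ in $G$. Then $J\cap\mathcal{C}_c(G)=\{0\}$ if and only if $J=\{0\}$, and $J=\{0\}$ if and only if $G$ does not satisfy condition $(\mathcal{S}_0)$.
   Context: Groupoids. A groupoid $G$ is a small category all of whose morphisms are invertible, identified with its set of morphisms; $G^{(0)}\subseteq G$ is its set of units, $r,s\colon G\to G^{(0)}$ are range and source, and $G_x=s^{-1}(x)$. Topological groupoids (continuous range, source, multiplication, inversion) are always assumed locally compact with $G^{(0)}$ Hausdorff in the subspace topology; $G$ itself need not be Hausdorff, and compact subsets need not be closed. $G$ is étale if $r$ is a local homeomorphism. An open bisection is an open subset $U\subseteq G$ on which $r$ and $s$ are injective ($U$ is then locally compact Hausdorff). $C^*$-algebra. For an open bisection $U$, $C_c(U)$ is the set of continuous functions $U\to\mathbb{C}$ with compact support in $U$, extended by zero to functions on $G$; $\mathcal{C}_c(G)$ is the linear span of all $C_c(U)$, a $*$-algebra under $f^*(g)=\overline{f(g^{-1})}$ and convolution $(f_1*f_2)(g)=\sum_{g_1g_2=g}f_1(g_1)f_2(g_2)$. For $x\in G^{(0)}$, $\pi_x\colon\mathcal{C}_c(G)\to\mathcal{L}(\ell^2(G_x))$ is $\pi_x(f)\xi=f*\xi$; $C^*_r(G)$ is the completion of $\mathcal{C}_c(G)$ in the norm $\sup_{x}\|\pi_x(f)\|$. Elements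 $f\in C^*_r(G)$ are viewed as functions on $G$ via $f(g)=\langle\pi_{s(g)}(f)\delta_{s(g)},\delta_g\rangle$. Singular ideal. With $\mathrm{supp}^\circ(f)=\{g: f(g)\neq0\}$, set $J=\{f\in C^*_r(G): s(\mathrm{supp}^\circ(f))\text{ has empty interior}\}$. Condition $(\mathcal{S}_0)$: there exist a positive integer $n$ and open bisections $U_1,\dots,U_n\subseteq G$ such that (1) $s(U_i)=s(U_j)$ for all $1\le i,j\le n$; (2) $U_i\setminus\bigcup_{j\neq i}U_j$ is non-empty and has empty interior for all $1\le i\le n$; (3) $\mathrm{span}_{\mathbb{Q}}\{b_I: I\subseteq\{1,\dots,n\},\ \#I>1,\ (\bigcap_{i\in I}U_i)\setminus(\bigcup_{j\notin I}U_j)\neq\emptyset\}\neq\mathbb{Q}^n$, where $b_I=\sum_{i\in I}b_i$ and $b_i$ is the $i$-th standard basis vector of $\mathbb{Q}^n$. *)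

theory Defs
  imports "HOL-Analysis.Analysis" "HOL-Library.Function_Algebras"
begin

section \<open>Topological groupoids\<close>

text \<open>
  A groupoid is identified with its set of morphisms, which is the underlying set
  \<open>topspace (gtop G)\<close>. The product \<open>gmult G g h\<close> is meaningful when the source of \<open>g\<close>
  is the range of \<open>h\<close>.
\<close>

record 'g topgroupoid =
  gtop :: "'g topology"
  units :: "'g set"
  rng :: "'g \<Rightarrow> 'g"
  src :: "'g \<Rightarrow> 'g"
  gmult :: "'g \<Rightarrow> 'g \<Rightarrow> 'g"
  ginv :: "'g \<Rightarrow> 'g"

abbreviation arrows :: "'g topgroupoid \<Rightarrow> 'g set"
  where "arrows G \<equiv> topspace (gtop G)"

abbreviation units_top :: "'g topgroupoid \<Rightarrow> 'g topology"
  where "units_top G \<equiv> subtopology (gtop G) (units G)"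

definition composable :: "'g topgroupoid \<Rightarrow> ('g \<times> 'g) set"
  where "composable G = {(g, h). g \<in> arrows G \<and> h \<in> arrows G \<and> src G g = rng G h}"

definition groupoid :: "'g topgroupoid \<Rightarrow> bool"
  where "groupoid G \<longleftrightarrow>
    units G \<subseteq> arrows G \<and>
    rng G \<in> arrows G \<rightarrow> units G \<and>
    src G \<in> arrows G \<rightarrow> units G \<and>
    (\<forall>x\<in>units G. rng G x = x \<and> src G x = x) \<and>
    (\<forall>(g, h)\<in>composable G. gmult G g h \<in> arrows G \<and>
       rng G (gmult G g h) = rng G g \<and> src G (gmult G g h) = src G h) \<and>
    (\<forall>g h k. (g, h) \<in> composable G \<and> (h, k) \<in> composable G \<longrightarrow>
       gmult G (gmult G g h) k = gmult G g (gmult G h k)) \<and>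
    (\<forall>g\<in>arrows G. gmult G (rng G g) g = g \<and> gmult G g (src G g) = g) \<and>
    (\<forall>g\<in>arrows G. ginv G g \<in> arrows G \<and>
       rng G (ginv G g) = src G g \<and> src G (ginv G g) = rng G g \<and>
       gmult G g (ginv G g) = rng G g \<and> gmult G (ginv G g) g = src G g)"

text \<open>
  The whole groupoid is not assumed to be Hausdorff, and compactness is the open cover
  property only.
\<close>

definition topological_groupoid :: "'g topgroupoid \<Rightarrow> bool"
  where "topological_groupoid G \<longleftrightarrow>
    groupoid G \<and>
    continuous_map (gtop G) (units_top G) (rng G) \<and>
    continuous_map (gtop G) (units_top G) (src G) \<and>
    continuous_map (subtopology (prod_topology (gtop G) (gtop G)) (composable G)) (gtop G)
      (\<lambda>(g, h). gmult G g h) \<and>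
    continuous_map (gtop G) (gtop G) (ginv G) \<and>
    locally_compact_space (gtop G) \<and>
    Hausdorff_space (units_top G)"

definition local_homeomorphism :: "'a topology \<Rightarrow> 'b topology \<Rightarrow> ('a \<Rightarrow> 'b) \<Rightarrow> bool"
  where "local_homeomorphism X Y f \<longleftrightarrow>
    (\<forall>x\<in>topspace X. \<exists>U. openin X U \<and> x \<in> U \<and> openin Y (f ` U) \<and>
       homeomorphic_map (subtopology X U) (subtopology Y (f ` U)) f)"

definition etale_groupoid :: "'g topgroupoid \<Rightarrow> bool"
  where "etale_groupoid G \<longleftrightarrow>
    topological_groupoid G \<and> local_homeomorphism (gtop G) (units_top G) (rng G)"

definition open_bisection :: "'g topgroupoid \<Rightarrow> 'g set \<Rightarrow> bool"
  where "open_bisection G U \<longleftrightarrow>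
    openin (gtop G) U \<and> inj_on (rng G) U \<and> inj_on (src G) U"

definition src_fibre :: "'g topgroupoid \<Rightarrow> 'g \<Rightarrow> 'g set"
  where "src_fibre G x = {g \<in> arrows G. src G g = x}"

definition finite_to_one_on :: "('a \<Rightarrow> 'b) \<Rightarrow> 'a set \<Rightarrow> bool"
  where "finite_to_one_on f A \<longleftrightarrow> (\<forall>y. finite {a \<in> A. f a = y})"


section \<open>Functions on a groupoid\<close>

definition fun_scale :: "'k::field \<Rightarrow> ('i \<Rightarrow> 'k) \<Rightarrow> 'i \<Rightarrow> 'k"
  where "fun_scale c v = (\<lambda>i. c * v i)"

interpretation fun_vs: vector_space "fun_scale :: 'k::field \<Rightarrow> ('i \<Rightarrow> 'k) \<Rightarrow> 'i \<Rightarrow> 'k"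
  by unfold_locales (auto simp: fun_scale_def fun_eq_iff algebra_simps)

definition Cc_on :: "'g topgroupoid \<Rightarrow> 'g set \<Rightarrow> ('g \<Rightarrow> complex) set"
  where "Cc_on G U = {f.
    continuous_map (subtopology (gtop G) U) euclidean f \<and>
    compactin (subtopology (gtop G) U) (subtopology (gtop G) U closure_of {g \<in> U. f g \<noteq> 0}) \<and>
    (\<forall>g. g \<notin> U \<longrightarrow> f g = 0)}"

definition Cc :: "'g topgroupoid \<Rightarrow> ('g \<Rightarrow> complex) set"
  where "Cc G = fun_vs.span (\<Union>U\<in>{U. open_bisection G U}. Cc_on G U)"

text \<open>
  For \<open>f\<close> in \<open>Cc G\<close> the sum has only finitely many nonzero terms, for any function \<open>\<xi>\<close>.
\<close>

definition convolution ::
    "'g topgroupoid \<Rightarrow> ('g \<Rightarrow> complex) \<Rightarrow> ('g \<Rightarrow> complex) \<Rightarrow> 'g \<Rightarrow> complex"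
  where "convolution G f \<xi> =
    (\<lambda>g. \<Sum>\<^sub>\<infinity>(g1, g2)\<in>{(g1, g2) \<in> composable G. gmult G g1 g2 = g}. f g1 * \<xi> g2)"


section \<open>The reduced C*-algebra\<close>

text \<open>
  Elements of \<open>\<ell>\<^sup>2(A)\<close> are functions on the whole type, extended by zero outside \<open>A\<close>.
\<close>

definition ell2 :: "'a set \<Rightarrow> ('a \<Rightarrow> complex) set"
  where "ell2 A = {\<xi>. (\<forall>a. a \<notin> A \<longrightarrow> \<xi> a = 0) \<and> (\<lambda>a. (cmod (\<xi> a))\<^sup>2) summable_on A}"

definition ell2_norm :: "'a set \<Rightarrow> ('a \<Rightarrow> complex) \<Rightarrow> real"
  where "ell2_norm A \<xi> = sqrt (\<Sum>\<^sub>\<infinity>a\<in>A. (cmod (\<xi> a))\<^sup>2)"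

definition ell2_inner :: "'a set \<Rightarrow> ('a \<Rightarrow> complex) \<Rightarrow> ('a \<Rightarrow> complex) \<Rightarrow> complex"
  where "ell2_inner A \<xi> \<eta> = (\<Sum>\<^sub>\<infinity>a\<in>A. \<xi> a * cnj (\<eta> a))"

definition delta :: "'a \<Rightarrow> 'a \<Rightarrow> complex"
  where "delta a = (\<lambda>b. if b = a then 1 else 0)"

definition ell2_opnorm :: "'a set \<Rightarrow> (('a \<Rightarrow> complex) \<Rightarrow> 'a \<Rightarrow> complex) \<Rightarrow> real"
  where "ell2_opnorm A T = (SUP \<xi>\<in>{\<xi> \<in> ell2 A. ell2_norm A \<xi> \<le> 1}. ell2_norm A (T \<xi>))"

text \<open>
  The regular representation \<open>\<pi>\<^sub>x\<close> on \<open>\<ell>\<^sup>2(G\<^sub>x)\<close> is \<open>\<xi> \<mapsto> convolution G f \<xi>\<close>.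
\<close>

definition red_norm :: "'g topgroupoid \<Rightarrow> ('g \<Rightarrow> complex) \<Rightarrow> real"
  where "red_norm G f = (SUP x\<in>units G. ell2_opnorm (src_fibre G x) (convolution G f))"

text \<open>
  The completion of \<open>Cc G\<close>: Cauchy sequences modulo null sequences. Its elements are
  equivalence classes, that is, sets of sequences.
\<close>

definition red_Cauchy :: "'g topgroupoid \<Rightarrow> (nat \<Rightarrow> 'g \<Rightarrow> complex) set"
  where "red_Cauchy G = {F. (\<forall>n. F n \<in> Cc G) \<and>
    (\<forall>\<epsilon>>0. \<exists>N. \<forall>m\<ge>N. \<forall>n\<ge>N. red_norm G (F m - F n) < \<epsilon>)}"

definition red_equiv ::
    "'g topgroupoid \<Rightarrow> ((nat \<Rightarrow> 'g \<Rightarrow> complex) \<times> (nat \<Rightarrow> 'g \<Rightarrow> complex)) set"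
  where "red_equiv G = {(F, F'). F \<in> red_Cauchy G \<and> F' \<in> red_Cauchy G \<and>
    (\<lambda>n. red_norm G (F n - F' n)) \<longlonglongrightarrow> 0}"

definition Cred :: "'g topgroupoid \<Rightarrow> (nat \<Rightarrow> 'g \<Rightarrow> complex) set set"
  where "Cred G = red_Cauchy G // red_equiv G"

definition Cred_of :: "'g topgroupoid \<Rightarrow> ('g \<Rightarrow> complex) \<Rightarrow> (nat \<Rightarrow> 'g \<Rightarrow> complex) set"
  where "Cred_of G f = red_equiv G `` {\<lambda>n. f}"

definition Cred_zero :: "'g topgroupoid \<Rightarrow> (nat \<Rightarrow> 'g \<Rightarrow> complex) set"
  where "Cred_zero G = Cred_of G 0"

text \<open>
  The continuous extension of \<open>\<pi>\<^sub>x\<close> to the completion, as the limit in \<open>\<ell>\<^sup>2(G\<^sub>x)\<close> along any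
  representing Cauchy sequence.
\<close>

definition reg_rep ::
    "'g topgroupoid \<Rightarrow> 'g \<Rightarrow> (nat \<Rightarrow> 'g \<Rightarrow> complex) set \<Rightarrow> ('g \<Rightarrow> complex) \<Rightarrow> 'g \<Rightarrow> complex"
  where "reg_rep G x a \<xi> = (THE \<eta>. \<eta> \<in> ell2 (src_fibre G x) \<and>
    (\<forall>F\<in>a. (\<lambda>n. ell2_norm (src_fibre G x) (convolution G (F n) \<xi> - \<eta>)) \<longlonglongrightarrow> 0))"

definition Cred_fun :: "'g topgroupoid \<Rightarrow> (nat \<Rightarrow> 'g \<Rightarrow> complex) set \<Rightarrow> 'g \<Rightarrow> complex"
  where "Cred_fun G a g = ell2_inner (src_fibre G (src G g))
    (reg_rep G (src G g) a (delta (src G g))) (delta g)"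

definition open_supp :: "'g topgroupoid \<Rightarrow> (nat \<Rightarrow> 'g \<Rightarrow> complex) set \<Rightarrow> 'g set"
  where "open_supp G a = {g \<in> arrows G. Cred_fun G a g \<noteq> 0}"

definition singular_ideal :: "'g topgroupoid \<Rightarrow> (nat \<Rightarrow> 'g \<Rightarrow> complex) set set"
  where "singular_ideal G =
    {a \<in> Cred G. units_top G interior_of (src G ` open_supp G a) = {}}"


section \<open>The condition on open bisections\<close>

text \<open>
  The space \<open>\<rat>\<^sup>n\<close> is realised as the rational functions on \<open>nat\<close> supported in \<open>{1..n}\<close>.
\<close>

definition rat_space :: "nat \<Rightarrow> (nat \<Rightarrow> rat) set"
  where "rat_space n = {v. \<forall>i. i \<notin> {1..n} \<longrightarrow> v i = 0}"

definition std_basis :: "nat \<Rightarrow> nat \<Rightarrow> rat"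
  where "std_basis i = (\<lambda>j. if j = i then 1 else 0)"

definition cond_S0 :: "'g topgroupoid \<Rightarrow> bool"
  where "cond_S0 G \<longleftrightarrow> (\<exists>(n::nat) U. n > 0 \<and>
    (\<forall>i\<in>{1..n}. open_bisection G (U i)) \<and>
    (\<forall>i\<in>{1..n}. \<forall>j\<in>{1..n}. src G ` U i = src G ` U j) \<and>
    (\<forall>i\<in>{1..n}. U i - (\<Union>j\<in>{1..n} - {i}. U j) \<noteq> {} \<and>
       gtop G interior_of (U i - (\<Union>j\<in>{1..n} - {i}. U j)) = {}) \<and>
    fun_vs.span {\<Sum>i\<in>I. std_basis i | I.
       I \<subseteq> {1..n} \<and> card I > 1 \<and> (\<Inter>i\<in>I. U i) - (\<Union>j\<in>{1..n} - I. U j) \<noteq> {}}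
      \<noteq> rat_space n)"

end

theory Submission
  imports Defs "HOL-Algebra.Group"
begin

text \<open>
  If \<open>cond_S0 G\<close> holds, choose a nonzero rational vector \<open>q\<close> orthogonal to all the \<open>b\<^sub>I\<close> and a bump
  function \<open>\<phi>\<close> on the common source of the \<open>U\<^sub>i\<close>. Then \<open>\<Sum>\<^sub>i q\<^sub>i (\<phi> \<circ> s) 1\<^bsub>U\<^sub>i\<^esub>\<close> is a nonzero element of \<open>Cc G\<close>
  supported on the sets \<open>U\<^sub>i - \<Union>\<^bsub>j\<noteq>i\<^esub> U\<^sub>j\<close>, whose sources are nowhere dense.

  Conversely let \<open>f\<close> be a uniform limit of functions in \<open>Cc G\<close> with \<open>f g\<^sub>0 \<noteq> 0\<close> whose support has source
  with empty interior. If \<open>g\<close> and \<open>h\<close> have no disjoint neighbourhoods, then \<open>g h\<inverse>\<close> is an isotropy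
  element in the closure of the units. At each unit these elements form a finite set, which is
  invariant under conjugation and consists of torsion elements, so by Dietzmann's lemma it generates
  a finite group. Hence \<open>g\<^sub>0\<close> lies in a finite subset \<open>F\<close> of its source fibre that is closed under
  inseparability. Near \<open>F\<close> the values of \<open>f\<close> are approximately the sums of \<open>f\<close> over those \<open>g \<in> F\<close> whose
  bisections \<open>U\<^sub>g\<close> contain the given point. Composing with a \<open>\<rat>\<close>-linear functional \<open>\<complex> \<rightarrow> \<rat>\<close> that
  does not vanish at \<open>f g\<^sub>0\<close> yields a nonzero rational combination of the \<open>1\<^bsub>U\<^sub>g\<^esub>\<close> with support inside that
  of \<open>f\<close>. At a unit where its fibrewise support is nonempty of minimal cardinality, merging the bisections
  that meet there produces the bisections required by \<open>cond_S0 G\<close>.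
\<close>


no_notation eq_closure_of (\<open>closure'_of\<index>\<close>)

section \<open>Dietzmann's lemma\<close>

text \<open>Moving \<open>c [^] k\<close> to the left past a letter \<open>a\<close> turns
  \<open>a\<close> into its conjugate by \<open>c [^] k\<close>, again a letter because
  \<open>C\<close> is closed under conjugation. The exact length is recorded so that a trivial power
  with \<open>k > 0\<close> yields a strictly shorter word with the same product.\<close>

lemma (in group) pull_power:
  assumes "c \<in> C" "C \<subseteq> carrier G" "\<And>g a. g \<in> carrier G \<Longrightarrow> a \<in> C \<Longrightarrow> inv g \<otimes> a \<otimes> g \<in> C"
  shows "ws \<in> lists C \<Longrightarrow> k \<le> count_list ws c \<Longrightarrow>
    \<exists>vs\<in>lists C. length vs + k = length ws \<and>
      foldr (\<otimes>) ws \<one> = c [^] k \<otimes> foldr (\<otimes>) vs \<one>"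
proof (induction ws arbitrary: k)
  case Nil
  then show ?case by auto
next
  case (Cons a ws)
  have fold_closed: "foldr (\<otimes>) vs \<one> \<in> carrier G" if "vs \<in> lists C" for vs
    using that assms(2) by (induction vs) auto
  have c: "c \<in> carrier G" and a: "a \<in> carrier G" using assms Cons by auto
  show ?case
  proof (cases "a = c \<and> k > 0")
    case True
    then obtain l where l: "k = Suc l" by (cases k) auto
    have "ws \<in> lists C" "l \<le> count_list ws c" using Cons.prems l True by auto
    from Cons.IH[OF this] obtain vs where vs: "vs \<in> lists C" "length vs + l = length ws"
      "foldr (\<otimes>) ws \<one> = c [^] l \<otimes> foldr (\<otimes>) vs \<one>" by blast
    have "foldr (\<otimes>) (a # ws) \<one> = c [^] k \<otimes> foldr (\<otimes>) vs \<one>"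
      using True vs c fold_closed[OF vs(1)] nat_pow_Suc2[OF c, of l]
      unfolding l by (simp add: m_assoc del: nat_pow_Suc)
    then show ?thesis using vs l by auto
  next
    case False
    then have "k \<le> count_list ws c" using Cons by (auto split: if_splits)
    moreover have "ws \<in> lists C" using Cons.prems by auto
    ultimately obtain vs where vs: "vs \<in> lists C" "length vs + k = length ws"
      "foldr (\<otimes>) ws \<one> = c [^] k \<otimes> foldr (\<otimes>) vs \<one>" using Cons.IH by blast
    let ?b = "inv (c [^] k) \<otimes> a \<otimes> c [^] k"
    have "?b \<in> C" using assms Cons c by auto
    moreover have "foldr (\<otimes>) (a # ws) \<one> = c [^] k \<otimes> foldr (\<otimes>) (?b # vs) \<one>"
      using vs c a fold_closed[OF vs(1)] by (simp add: m_assoc[symmetric])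
    ultimately show ?thesis using vs by (intro bexI[of _ "?b # vs"]) auto
  qed
qed

text \<open>A letter occurring as often as its exponent can be collected at the front, conjugating the
  letters that it passes, and then deleted.\<close>

lemma (in group) finite_products_of_normal_torsion_set:
  assumes fin: "finite C" and C: "C \<subseteq> carrier G"
    and conj: "\<And>g a. g \<in> carrier G \<Longrightarrow> a \<in> C \<Longrightarrow> inv g \<otimes> a \<otimes> g \<in> C"
    and tors: "\<And>a. a \<in> C \<Longrightarrow> \<exists>n>0. a [^] (n::nat) = \<one>"
  shows "finite ((\<lambda>ws. foldr (\<otimes>) ws \<one>) ` lists C)"
proof -
  obtain e where e: "\<And>a. a \<in> C \<Longrightarrow> 0 < e a \<and> a [^] (e a :: nat) = \<one>"
    using tors by metis
  \<comment> \<open>Pigeonhole bound: in a word longer than \<open>N\<close> some letter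
    \<open>c\<close> occurs at least \<open>e c\<close> times. Here \<open>e c\<close> is any
    positive exponent that kills \<open>c\<close>, not necessarily its order.\<close>
  define N where "N = sum e C"
  let ?p = "\<lambda>ws. foldr (\<otimes>) ws \<one>"
  have fold_closed: "?p vs \<in> carrier G" if "vs \<in> lists C" for vs
    using that C by (induction vs) auto
  have short: "\<exists>vs\<in>lists C. length vs \<le> N \<and> ?p vs = ?p ws" if "ws \<in> lists C" for ws
    using that
  proof (induction "length ws" arbitrary: ws rule: less_induct)
    case less
    show ?case
    proof (cases "length ws \<le> N")
      case False
      have "\<exists>c\<in>C. e c \<le> count_list ws c"
      proof (rule ccontr)
        assume "\<not> ?thesis"
        then have "sum (count_list ws) C \<le> N"
          unfolding N_def by (intro sum_mono) (auto simp: not_le less_imp_le)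
        moreover have "sum (count_list ws) C = length ws"
          using less.prems fin by (intro sum_count_set) auto
        ultimately show False using False by simp
      qed
      then obtain c where c: "c \<in> C" "e c \<le> count_list ws c" by blast
      obtain vs where vs: "vs \<in> lists C" "length vs + e c = length ws"
        "?p ws = c [^] e c \<otimes> ?p vs"
        using pull_power[OF c(1) C conj less.prems c(2)] by blast
      then have "?p ws = ?p vs" "length vs < length ws"
        using e[OF c(1)] fold_closed[OF vs(1)] by auto
      then show ?thesis using less.hyps[of vs] vs(1) by auto
    qed (use less.prems in blast)
  qed
  have "?p ` lists C \<subseteq> ?p ` {vs. set vs \<subseteq> C \<and> length vs \<le> N}"
  proof
    fix a assume "a \<in> ?p ` lists C"
    then obtain ws where "ws \<in> lists C" "a = ?p ws" by blast
    moreover from short[OF this(1)] obtain vs where "vs \<in> lists C" "length vs \<le> N" "?p vs = ?p ws"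
      by blast
    ultimately show "a \<in> ?p ` {vs. set vs \<subseteq> C \<and> length vs \<le> N}" by (auto simp: image_iff)
  qed
  then show ?thesis
    using finite_lists_length_le[OF fin, of N] finite_subset by blast
qed

section \<open>Rational linear algebra\<close>

text \<open>The functional is the coordinate at \<open>v\<close> in a basis of the whole space that
  extends a basis of \<open>span S\<close> enlarged by \<open>v\<close>.\<close>

lemma (in vector_space) annihilating_functional:
  assumes "v \<notin> span S"
  obtains \<phi> :: "'b \<Rightarrow> 'a" where "\<And>x y. \<phi> (x + y) = \<phi> x + \<phi> y" "\<And>x. x \<in> S \<Longrightarrow> \<phi> x = 0" "\<phi> v \<noteq> 0"
proof -
  obtain B where B: "B \<subseteq> S" "independent B" "S \<subseteq> span B"
    using maximal_independent_subset by blast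
  have v: "v \<notin> span B" using assms span_mono[OF B(1)] by blast
  define E where "E = extend_basis (insert v B)"
  have ind: "independent (insert v B)" using v B(2) by (rule independent_insertI)
  have E: "independent E" "span E = UNIV" "insert v B \<subseteq> E"
    using independent_extend_basis[OF ind] span_extend_basis[OF ind] extend_basis_superset[OF ind]
    by (auto simp: E_def)
  define \<phi> where "\<phi> w = representation E w v" for w
  have add: "\<phi> (x + y) = \<phi> x + \<phi> y" for x y
    using E by (simp add: \<phi>_def representation_add)
  have scale: "\<phi> (scale c x) = c * \<phi> x" for c x
    using E by (simp add: \<phi>_def representation_scale)
  have zero: "\<phi> 0 = 0" by (simp add: \<phi>_def representation_zero)
  have on_B: "\<phi> b = 0" if "b \<in> B" for b
    using E that v span_base[OF that] by (auto simp: \<phi>_def representation_basis)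
  have "\<phi> x = 0" if "x \<in> span B" for x
    using that by (induction rule: span_induct_alt) (auto simp: zero add scale on_B)
  moreover have "\<phi> v \<noteq> 0" using E by (simp add: \<phi>_def representation_basis)
  ultimately show ?thesis using that[of \<phi>] add B(3) by auto
qed

lemma additive_sum:
  fixes \<phi> :: "'a::ab_group_add \<Rightarrow> 'b::ab_group_add"
  assumes "\<And>x y. \<phi> (x + y) = \<phi> x + \<phi> y"
  shows "\<phi> (sum f A) = (\<Sum>a\<in>A. \<phi> (f a))"
proof -
  have "\<phi> 0 = 0" using assms[of 0 0] by simp
  then show ?thesis using assms by (induction A rule: infinite_finite_induct) auto
qed

text \<open>The complex numbers form a vector space over the rationals, in which a nonzero
  \<open>z\<close> is outside the span of the empty set. The later use of additivity is that a sum
  of complex values is nonzero as soon as its image under \<phi> is.\<close>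

lemma rational_functional:
  fixes z :: complex
  assumes "z \<noteq> 0"
  obtains \<phi> :: "complex \<Rightarrow> rat" where "\<And>x y. \<phi> (x + y) = \<phi> x + \<phi> y" "\<phi> z \<noteq> 0"
proof -
  interpret vector_space "\<lambda>(r::rat) (z::complex). of_rat r * z"
    by unfold_locales (auto simp: algebra_simps of_rat_add of_rat_mult)
  show ?thesis using annihilating_functional[of z "{}"] assms that by auto
qed

lemma sum_std_basis: "finite I \<Longrightarrow> (\<Sum>i\<in>I. std_basis i) j = (if j \<in> I then 1 else 0)"
  by (induction I rule: finite_induct) (auto simp: std_basis_def)

text \<open>The standard basis vectors span \<open>rat_space n\<close>, so one of them, with index
  \<open>k\<close>, escapes the span of \<open>S\<close>. A functional vanishing on \<open>S\<close>
  but not on that vector supplies \<open>q\<close> as its values on the basis.\<close>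

lemma ex_annihilator:
  assumes S: "S \<subseteq> rat_space n" and ne: "fun_vs.span S \<noteq> rat_space n"
  obtains q :: "nat \<Rightarrow> rat" and k where "k \<in> {1..n}" "q k \<noteq> 0"
    "\<forall>I. (\<Sum>i\<in>I. std_basis i) \<in> S \<longrightarrow> (\<Sum>i\<in>I. q i) = 0"
proof -
  have "fun_vs.subspace (rat_space n)"
    by (auto simp: fun_vs.subspace_def rat_space_def fun_scale_def)
  then have "fun_vs.span S \<subseteq> rat_space n" using S fun_vs.span_minimal by blast
  have "\<exists>k\<in>{1..n}. std_basis k \<notin> fun_vs.span S"
  proof (rule ccontr)
    assume "\<not> ?thesis"
    then have b: "std_basis k \<in> fun_vs.span S" if "k \<in> {1..n}" for k using that by blast
    have "v \<in> fun_vs.span S" if v: "v \<in> rat_space n" for v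
    proof -
      have "(\<Sum>k\<in>A. fun_scale (v k) (std_basis k)) j = (if j \<in> A then v j else 0)"
        if "finite A" for A j
        using that by (induction A rule: finite_induct) (auto simp: std_basis_def fun_scale_def)
      then have "v = (\<Sum>k\<in>{1..n}. fun_scale (v k) (std_basis k))"
        using v by (auto simp: rat_space_def fun_eq_iff)
      also have "\<dots> \<in> fun_vs.span S"
        by (intro fun_vs.span_sum fun_vs.span_scale b)
      finally show ?thesis .
    qed
    then show False using ne \<open>fun_vs.span S \<subseteq> rat_space n\<close> by blast
  qed
  then obtain k where k: "k \<in> {1..n}" "std_basis k \<notin> fun_vs.span S" by blast
  obtain \<phi> :: "(nat \<Rightarrow> rat) \<Rightarrow> rat" where \<phi>: "\<And>x y. \<phi> (x + y) = \<phi> x + \<phi> y"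
    "\<And>x. x \<in> S \<Longrightarrow> \<phi> x = 0" "\<phi> (std_basis k) \<noteq> 0"
    using fun_vs.annihilating_functional[OF k(2)] by blast
  show ?thesis
    by (rule that[OF k(1), of "\<lambda>i. \<phi> (std_basis i)"])
      (use \<phi> additive_sum[of \<phi> std_basis, OF \<phi>(1)] in \<open>metis+\<close>)
qed

text \<open>Counterpart of \<open>ex_annihilator\<close>: the linear form with coefficients
  \<open>q\<close> kills the span of \<open>S\<close> but takes the nonzero value \<open>q k\<close>
  on a basis vector.\<close>

lemma span_ne_rat_space:
  fixes q :: "nat \<Rightarrow> rat"
  assumes "k \<in> {1..n}" "q k \<noteq> 0" "\<And>v. v \<in> S \<Longrightarrow> (\<Sum>i=1..n. q i * v i) = 0"
  shows "fun_vs.span S \<noteq> rat_space n"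
proof
  assume "fun_vs.span S = rat_space n"
  then have "std_basis k \<in> fun_vs.span S" using assms(1) by (auto simp: rat_space_def std_basis_def)
  then have "(\<Sum>i=1..n. q i * std_basis k i) = 0"
  proof (induction rule: fun_vs.span_induct_alt)
    case (step c x y)
    have "(\<Sum>i=1..n. q i * (fun_scale c x + y) i) = c * (\<Sum>i=1..n. q i * x i) + (\<Sum>i=1..n. q i * y i)"
      by (simp add: fun_scale_def sum_distrib_left sum.distrib[symmetric] algebra_simps)
    then show ?case using step assms(3) by simp
  qed simp
  moreover have "(\<Sum>i=1..n. q i * std_basis k i) = (\<Sum>i=1..n. if i = k then q k else 0)"
    by (intro sum.cong) (auto simp: std_basis_def)
  ultimately show False using assms by simp
qed

section \<open>Square-summable functions\<close>

text \<open>A sum of nonnegative terms is the supremum of its finite partial sums. Reducing to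
  finite sets \<open>S\<close> makes the triangle inequality for \<open>L2_set\<close> and
  coordinatewise limits available.\<close>

lemma ell2_normI:
  assumes "\<And>a. a \<notin> A \<Longrightarrow> \<xi> a = 0"
    and "\<And>S. finite S \<Longrightarrow> S \<subseteq> A \<Longrightarrow> L2_set (\<lambda>a. cmod (\<xi> a)) S \<le> c"
  shows "\<xi> \<in> ell2 A" "ell2_norm A \<xi> \<le> c"
proof -
  have c: "c \<ge> 0" using assms(2)[of "{}"] by simp
  have bound: "(\<Sum>a\<in>S. (cmod (\<xi> a))\<^sup>2) \<le> c\<^sup>2" if "finite S" "S \<subseteq> A" for S
    using assms(2)[OF that] c unfolding L2_set_def by (metis real_le_lsqrt real_sqrt_le_iff sqrt_le_D)
  have s: "(\<lambda>a. (cmod (\<xi> a))\<^sup>2) summable_on A"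
  proof (rule nonneg_bdd_above_summable_on)
    show "bdd_above (sum (\<lambda>a. (cmod (\<xi> a))\<^sup>2) ` {F. F \<subseteq> A \<and> finite F})"
      using bound by (intro bdd_aboveI2) blast
  qed simp
  then show "\<xi> \<in> ell2 A" using assms(1) by (simp add: ell2_def)
  have "(\<Sum>\<^sub>\<infinity>a\<in>A. (cmod (\<xi> a))\<^sup>2) \<le> c\<^sup>2"
    using s bound by (rule infsum_le_finite_sums)
  then show "ell2_norm A \<xi> \<le> c" unfolding ell2_norm_def using c by (rule real_le_lsqrt[rotated])
qed

lemma L2_set_le_ell2_norm:
  assumes "\<xi> \<in> ell2 A" "finite S" "S \<subseteq> A"
  shows "L2_set (\<lambda>a. cmod (\<xi> a)) S \<le> ell2_norm A \<xi>"
  unfolding L2_set_def ell2_norm_def using assms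
  by (intro real_sqrt_le_mono finite_sum_le_infsum) (auto simp: ell2_def)

lemma ell2_norm_nonneg: "0 \<le> ell2_norm A \<xi>"
  unfolding ell2_norm_def by (intro real_sqrt_ge_zero infsum_nonneg) simp

lemma ell2_outside: "\<xi> \<in> ell2 A \<Longrightarrow> a \<notin> A \<Longrightarrow> \<xi> a = 0"
  by (simp add: ell2_def)

lemma cmod_le_ell2_norm: "\<xi> \<in> ell2 A \<Longrightarrow> cmod (\<xi> a) \<le> ell2_norm A \<xi>"
  using L2_set_le_ell2_norm[of \<xi> A "{a}"] ell2_outside[of \<xi> A a] ell2_norm_nonneg[of A \<xi>]
  by (cases "a \<in> A") auto

lemma ell2_add:
  assumes "\<xi> \<in> ell2 A" "\<eta> \<in> ell2 A"
  shows "\<xi> + \<eta> \<in> ell2 A" "ell2_norm A (\<xi> + \<eta>) \<le> ell2_norm A \<xi> + ell2_norm A \<eta>"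
proof -
  have out: "(\<xi> + \<eta>) a = 0" if "a \<notin> A" for a using that assms by (simp add: ell2_outside)
  have le: "L2_set (\<lambda>a. cmod ((\<xi> + \<eta>) a)) S \<le> ell2_norm A \<xi> + ell2_norm A \<eta>"
    if S: "finite S" "S \<subseteq> A" for S
  proof -
    have "L2_set (\<lambda>a. cmod ((\<xi> + \<eta>) a)) S \<le> L2_set (\<lambda>a. cmod (\<xi> a) + cmod (\<eta> a)) S"
      by (rule L2_set_mono) (auto simp: norm_triangle_ineq)
    also have "\<dots> \<le> L2_set (\<lambda>a. cmod (\<xi> a)) S + L2_set (\<lambda>a. cmod (\<eta> a)) S"
      by (rule L2_set_triangle_ineq)
    also have "\<dots> \<le> ell2_norm A \<xi> + ell2_norm A \<eta>"
      using assms S by (intro add_mono L2_set_le_ell2_norm)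
    finally show ?thesis .
  qed
  show "\<xi> + \<eta> \<in> ell2 A" "ell2_norm A (\<xi> + \<eta>) \<le> ell2_norm A \<xi> + ell2_norm A \<eta>"
    using ell2_normI[OF out le] by blast+
qed

lemma ell2_scale:
  assumes "\<xi> \<in> ell2 A"
  shows "fun_scale c \<xi> \<in> ell2 A" "ell2_norm A (fun_scale c \<xi>) \<le> cmod c * ell2_norm A \<xi>"
proof -
  have out: "fun_scale c \<xi> a = 0" if "a \<notin> A" for a
    using that assms by (simp add: ell2_outside fun_scale_def)
  have le: "L2_set (\<lambda>a. cmod (fun_scale c \<xi> a)) S \<le> cmod c * ell2_norm A \<xi>" if "finite S" "S \<subseteq> A" for S
    using L2_set_le_ell2_norm[OF assms that]
    by (simp add: fun_scale_def norm_mult L2_set_right_distrib[symmetric] mult_left_mono)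
  show "fun_scale c \<xi> \<in> ell2 A" "ell2_norm A (fun_scale c \<xi>) \<le> cmod c * ell2_norm A \<xi>"
    using ell2_normI[OF out le] by blast+
qed

lemma ell2_norm_minus: "ell2_norm A (\<xi> - \<eta>) = ell2_norm A (\<eta> - \<xi>)"
  by (simp add: ell2_norm_def norm_minus_commute)

lemma ell2_zero [simp]: "0 \<in> ell2 A" "ell2_norm A 0 = 0"
  by (auto simp: ell2_def ell2_norm_def)

lemma ell2_delta:
  assumes "x \<in> A"
  shows "delta x \<in> ell2 A" "ell2_norm A (delta x) \<le> 1"
proof -
  have out: "delta x a = 0" if "a \<notin> A" for a using that assms by (auto simp: delta_def)
  have le: "L2_set (\<lambda>a. cmod (delta x a)) S \<le> 1" if "finite S" "S \<subseteq> A" for S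
  proof -
    have "(\<Sum>a\<in>S. (cmod (delta x a))\<^sup>2) = (\<Sum>a\<in>S. if a = x then 1 else 0)"
      by (intro sum.cong) (auto simp: delta_def)
    also have "\<dots> \<le> 1" using that by simp
    finally show ?thesis by (simp add: L2_set_def)
  qed
  show "delta x \<in> ell2 A" "ell2_norm A (delta x) \<le> 1"
    using ell2_normI[OF out le] by blast+
qed

lemma infsum_supported_single:
  fixes f :: "'a \<Rightarrow> complex"
  assumes "a \<in> A" "\<And>b. b \<in> A \<Longrightarrow> b \<noteq> a \<Longrightarrow> f b = 0"
  shows "infsum f A = f a"
  by (rule infsumI, rule has_sum_finite_neutralI[of "{a}"]) (use assms in auto)

section \<open>Topology of etale groupoids\<close>

locale etale_gpd =
  fixes G :: "'g topgroupoid"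
  assumes etale: "etale_groupoid G"
begin

lemma top_gpd: "topological_groupoid G" and gpd: "groupoid G"
  using etale by (auto simp: etale_groupoid_def topological_groupoid_def)

lemma unit_arrow: "x \<in> units G \<Longrightarrow> x \<in> arrows G"
  and rng_unit [simp]: "x \<in> units G \<Longrightarrow> rng G x = x"
  and src_unit [simp]: "x \<in> units G \<Longrightarrow> src G x = x"
  and rng_in [simp]: "g \<in> arrows G \<Longrightarrow> rng G g \<in> units G"
  and src_in [simp]: "g \<in> arrows G \<Longrightarrow> src G g \<in> units G"
  and mult_in [simp]: "g \<in> arrows G \<Longrightarrow> h \<in> arrows G \<Longrightarrow> src G g = rng G h \<Longrightarrow> gmult G g h \<in> arrows G"
  and rng_mult [simp]: "g \<in> arrows G \<Longrightarrow> h \<in> arrows G \<Longrightarrow> src G g = rng G h \<Longrightarrow> rng G (gmult G g h) = rng G g"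
  and src_mult [simp]: "g \<in> arrows G \<Longrightarrow> h \<in> arrows G \<Longrightarrow> src G g = rng G h \<Longrightarrow> src G (gmult G g h) = src G h"
  and unit_left [simp]: "g \<in> arrows G \<Longrightarrow> gmult G (rng G g) g = g"
  and unit_right [simp]: "g \<in> arrows G \<Longrightarrow> gmult G g (src G g) = g"
  and inv_in [simp]: "g \<in> arrows G \<Longrightarrow> ginv G g \<in> arrows G"
  and rng_inv [simp]: "g \<in> arrows G \<Longrightarrow> rng G (ginv G g) = src G g"
  and src_inv [simp]: "g \<in> arrows G \<Longrightarrow> src G (ginv G g) = rng G g"
  and mult_inv [simp]: "g \<in> arrows G \<Longrightarrow> gmult G g (ginv G g) = rng G g"
  and inv_mult [simp]: "g \<in> arrows G \<Longrightarrow> gmult G (ginv G g) g = src G g"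
  using gpd unfolding groupoid_def composable_def by (auto simp: Pi_iff)

lemma mult_assoc: "g \<in> arrows G \<Longrightarrow> h \<in> arrows G \<Longrightarrow> k \<in> arrows G \<Longrightarrow> src G g = rng G h \<Longrightarrow>
    src G h = rng G k \<Longrightarrow> gmult G (gmult G g h) k = gmult G g (gmult G h k)"
  using gpd unfolding groupoid_def composable_def by simp

lemma mult_unit_right: "g \<in> arrows G \<Longrightarrow> src G g = x \<Longrightarrow> gmult G g x = g"
  and mult_unit_left: "g \<in> arrows G \<Longrightarrow> rng G g = x \<Longrightarrow> gmult G x g = g"
  by auto

lemma mult_inv_cancel:
  assumes "g \<in> arrows G" "h \<in> arrows G" "src G g = src G h"
  shows "gmult G (gmult G g (ginv G h)) h = g"
  using assms by (simp add: mult_assoc mult_unit_right)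

lemma mult_cancel_inv:
  assumes "g \<in> arrows G" "h \<in> arrows G" "src G g = rng G h"
  shows "gmult G (gmult G g h) (ginv G h) = g"
  using assms by (simp add: mult_assoc mult_unit_right)

lemma left_inverse_unique:
  assumes "g \<in> arrows G" "h \<in> arrows G" "src G g = rng G h" "gmult G g h = src G h"
  shows "g = ginv G h"
  using mult_cancel_inv[OF assms(1-3)] mult_unit_left[of "ginv G h" "src G h"] assms by simp

lemma inv_inv [simp]: "g \<in> arrows G \<Longrightarrow> ginv G (ginv G g) = g"
  using left_inverse_unique[of g "ginv G g"] by simp

lemma inv_unit [simp]: "x \<in> units G \<Longrightarrow> ginv G x = x"
  using left_inverse_unique[of x x] unit_right[of x] by (simp add: unit_arrow del: unit_right)

lemma arrows_mult_inv_eq: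
  assumes "g \<in> arrows G" "h \<in> arrows G" "k \<in> arrows G" "src G h = src G g" "src G k = src G g"
    "gmult G g (ginv G h) = gmult G g (ginv G k)"
  shows "h = k"
proof -
  have eq: "ginv G l = gmult G (ginv G g) (gmult G g (ginv G l))"
    if "l \<in> arrows G" "src G l = src G g" for l
    using that assms(1) mult_assoc[of "ginv G g" g "ginv G l"]
    by (simp add: mult_unit_left)
  have "ginv G h = ginv G k" using eq[of h] eq[of k] assms by simp
  then show ?thesis using inv_inv assms by metis
qed

lemma cont_rng: "continuous_map (gtop G) (gtop G) (rng G)"
  and cont_src: "continuous_map (gtop G) (gtop G) (src G)"
  and cont_inv: "continuous_map (gtop G) (gtop G) (ginv G)"
  and Hausdorff_units: "Hausdorff_space (units_top G)"
  using top_gpd by (auto simp: topological_groupoid_def continuous_map_in_subtopology)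

lemma topspace_units [simp]: "topspace (units_top G) = units G"
  using unit_arrow by (auto simp: topspace_subtopology)

lemma openin_src_vimage: "openin (gtop G) W \<Longrightarrow> openin (gtop G) {g \<in> arrows G. src G g \<in> W}"
  and openin_rng_vimage: "openin (gtop G) W \<Longrightarrow> openin (gtop G) {g \<in> arrows G. rng G g \<in> W}"
  and openin_inv_vimage: "openin (gtop G) W \<Longrightarrow> openin (gtop G) {g \<in> arrows G. ginv G g \<in> W}"
  using cont_rng cont_src cont_inv by (auto simp: continuous_map)

lemma rng_local_homeo:
  assumes "g \<in> arrows G"
  obtains U where "openin (gtop G) U" "g \<in> U" "openin (units_top G) (rng G ` U)" "inj_on (rng G) U"
    "\<And>W. openin (gtop G) W \<Longrightarrow> openin (units_top G) (rng G ` (W \<inter> U))"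
proof -
  from assms etale obtain U where U: "openin (gtop G) U" "g \<in> U" "openin (units_top G) (rng G ` U)"
    "homeomorphic_map (subtopology (gtop G) U) (subtopology (units_top G) (rng G ` U)) (rng G)"
    unfolding etale_groupoid_def local_homeomorphism_def by blast
  have UA: "U \<subseteq> arrows G" using U(1) openin_subset by blast
  then have "inj_on (rng G) U" using homeomorphic_imp_injective_map[OF U(4)]
    by (simp add: topspace_subtopology Int_absorb1)
  moreover have "openin (units_top G) (rng G ` (W \<inter> U))" if "openin (gtop G) W" for W
  proof -
    have "openin (subtopology (gtop G) U) (W \<inter> U)" using that by (auto simp: openin_subtopology)
    then have "openin (subtopology (units_top G) (rng G ` U)) (rng G ` (W \<inter> U))"
      using homeomorphic_imp_open_map[OF U(4)] by (auto simp: open_map_def)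
    then show ?thesis using U(3) openin_trans_full by blast
  qed
  ultimately show ?thesis using that U by blast
qed

text \<open>Near a unit there is an open \<open>U\<close> on which \<open>rng G\<close> is
  injective. If \<open>u\<close> and \<open>rng G u\<close> both lie in \<open>U\<close>, they have
  the same range and therefore coincide, so \<open>u\<close> is a unit.\<close>

lemma units_open: "openin (gtop G) (units G)"
proof (subst openin_subopen, safe)
  fix x assume x: "x \<in> units G"
  then obtain U where U: "openin (gtop G) U" "x \<in> U" "inj_on (rng G) U"
    using rng_local_homeo unit_arrow by metis
  have UA: "U \<subseteq> arrows G" using U(1) openin_subset by blast
  let ?V = "U \<inter> {g \<in> arrows G. rng G g \<in> U}"
  have "openin (gtop G) ?V" using U openin_rng_vimage by blast
  moreover have "x \<in> ?V" using x U unit_arrow by simp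
  moreover have "?V \<subseteq> units G"
  proof
    fix u assume u: "u \<in> ?V"
    then have "rng G (rng G u) = rng G u" by simp
    then have "rng G u = u" using inj_onD[OF U(3)] u by blast
    then show "u \<in> units G" using u rng_in by (metis (lifting) IntD2 mem_Collect_eq)
  qed
  ultimately show "\<exists>T. openin (gtop G) T \<and> x \<in> T \<and> T \<subseteq> units G" by blast
qed

lemma openin_units_iff: "openin (units_top G) W \<longleftrightarrow> openin (gtop G) W \<and> W \<subseteq> units G"
  using units_open openin_open_subtopology by blast

lemma open_map_rng: assumes "openin (gtop G) S" shows "openin (gtop G) (rng G ` S)"
proof (subst openin_subopen, safe)
  fix g assume g: "g \<in> S"
  then have "g \<in> arrows G" using assms openin_subset by blast
  then obtain U where U: "g \<in> U" "\<And>W. openin (gtop G) W \<Longrightarrow> openin (units_top G) (rng G ` (W \<inter> U))"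
    using rng_local_homeo by metis
  show "\<exists>T. openin (gtop G) T \<and> rng G g \<in> T \<and> T \<subseteq> rng G ` S"
    using U(2)[OF assms] U(1) g openin_units_iff by (intro exI[of _ "rng G ` (S \<inter> U)"]) auto
qed

lemma open_map_src: assumes "openin (gtop G) S" shows "openin (gtop G) (src G ` S)"
proof -
  have sub: "S \<subseteq> arrows G" using assms openin_subset by blast
  let ?I = "{g \<in> arrows G. ginv G g \<in> S}"
  have "src G ` S = rng G ` ?I"
  proof (intro equalityI subsetI)
    fix x assume "x \<in> src G ` S"
    then obtain g where g: "g \<in> S" "x = src G g" by blast
    then have "ginv G g \<in> ?I" "x = rng G (ginv G g)" using sub by auto
    then show "x \<in> rng G ` ?I" by blast
  next
    fix x assume "x \<in> rng G ` ?I"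
    then obtain g where g: "g \<in> arrows G" "ginv G g \<in> S" "x = rng G g" by blast
    then have "x = src G (ginv G g)" by simp
    then show "x \<in> src G ` S" using g by blast
  qed
  then show ?thesis using open_map_rng[OF openin_inv_vimage[OF assms]] by simp
qed

lemma bisection_subset: "open_bisection G U \<Longrightarrow> openin (gtop G) V \<Longrightarrow> V \<subseteq> U \<Longrightarrow> open_bisection G V"
  unfolding open_bisection_def by (meson inj_on_subset)

text \<open>Local injectivity of the source map near \<open>g\<close> is local injectivity of the
  range map near \<open>ginv G g\<close>, transported by inversion.\<close>

lemma bisection_base:
  assumes "openin (gtop G) S" "g \<in> S"
  obtains U where "open_bisection G U" "g \<in> U" "U \<subseteq> S"
proof -
  have g: "g \<in> arrows G" using assms openin_subset by blast
  obtain U where U: "openin (gtop G) U" "g \<in> U" "inj_on (rng G) U" using rng_local_homeo[OF g] by metis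
  obtain V where V: "openin (gtop G) V" "ginv G g \<in> V" "inj_on (rng G) V"
    using rng_local_homeo[OF inv_in[OF g]] by metis
  let ?W = "S \<inter> U \<inter> {h \<in> arrows G. ginv G h \<in> V}"
  have "inj_on (src G) ?W"
  proof (rule inj_onI)
    fix a b assume ab: "a \<in> ?W" "b \<in> ?W" "src G a = src G b"
    then have "rng G (ginv G a) = rng G (ginv G b)" by simp
    then have "ginv G a = ginv G b" using inj_onD[OF V(3)] ab by blast
    then show "a = b" using ab inv_inv by (metis (lifting) IntD2 mem_Collect_eq)
  qed
  moreover have "inj_on (rng G) ?W" by (rule inj_on_subset[OF U(3)]) blast
  moreover have "openin (gtop G) ?W" using assms U V openin_inv_vimage by blast
  ultimately have "open_bisection G ?W" unfolding open_bisection_def by blast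
  moreover have "g \<in> ?W" using assms U V g by simp
  moreover have "?W \<subseteq> S" by blast
  ultimately show ?thesis by (rule that)
qed

lemma bisection_arrows: "open_bisection G U \<Longrightarrow> g \<in> U \<Longrightarrow> g \<in> arrows G"
  unfolding open_bisection_def using openin_subset by blast

lemma bisection_open: "open_bisection G U \<Longrightarrow> openin (gtop G) U"
  by (simp add: open_bisection_def)

lemma bisection_src_eq: "open_bisection G U \<Longrightarrow> g \<in> U \<Longrightarrow> h \<in> U \<Longrightarrow> src G g = src G h \<Longrightarrow> g = h"
  and bisection_rng_eq: "open_bisection G U \<Longrightarrow> g \<in> U \<Longrightarrow> h \<in> U \<Longrightarrow> rng G g = rng G h \<Longrightarrow> g = h"
  by (auto simp: open_bisection_def dest: inj_onD)

lemma mult_continuous: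
  assumes "g \<in> arrows G" "h \<in> arrows G" "src G g = rng G h" "openin (gtop G) N" "gmult G g h \<in> N"
  obtains O1 O2 where "openin (gtop G) O1" "openin (gtop G) O2" "g \<in> O1" "h \<in> O2"
    "\<And>a b. a \<in> O1 \<Longrightarrow> b \<in> O2 \<Longrightarrow> src G a = rng G b \<Longrightarrow> gmult G a b \<in> N"
proof -
  let ?P = "prod_topology (gtop G) (gtop G)"
  have "continuous_map (subtopology ?P (composable G)) (gtop G) (\<lambda>(g, h). gmult G g h)"
    using top_gpd by (simp add: topological_groupoid_def)
  then have "openin (subtopology ?P (composable G))
      {p \<in> topspace (subtopology ?P (composable G)). (\<lambda>(g, h). gmult G g h) p \<in> N}"
    using assms(4) by (auto simp: continuous_map)
  then obtain T where T: "openin ?P T" and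
    Teq: "{p \<in> topspace (subtopology ?P (composable G)). (\<lambda>(g, h). gmult G g h) p \<in> N} = T \<inter> composable G"
    unfolding openin_subtopology by blast
  have ts: "topspace (subtopology ?P (composable G)) = composable G"
    by (auto simp: topspace_subtopology composable_def)
  have Tiff: "(a, b) \<in> T \<longleftrightarrow> gmult G a b \<in> N" if "(a, b) \<in> composable G" for a b
    using that Teq[unfolded ts] by (auto simp: set_eq_iff)
  have gh: "(g, h) \<in> T" using assms Tiff by (simp add: composable_def)
  then obtain O1 O2 where S: "openin (gtop G) O1" "openin (gtop G) O2" "g \<in> O1" "h \<in> O2" "O1 \<times> O2 \<subseteq> T"
    using T[unfolded openin_prod_topology_alt, rule_format, OF gh] by blast
  show ?thesis
  proof (rule that[OF S(1-4)])
    fix a b assume ab: "a \<in> O1" "b \<in> O2" "src G a = rng G b"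
    have "(a, b) \<in> composable G"
      using ab openin_subset[OF S(1)] openin_subset[OF S(2)] by (auto simp: composable_def)
    moreover have "(a, b) \<in> T" using ab S(5) by blast
    ultimately show "gmult G a b \<in> N" using Tiff by blast
  qed
qed

lemma units_separate:
  assumes "x \<in> units G" "y \<in> units G" "x \<noteq> y"
  obtains A B where "openin (gtop G) A" "openin (gtop G) B" "x \<in> A" "y \<in> B" "A \<inter> B = {}"
  using Hausdorff_units assms openin_units_iff
  unfolding Hausdorff_space_def disjnt_def topspace_units by metis

section \<open>Inseparable elements\<close>

text \<open>The relation is reflexive and symmetric but in general not transitive. Finiteness of the
  set of arrows inseparable from a given one therefore does not by itself bound what is reached by
  iterating the relation.\<close>

definition inseparable :: "'g \<Rightarrow> 'g \<Rightarrow> bool"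
  where "inseparable g h \<longleftrightarrow>
    (\<forall>A B. openin (gtop G) A \<and> openin (gtop G) B \<and> g \<in> A \<and> h \<in> B \<longrightarrow> A \<inter> B \<noteq> {})"

definition isotropy :: "'g \<Rightarrow> 'g monoid"
  where "isotropy x = \<lparr>carrier = {g \<in> arrows G. rng G g = x \<and> src G g = x}, mult = gmult G, one = x\<rparr>"

lemma inseparable_src:
  assumes "g \<in> arrows G" "h \<in> arrows G" "inseparable g h"
  shows "src G g = src G h"
proof (rule ccontr)
  assume "src G g \<noteq> src G h"
  then obtain A B where AB: "openin (gtop G) A" "openin (gtop G) B" "src G g \<in> A" "src G h \<in> B" "A \<inter> B = {}"
    using units_separate[of "src G g" "src G h"] assms by auto
  have "{k \<in> arrows G. src G k \<in> A} \<inter> {k \<in> arrows G. src G k \<in> B} \<noteq> {}"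
    using assms(3)[unfolded inseparable_def, rule_format,
      of "{k \<in> arrows G. src G k \<in> A}" "{k \<in> arrows G. src G k \<in> B}"]
      AB openin_src_vimage assms by simp
  then show False using AB(5) by blast
qed

lemma closure_units_iff:
  "c \<in> gtop G closure_of units G \<longleftrightarrow>
    c \<in> arrows G \<and> (\<forall>A. openin (gtop G) A \<and> c \<in> A \<longrightarrow> (\<exists>u\<in>units G. u \<in> A))"
  by (auto simp: in_closure_of)

text \<open>Range and source agree on units and take values in a Hausdorff space, so they agree on
  the closure of the units.\<close>

lemma closure_units_isotropy:
  assumes "c \<in> gtop G closure_of units G"
  shows "rng G c = src G c"
proof (rule ccontr)
  have c: "c \<in> arrows G" using assms closure_units_iff by simp
  assume "rng G c \<noteq> src G c"
  then obtain A B where AB: "openin (gtop G) A" "openin (gtop G) B" "rng G c \<in> A" "src G c \<in> B" "A \<inter> B = {}"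
    using units_separate[of "rng G c" "src G c"] c by auto
  have "openin (gtop G) ({k \<in> arrows G. rng G k \<in> A} \<inter> {k \<in> arrows G. src G k \<in> B})"
    using AB openin_src_vimage openin_rng_vimage by (intro openin_Int) auto
  moreover have "c \<in> {k \<in> arrows G. rng G k \<in> A} \<inter> {k \<in> arrows G. src G k \<in> B}"
    using AB c by simp
  ultimately obtain u where "u \<in> units G" "u \<in> {k \<in> arrows G. rng G k \<in> A} \<inter> {k \<in> arrows G. src G k \<in> B}"
    using assms closure_units_iff by meson
  then show False using AB(5) by auto
qed

text \<open>A common point \<open>k\<close> of neighbourhoods of \<open>g\<close> and
  \<open>h\<close> gives the unit \<open>gmult G k (ginv G k)\<close>, which lies close to
  \<open>gmult G g (ginv G h)\<close>.\<close>

lemma inseparable_quotient: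
  assumes "g \<in> arrows G" "h \<in> arrows G" "inseparable g h"
  shows "gmult G g (ginv G h) \<in> gtop G closure_of units G"
  unfolding closure_units_iff
proof (intro conjI allI impI)
  have s: "src G g = src G h" by (rule inseparable_src[OF assms])
  then show "gmult G g (ginv G h) \<in> arrows G" using assms by simp
  fix N assume "openin (gtop G) N \<and> gmult G g (ginv G h) \<in> N"
  then obtain A B where AB: "openin (gtop G) A" "openin (gtop G) B" "g \<in> A" "ginv G h \<in> B"
    "\<And>a b. a \<in> A \<Longrightarrow> b \<in> B \<Longrightarrow> src G a = rng G b \<Longrightarrow> gmult G a b \<in> N"
    using mult_continuous[of g "ginv G h" N] assms s by auto
  have "A \<inter> {k \<in> arrows G. ginv G k \<in> B} \<noteq> {}"
    using assms(3)[unfolded inseparable_def, rule_format, of A "{k \<in> arrows G. ginv G k \<in> B}"]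
      AB openin_inv_vimage assms by simp
  then obtain k where k: "k \<in> A" "k \<in> arrows G" "ginv G k \<in> B" by blast
  then show "\<exists>u\<in>units G. u \<in> N" using AB(5)[of k "ginv G k"] by (intro bexI[of _ "rng G k"]) auto
qed

text \<open>For a unit \<open>u\<close> close to \<open>c\<close>, openness of the source map yields
  an arrow \<open>w\<close> close to \<open>h\<close> with source \<open>u\<close>. The conjugate of
  \<open>u\<close> by \<open>w\<close> is the unit \<open>rng G w\<close>, close to the conjugate of
  \<open>c\<close> by \<open>h\<close>.\<close>

lemma closure_units_conj:
  assumes c: "c \<in> gtop G closure_of units G" and h: "h \<in> arrows G" "src G h = src G c"
  shows "gmult G (gmult G h c) (ginv G h) \<in> gtop G closure_of units G"
proof -
  have cA: "c \<in> arrows G" and rc: "rng G c = src G c"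
    using c closure_units_iff closure_units_isotropy by auto
  show ?thesis unfolding closure_units_iff
  proof (intro conjI allI impI)
    show "gmult G (gmult G h c) (ginv G h) \<in> arrows G" using cA rc h by simp
    fix N assume "openin (gtop G) N \<and> gmult G (gmult G h c) (ginv G h) \<in> N"
    then obtain A B where AB: "openin (gtop G) A" "openin (gtop G) B" "gmult G h c \<in> A" "ginv G h \<in> B"
      "\<And>a b. a \<in> A \<Longrightarrow> b \<in> B \<Longrightarrow> src G a = rng G b \<Longrightarrow> gmult G a b \<in> N"
      using mult_continuous[of "gmult G h c" "ginv G h" N] cA rc h by auto
    obtain D E where DE: "openin (gtop G) D" "openin (gtop G) E" "h \<in> D" "c \<in> E"
      "\<And>a b. a \<in> D \<Longrightarrow> b \<in> E \<Longrightarrow> src G a = rng G b \<Longrightarrow> gmult G a b \<in> A"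
      using mult_continuous[of h c A] cA rc h AB(1,3) by auto
    let ?S = "D \<inter> {k \<in> arrows G. ginv G k \<in> B}"
    have "openin (gtop G) ?S" using DE(1) openin_inv_vimage[OF AB(2)] by blast
    then have "openin (gtop G) (E \<inter> {k \<in> arrows G. src G k \<in> src G ` ?S})"
      using DE(2) openin_src_vimage[OF open_map_src] by blast
    moreover have "c \<in> E \<inter> {k \<in> arrows G. src G k \<in> src G ` ?S}"
      using DE(3,4) AB(4) cA h by (auto simp: image_iff intro!: bexI[of _ h])
    ultimately obtain u where u: "u \<in> units G" "u \<in> E \<inter> {k \<in> arrows G. src G k \<in> src G ` ?S}"
      using c closure_units_iff by meson
    then have "u \<in> src G ` ?S" by simp
    then obtain w where w: "w \<in> D" "w \<in> arrows G" "ginv G w \<in> B" "u = src G w" by blast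
    have "u \<in> E" using u by blast
    then have "gmult G w u \<in> A" using DE(5)[OF w(1)] w(4) rng_unit[OF u(1)] by metis
    then have "w \<in> A" using mult_unit_right w(2,4) by metis
    then have "rng G w \<in> N" using AB(5)[of w "ginv G w"] w(2,3) by simp
    then show "\<exists>u\<in>units G. u \<in> N" using w by (intro bexI[of _ "rng G w"]) auto
  qed
qed

section \<open>Isotropy groups and finite sets closed under inseparability\<close>

lemma group_isotropy: "x \<in> units G \<Longrightarrow> group (isotropy x)"
proof (rule groupI)
  fix g assume "x \<in> units G" "g \<in> carrier (isotropy x)"
  then show "\<exists>h\<in>carrier (isotropy x). h \<otimes>\<^bsub>isotropy x\<^esub> g = \<one>\<^bsub>isotropy x\<^esub>"
    by (intro bexI[of _ "ginv G g"]) (auto simp: isotropy_def)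
qed (auto simp: isotropy_def unit_arrow mult_assoc)

lemma inv_isotropy: "x \<in> units G \<Longrightarrow> g \<in> carrier (isotropy x) \<Longrightarrow> inv\<^bsub>isotropy x\<^esub> g = ginv G g"
  by (rule group.inv_equality[OF group_isotropy]) (auto simp: isotropy_def)

text \<open>A unit is its own \<open>n\<close>-th power, so a unit near \<open>c\<close> is also
  near the powers of \<open>c\<close>. The induction proves this for all units near
  \<open>c\<close>, since one unit has to serve both factors; for a product of different elements of
  the closure a common unit need not exist.\<close>

lemma closure_units_pow:
  fixes n :: nat
  assumes c: "c \<in> gtop G closure_of units G" and x: "x = src G c"
  shows "c [^]\<^bsub>isotropy x\<^esub> n \<in> gtop G closure_of units G"
proof -
  have cA: "c \<in> arrows G" and rc: "rng G c = src G c"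
    using c closure_units_iff closure_units_isotropy by auto
  have xu: "x \<in> units G" using x cA by simp
  interpret I: group "isotropy x" by (rule group_isotropy[OF xu])
  have cI: "c \<in> carrier (isotropy x)" using cA rc x by (simp add: isotropy_def)
  have powI: "c [^]\<^bsub>isotropy x\<^esub> m \<in> carrier (isotropy x)" for m :: nat
    using cI by simp
  have "\<exists>S. openin (gtop G) S \<and> c \<in> S \<and> (\<forall>u\<in>units G. u \<in> S \<longrightarrow> u \<in> N)"
    if "openin (gtop G) N" "c [^]\<^bsub>isotropy x\<^esub> n \<in> N" for N
    using that
  proof (induction n arbitrary: N)
    case 0
    then have "x \<in> N" by (simp add: isotropy_def)
    then have "c \<in> {k \<in> arrows G. src G k \<in> N}" using cA x by simp
    then show ?case using openin_src_vimage[OF 0(1)] by (intro exI[of _ "{k \<in> arrows G. src G k \<in> N}"]) auto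
  next
    case (Suc n)
    have p: "c [^]\<^bsub>isotropy x\<^esub> n \<in> arrows G" "src G (c [^]\<^bsub>isotropy x\<^esub> n) = x"
      using powI[of n] by (auto simp: isotropy_def)
    have "gmult G (c [^]\<^bsub>isotropy x\<^esub> n) c \<in> N" using Suc.prems(2) by (simp add: isotropy_def)
    then obtain A B where AB: "openin (gtop G) A" "openin (gtop G) B" "c [^]\<^bsub>isotropy x\<^esub> n \<in> A" "c \<in> B"
      "\<And>a b. a \<in> A \<Longrightarrow> b \<in> B \<Longrightarrow> src G a = rng G b \<Longrightarrow> gmult G a b \<in> N"
      using mult_continuous[of "c [^]\<^bsub>isotropy x\<^esub> n" c N] p cA rc x Suc.prems(1) by auto
    from Suc.IH[OF AB(1,3)] obtain S where S: "openin (gtop G) S" "c \<in> S" "\<forall>u\<in>units G. u \<in> S \<longrightarrow> u \<in> A"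
      by blast
    have "u \<in> N" if "u \<in> units G" "u \<in> S \<inter> B" for u
      using AB(5)[of u u] that S(3) mult_unit_right[of u u] by (simp add: unit_arrow)
    then show ?case using S AB by (intro exI[of _ "S \<inter> B"]) auto
  qed
  then show ?thesis
    unfolding closure_units_iff using c[unfolded closure_units_iff] powI[of n]
    by (fastforce simp: isotropy_def)
qed

text \<open>The witness is the translate by \<open>g0\<close> of the set of all products of words
  over \<open>C\<close>, where \<open>C\<close> consists of the elements of the closure of the units
  that lie over \<open>rng G g0\<close>. Finiteness of the set of products is Dietzmann's
  lemma.\<close>

lemma finite_inseparable_closed_set:
  assumes fin: "\<And>x. x \<in> units G \<Longrightarrow> finite {c \<in> gtop G closure_of units G. src G c = x}"
    and g0: "g0 \<in> arrows G"
  obtains F where "finite F" "g0 \<in> F" "F \<subseteq> src_fibre G (src G g0)"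
    "\<And>g h. g \<in> F \<Longrightarrow> h \<in> arrows G \<Longrightarrow> inseparable h g \<Longrightarrow> h \<in> F"
proof -
  define y where "y = rng G g0"
  define C where "C = {c \<in> gtop G closure_of units G. src G c = y}"
  have y: "y \<in> units G" using g0 by (simp add: y_def)
  interpret I: group "isotropy y" by (rule group_isotropy[OF y])
  have CI: "C \<subseteq> carrier (isotropy y)"
    using closure_units_isotropy closure_units_iff by (auto simp: C_def isotropy_def)
  have conj: "inv\<^bsub>isotropy y\<^esub> g \<otimes>\<^bsub>isotropy y\<^esub> a \<otimes>\<^bsub>isotropy y\<^esub> g \<in> C"
    if g: "g \<in> carrier (isotropy y)" and a: "a \<in> C" for g a
  proof -
    have "inv\<^bsub>isotropy y\<^esub> g \<otimes>\<^bsub>isotropy y\<^esub> a \<otimes>\<^bsub>isotropy y\<^esub> g \<in> carrier (isotropy y)"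
      using g a CI by (intro I.m_closed I.inv_closed) auto
    moreover have "gmult G (gmult G (ginv G g) a) (ginv G (ginv G g)) \<in> gtop G closure_of units G"
      using g a by (intro closure_units_conj) (auto simp: isotropy_def C_def)
    ultimately show ?thesis using g y by (simp add: inv_isotropy C_def) (simp add: isotropy_def)
  qed
  have finC: "finite C" using fin[OF y] by (simp add: C_def)
  \<comment> \<open>Powers of \<open>a\<close> stay in the closure of the units, hence in the finite
    set \<open>C\<close>. Two of them coincide, and cancellation shows that \<open>a\<close> is
    torsion.\<close>
  have tors: "\<exists>n>0. a [^]\<^bsub>isotropy y\<^esub> (n::nat) = \<one>\<^bsub>isotropy y\<^esub>" if a: "a \<in> C" for a
  proof -
    have aI: "a \<in> carrier (isotropy y)" using a CI by blast
    have "a [^]\<^bsub>isotropy y\<^esub> (n::nat) \<in> C" for n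
      using closure_units_pow[of a y n] a I.nat_pow_closed[OF aI, of n] by (auto simp: C_def isotropy_def)
    then have "range (\<lambda>n::nat. a [^]\<^bsub>isotropy y\<^esub> n) \<subseteq> C" by blast
    then have "\<not> inj (\<lambda>n::nat. a [^]\<^bsub>isotropy y\<^esub> n)"
      using finC finite_subset range_inj_infinite by blast
    then obtain m n :: nat where mn: "m < n" "a [^]\<^bsub>isotropy y\<^esub> m = a [^]\<^bsub>isotropy y\<^esub> n"
      unfolding inj_def by (metis linorder_neqE_nat)
    have "a [^]\<^bsub>isotropy y\<^esub> m \<otimes>\<^bsub>isotropy y\<^esub> a [^]\<^bsub>isotropy y\<^esub> (n - m)
        = a [^]\<^bsub>isotropy y\<^esub> m \<otimes>\<^bsub>isotropy y\<^esub> \<one>\<^bsub>isotropy y\<^esub>"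
      using mn I.nat_pow_mult[OF aI, of m "n - m"] aI by simp
    then have "a [^]\<^bsub>isotropy y\<^esub> (n - m) = \<one>\<^bsub>isotropy y\<^esub>"
      using aI by (subst (asm) I.Units_l_cancel) auto
    then show ?thesis using mn(1) by (intro exI[of _ "n - m"]) simp
  qed
  let ?p = "\<lambda>ws. foldr (\<otimes>\<^bsub>isotropy y\<^esub>) ws \<one>\<^bsub>isotropy y\<^esub>"
  define F where "F = (\<lambda>k. gmult G k g0) ` ?p ` lists C"
  have pI: "?p ws \<in> carrier (isotropy y)" if "ws \<in> lists C" for ws
    using that CI by (induction ws) auto
  show ?thesis
  proof (rule that)
    show "finite F" unfolding F_def
      using I.finite_products_of_normal_torsion_set[OF finC CI conj tors] by blast
    have "y \<in> ?p ` lists C" by (rule image_eqI[of _ _ "[]"]) (auto simp: isotropy_def)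
    moreover have "g0 = gmult G y g0" using g0 by (simp add: y_def)
    ultimately show "g0 \<in> F" unfolding F_def by (rule rev_image_eqI)
    have FA: "gmult G (?p ws) g0 \<in> arrows G \<and> src G (gmult G (?p ws) g0) = src G g0 \<and>
        rng G (gmult G (?p ws) g0) = y" if "ws \<in> lists C" for ws
      using pI[OF that] g0 by (auto simp: isotropy_def y_def)
    then show "F \<subseteq> src_fibre G (src G g0)" unfolding F_def src_fibre_def by blast
    fix g h assume gh: "g \<in> F" "h \<in> arrows G" "inseparable h g"
    then obtain ws where ws: "ws \<in> lists C" "g = gmult G (?p ws) g0" unfolding F_def by blast
    \<comment> \<open>The quotient of inseparable arrows is a letter from \<open>C\<close>;
      prepending it to the word of \<open>g\<close> gives a word for \<open>h\<close>.\<close>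
    let ?c = "gmult G h (ginv G g)"
    have g: "g \<in> arrows G" "rng G g = y" using FA[OF ws(1)] ws(2) by auto
    have s: "src G h = src G g" using inseparable_src gh g by blast
    have "?c \<in> C" using inseparable_quotient[OF gh(2) g(1) gh(3)] gh g s by (simp add: C_def)
    then have "?c # ws \<in> lists C" "?c \<in> carrier (isotropy y)" using ws CI by auto
    moreover have "h = gmult G (?p (?c # ws)) g0"
    proof -
      have "h = gmult G ?c g" using mult_inv_cancel[OF gh(2) g(1) s] by simp
      also have "\<dots> = gmult G (gmult G ?c (?p ws)) g0"
        unfolding ws(2)[symmetric] using ws(2) pI[OF ws(1)] \<open>?c \<in> carrier (isotropy y)\<close> g0
        by (subst mult_assoc) (auto simp: isotropy_def y_def)
      finally show ?thesis by (simp add: isotropy_def)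
    qed
    ultimately show "h \<in> F" unfolding F_def by blast
  qed
qed

section \<open>Germs of functions\<close>

lemma eventually_nhdsin_arrow:
  "g \<in> arrows G \<Longrightarrow> eventually P (nhdsin (gtop G) g) \<longleftrightarrow> (\<exists>S. openin (gtop G) S \<and> g \<in> S \<and> (\<forall>x\<in>S. P x))"
  by (simp add: eventually_nhdsin)

text \<open>Compact subsets of \<open>G\<close> need not be closed. Their sources are, being compact
  in the Hausdorff unit space.\<close>

lemma src_compact_closed:
  assumes "compactin (gtop G) K"
  shows "closedin (units_top G) (src G ` K)"
proof -
  have "continuous_map (gtop G) (units_top G) (src G)"
    using top_gpd by (simp add: topological_groupoid_def)
  then have "compactin (units_top G) (src G ` K)"
    using assms image_compactin by blast
  then show ?thesis using Hausdorff_units compactin_imp_closedin by blast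
qed

text \<open>The bisection \<open>U\<close> has at most one arrow over \<open>x\<close>. If there is
  none, or it lies outside \<open>F\<close>, both terms vanish near \<open>g1\<close>. If it is some
  \<open>g\<close> in \<open>F\<close>, then \<open>U\<close> and \<open>V g\<close> have the same
  arrows over sources close to \<open>x\<close>, and continuity of \<open>h\<close> at
  \<open>g\<close> gives the limit.\<close>

lemma Cc_on_germ_expansion:
  assumes U: "open_bisection G U" and h: "h \<in> Cc_on G U"
    and F: "finite F" "F \<subseteq> src_fibre G x"
    and clo: "\<And>g h. g \<in> F \<Longrightarrow> h \<in> arrows G \<Longrightarrow> inseparable h g \<Longrightarrow> h \<in> F"
    and V: "\<And>g. g \<in> F \<Longrightarrow> open_bisection G (V g) \<and> g \<in> V g"
    and g1: "g1 \<in> F"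
  shows "((\<lambda>\<gamma>. h \<gamma> - (\<Sum>g\<in>{g\<in>F. \<gamma> \<in> V g}. h g)) \<longlongrightarrow> 0) (nhdsin (gtop G) g1)"
proof -
  have FA: "g \<in> arrows G" "src G g = x" if "g \<in> F" for g
    using F(2) that by (auto simp: src_fibre_def)
  have g1A: "g1 \<in> arrows G" "src G g1 = x" using FA g1 by auto
  have hU: "h g = 0" if "g \<notin> U" for g using h that by (simp add: Cc_on_def)
  have xunit: "x \<in> units G" using g1A by auto
  show ?thesis
  proof (cases "\<exists>g\<in>U. src G g = x")
    case False
    then have h0: "h g = 0" if "g \<in> F" for g using FA that hU by blast
    let ?K = "subtopology (gtop G) U closure_of {g \<in> U. h g \<noteq> 0}"
    have K: "compactin (subtopology (gtop G) U) ?K" using h by (simp add: Cc_on_def)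
    then have KU: "compactin (gtop G) ?K" "?K \<subseteq> U" by (auto simp: compactin_subtopology)
    have sub: "{g \<in> U. h g \<noteq> 0} \<subseteq> ?K"
      using closure_of_subset[of "{g \<in> U. h g \<noteq> 0}" "subtopology (gtop G) U"]
        openin_subset[OF bisection_open[OF U]] by auto
    let ?W = "units G - src G ` ?K"
    have "openin (units_top G) ?W"
      using src_compact_closed[OF KU(1)] by (metis closedin_def topspace_units)
    then have W: "openin (gtop G) ?W" using openin_units_iff by blast
    have "x \<in> ?W" using False KU(2) xunit by blast
    then have "eventually (\<lambda>\<gamma>. h \<gamma> - (\<Sum>g\<in>{g\<in>F. \<gamma> \<in> V g}. h g) = 0) (nhdsin (gtop G) g1)"
      unfolding eventually_nhdsin_arrow[OF g1A(1)]
    proof (intro exI[of _ "{\<gamma> \<in> arrows G. src G \<gamma> \<in> ?W}"] conjI ballI)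
      fix \<gamma> assume "\<gamma> \<in> {\<gamma> \<in> arrows G. src G \<gamma> \<in> ?W}"
      then have "h \<gamma> = 0" using sub hU by blast
      then show "h \<gamma> - (\<Sum>g\<in>{g\<in>F. \<gamma> \<in> V g}. h g) = 0" using h0 by simp
    qed (use openin_src_vimage[OF W] g1A in auto)
    then show ?thesis by (rule tendsto_eventually)
  next
    case True
    then obtain g where g: "g \<in> U" "src G g = x" by blast
    have gA: "g \<in> arrows G" using g U bisection_arrows by blast
    have other: "h g' = 0" if "g' \<in> F" "g' \<noteq> g" for g'
      using bisection_src_eq[OF U _ g(1), of g'] FA[OF that(1)] g(2) that hU by metis
    show ?thesis
    proof (cases "g \<in> F")
      case False
      then have h0: "h g' = 0" if "g' \<in> F" for g' using other that by metis
      \<comment> \<open>Closedness of \<open>F\<close> enters here: \<open>g\<close> and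
        \<open>g1\<close> have disjoint neighbourhoods. Over \<open>?W\<close> the only arrow of
        \<open>U\<close> with a given source lies in \<open>A\<close>, so an arrow of
        \<open>B\<close> is not in \<open>U\<close>.\<close>
      from False have "\<not> inseparable g g1" using clo g1 gA by blast
      then obtain A B where AB: "openin (gtop G) A" "openin (gtop G) B" "g \<in> A" "g1 \<in> B" "A \<inter> B = {}"
        unfolding inseparable_def by blast
      let ?W = "src G ` (U \<inter> A)"
      have W: "openin (gtop G) ?W" using AB(1) bisection_open[OF U] by (intro open_map_src) blast
      have "eventually (\<lambda>\<gamma>. h \<gamma> - (\<Sum>g\<in>{g\<in>F. \<gamma> \<in> V g}. h g) = 0) (nhdsin (gtop G) g1)"
        unfolding eventually_nhdsin_arrow[OF g1A(1)]
      proof (intro exI[of _ "B \<inter> {\<gamma> \<in> arrows G. src G \<gamma> \<in> ?W}"] conjI ballI)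
        fix \<gamma> assume \<gamma>: "\<gamma> \<in> B \<inter> {\<gamma> \<in> arrows G. src G \<gamma> \<in> ?W}"
        then obtain a where a: "a \<in> U" "a \<in> A" "src G \<gamma> = src G a" by blast
        have "\<gamma> \<notin> U" using bisection_src_eq[OF U _ a(1) a(3)] a AB(5) \<gamma> by blast
        then show "h \<gamma> - (\<Sum>g\<in>{g\<in>F. \<gamma> \<in> V g}. h g) = 0" using h0 hU by simp
      next
        show "openin (gtop G) (B \<inter> {\<gamma> \<in> arrows G. src G \<gamma> \<in> ?W})"
          using AB(2) openin_src_vimage[OF W] by blast
        show "g1 \<in> B \<inter> {\<gamma> \<in> arrows G. src G \<gamma> \<in> ?W}" using AB g g1A by auto
      qed
      then show ?thesis by (rule tendsto_eventually)
    next
      case True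
      note Vg = V[OF True]
      show ?thesis
      proof (rule tendstoI)
        fix \<epsilon> :: real assume \<epsilon>: "\<epsilon> > 0"
        let ?D = "{k \<in> U. dist (h k) (h g) < \<epsilon>}"
        have "continuous_map (subtopology (gtop G) U) euclidean h" using h by (simp add: Cc_on_def)
        moreover have "openin euclidean (ball (h g) \<epsilon>)" by simp
        ultimately have "openin (subtopology (gtop G) U) {k \<in> topspace (subtopology (gtop G) U). h k \<in> ball (h g) \<epsilon>}"
          by (rule openin_continuous_map_preimage)
        moreover have "{k \<in> topspace (subtopology (gtop G) U). h k \<in> ball (h g) \<epsilon>} = ?D"
          using openin_subset[OF bisection_open[OF U]] by (auto simp: dist_commute)
        ultimately have D: "openin (gtop G) ?D"
          using bisection_open[OF U] openin_trans_full by metis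
        \<comment> \<open>Over \<open>?W\<close> the unique arrow \<open>a\<close> of
          \<open>U\<close> lies in \<open>V g\<close> and has \<open>h a\<close> close to
          \<open>h g\<close>. Any arrow \<open>\<gamma>\<close> over \<open>?W\<close> is either the
          corresponding \<open>a\<close> or outside both \<open>U\<close> and
          \<open>V g\<close>.\<close>
        let ?W = "src G ` (?D \<inter> V g)"
        have W: "openin (gtop G) ?W" using D Vg bisection_open by (intro open_map_src) blast
        show "eventually (\<lambda>\<gamma>. dist (h \<gamma> - (\<Sum>g\<in>{g\<in>F. \<gamma> \<in> V g}. h g)) 0 < \<epsilon>) (nhdsin (gtop G) g1)"
          unfolding eventually_nhdsin_arrow[OF g1A(1)]
        proof (intro exI[of _ "{\<gamma> \<in> arrows G. src G \<gamma> \<in> ?W}"] conjI ballI)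
          show "openin (gtop G) {\<gamma> \<in> arrows G. src G \<gamma> \<in> ?W}" by (rule openin_src_vimage[OF W])
          show "g1 \<in> {\<gamma> \<in> arrows G. src G \<gamma> \<in> ?W}"
            using g1A g Vg \<epsilon> by (auto intro!: image_eqI[of _ _ g])
          fix \<gamma> assume "\<gamma> \<in> {\<gamma> \<in> arrows G. src G \<gamma> \<in> ?W}"
          then obtain a where a: "a \<in> U" "dist (h a) (h g) < \<epsilon>" "a \<in> V g" "src G \<gamma> = src G a" by blast
          have "(\<Sum>g'\<in>{g\<in>F. \<gamma> \<in> V g}. h g') = (\<Sum>g'\<in>F. if g' = g then (if \<gamma> \<in> V g then h g else 0) else 0)"
            unfolding sum.inter_filter[OF F(1)] using other by (intro sum.cong) auto
          also have "\<dots> = (if \<gamma> \<in> V g then h g else 0)" using F(1) True by simp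
          finally have s: "(\<Sum>g'\<in>{g\<in>F. \<gamma> \<in> V g}. h g') = (if \<gamma> \<in> V g then h g else 0)" .
          show "dist (h \<gamma> - (\<Sum>g\<in>{g\<in>F. \<gamma> \<in> V g}. h g)) 0 < \<epsilon>"
          proof (cases "\<gamma> \<in> V g")
            case True
            then have "\<gamma> = a" using bisection_src_eq[of "V g" \<gamma> a] Vg a by blast
            then show ?thesis using a True unfolding s by (simp add: dist_norm)
          next
            case False
            then have "\<gamma> \<notin> U" using bisection_src_eq[OF U _ a(1) a(4)] a by blast
            then show ?thesis using False \<epsilon> hU unfolding s by simp
          qed
        qed
      qed
    qed
  qed
qed

lemma Cc_germ_expansion:
  assumes h: "h \<in> Cc G"
    and F: "finite F" "F \<subseteq> src_fibre G x"
    and clo: "\<And>g h. g \<in> F \<Longrightarrow> h \<in> arrows G \<Longrightarrow> inseparable h g \<Longrightarrow> h \<in> F"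
    and V: "\<And>g. g \<in> F \<Longrightarrow> open_bisection G (V g) \<and> g \<in> V g"
    and g1: "g1 \<in> F"
  shows "((\<lambda>\<gamma>. h \<gamma> - (\<Sum>g\<in>{g\<in>F. \<gamma> \<in> V g}. h g)) \<longlongrightarrow> 0) (nhdsin (gtop G) g1)"
  using h unfolding Cc_def
proof (induction rule: fun_vs.span_induct_alt)
  case base
  then show ?case by simp
next
  case (step c k l)
  then obtain U where U: "open_bisection G U" "k \<in> Cc_on G U" by blast
  have "((\<lambda>\<gamma>. c * (k \<gamma> - (\<Sum>g\<in>{g\<in>F. \<gamma> \<in> V g}. k g)) + (l \<gamma> - (\<Sum>g\<in>{g\<in>F. \<gamma> \<in> V g}. l g)))
      \<longlongrightarrow> c * 0 + 0) (nhdsin (gtop G) g1)"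
    by (intro tendsto_intros Cc_on_germ_expansion[OF U F clo V g1] step.IH)
  then show ?case
    by (simp add: fun_scale_def algebra_simps sum.distrib sum_distrib_left)
qed

text \<open>The only property of elements of the reduced algebra that enters the local analysis. It
  holds for them because the reduced norm dominates the supremum norm on the arrows.\<close>

definition Cc_uniform_limit :: "('g \<Rightarrow> complex) \<Rightarrow> bool"
  where "Cc_uniform_limit f \<longleftrightarrow> (\<forall>\<epsilon>>0. \<exists>h\<in>Cc G. \<forall>g\<in>arrows G. cmod (f g - h g) \<le> \<epsilon>)"

lemma uniform_limit_germ_expansion:
  assumes f: "Cc_uniform_limit f"
    and F: "finite F" "F \<subseteq> src_fibre G x"
    and clo: "\<And>g h. g \<in> F \<Longrightarrow> h \<in> arrows G \<Longrightarrow> inseparable h g \<Longrightarrow> h \<in> F"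
    and V: "\<And>g. g \<in> F \<Longrightarrow> open_bisection G (V g) \<and> g \<in> V g"
    and g1: "g1 \<in> F"
  shows "((\<lambda>\<gamma>. f \<gamma> - (\<Sum>g\<in>{g\<in>F. \<gamma> \<in> V g}. f g)) \<longlongrightarrow> 0) (nhdsin (gtop G) g1)"
proof (rule tendstoI)
  fix \<epsilon> :: real assume \<epsilon>: "\<epsilon> > 0"
  \<comment> \<open>The error occurs once at \<open>f \<gamma>\<close> and at most
    \<open>card F\<close> times in the sum, so \<open>e\<close> is chosen with
    \<open>e + card F * e\<close> equal to half of \<epsilon>.\<close>
  define e where "e = \<epsilon> / (2 * (real (card F) + 1))"
  have e: "e > 0" using \<epsilon> by (simp add: e_def)
  have "e * (2 * (real (card F) + 1)) = \<epsilon>" unfolding e_def by simp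
  then have ee: "e + real (card F) * e = \<epsilon> / 2" by (simp add: algebra_simps)
  obtain h where h: "h \<in> Cc G" "\<And>g. g \<in> arrows G \<Longrightarrow> cmod (f g - h g) \<le> e"
    using f e unfolding Cc_uniform_limit_def by blast
  have g1A: "g1 \<in> arrows G" using g1 F(2) by (auto simp: src_fibre_def)
  have "eventually (\<lambda>\<gamma>. dist (h \<gamma> - (\<Sum>g\<in>{g\<in>F. \<gamma> \<in> V g}. h g)) 0 < \<epsilon> / 2) (nhdsin (gtop G) g1)"
    using Cc_germ_expansion[OF h(1) F clo V g1] \<epsilon> by (intro tendstoD) auto
  then obtain S where S: "openin (gtop G) S" "g1 \<in> S"
    "\<And>\<gamma>. \<gamma> \<in> S \<Longrightarrow> cmod (h \<gamma> - (\<Sum>g\<in>{g\<in>F. \<gamma> \<in> V g}. h g)) < \<epsilon> / 2"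
    unfolding eventually_nhdsin_arrow[OF g1A] by auto
  have "dist (f \<gamma> - (\<Sum>g\<in>{g\<in>F. \<gamma> \<in> V g}. f g)) 0 < \<epsilon>" if \<gamma>: "\<gamma> \<in> S" for \<gamma>
  proof -
    let ?B = "{g\<in>F. \<gamma> \<in> V g}"
    have "\<gamma> \<in> arrows G" using \<gamma> S(1) openin_subset by blast
    then have 1: "cmod (f \<gamma> - h \<gamma>) \<le> e" by (rule h(2))
    have "cmod ((\<Sum>g\<in>?B. h g) - (\<Sum>g\<in>?B. f g)) \<le> (\<Sum>g\<in>?B. e)"
      unfolding sum_subtractf[symmetric] using h(2) F(2)
      by (intro sum_norm_le) (auto simp: src_fibre_def norm_minus_commute)
    also have "\<dots> \<le> real (card F) * e"
      using F(1) e by (auto intro!: mult_right_mono card_mono)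
    finally have 3: "cmod ((\<Sum>g\<in>?B. h g) - (\<Sum>g\<in>?B. f g)) \<le> real (card F) * e" .
    have "cmod ((f \<gamma> - h \<gamma>) + (h \<gamma> - (\<Sum>g\<in>?B. h g)) + ((\<Sum>g\<in>?B. h g) - (\<Sum>g\<in>?B. f g))) < e + \<epsilon> / 2 + real (card F) * e"
      using norm_triangle_ineq[of "(f \<gamma> - h \<gamma>) + (h \<gamma> - (\<Sum>g\<in>?B. h g))" "(\<Sum>g\<in>?B. h g) - (\<Sum>g\<in>?B. f g)"]
        norm_triangle_ineq[of "f \<gamma> - h \<gamma>" "h \<gamma> - (\<Sum>g\<in>?B. h g)"] 1 S(3)[OF \<gamma>] 3 by linarith
    then show ?thesis using ee by (simp add: algebra_simps)
  qed
  then show "eventually (\<lambda>\<gamma>. dist (f \<gamma> - (\<Sum>g\<in>{g\<in>F. \<gamma> \<in> V g}. f g)) 0 < \<epsilon>) (nhdsin (gtop G) g1)"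
    unfolding eventually_nhdsin_arrow[OF g1A] using S by blast
qed

section \<open>Singular functions and the condition on bisections\<close>

text \<open>A unit \<open>x\<close> is chosen where the fibrewise support of \<open>val\<close> is
  nonempty and as small as possible. Near \<open>x\<close> one bisection is kept for each arrow of
  this support, weighted by the value of \<open>val\<close> there. If \<open>val\<close> were
  nonzero where two of them meet, the support over that source would be smaller, so the weights
  annihilate the vectors that span the space in \<open>cond_S0\<close>.\<close>

lemma cond_S0_of_rational_combination:
  fixes U :: "'i \<Rightarrow> 'g set" and I :: "'i set" and q :: "'i \<Rightarrow> rat"
  defines "val \<equiv> \<lambda>\<gamma>. \<Sum>i\<in>{i\<in>I. \<gamma> \<in> U i}. q i"
  assumes I: "finite I"
    and U: "\<And>i. i \<in> I \<Longrightarrow> open_bisection G (U i)" "\<And>i. i \<in> I \<Longrightarrow> src G ` U i = V"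
    and nz: "\<gamma>0 \<in> arrows G" "val \<gamma>0 \<noteq> 0"
    and emp: "\<And>W. openin (gtop G) W \<Longrightarrow> W \<subseteq> src G ` {\<gamma> \<in> arrows G. val \<gamma> \<noteq> 0} \<Longrightarrow> W = {}"
  shows "cond_S0 G"
proof -
  define S where "S x = {\<gamma> \<in> arrows G. src G \<gamma> = x \<and> val \<gamma> \<noteq> 0}" for x
  have hit: "\<exists>i\<in>I. \<gamma> \<in> U i" if "val \<gamma> \<noteq> 0" for \<gamma>
  proof (rule ccontr)
    assume "\<not> ?thesis"
    then have "{i\<in>I. \<gamma> \<in> U i} = {}" by blast
    then show False using that unfolding val_def by (simp only: sum.empty)
  qed
  have finS: "finite (S x)" for x
  proof (rule finite_subset)
    show "S x \<subseteq> (\<Union>i\<in>I. {\<gamma> \<in> U i. src G \<gamma> = x})" using hit by (auto simp: S_def)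
    have "finite {\<gamma> \<in> U i. src G \<gamma> = x}" if "i \<in> I" for i
    proof (rule finite_imageD)
      show "finite (src G ` {\<gamma> \<in> U i. src G \<gamma> = x})" by (rule finite_subset[of _ "{x}"]) auto
      show "inj_on (src G) {\<gamma> \<in> U i. src G \<gamma> = x}"
        using U(1)[OF that] by (auto simp: open_bisection_def inj_on_def)
    qed
    then show "finite (\<Union>i\<in>I. {\<gamma> \<in> U i. src G \<gamma> = x})" using I by blast
  qed
  have "S (src G \<gamma>0) \<noteq> {}" using nz by (auto simp: S_def)
  then obtain x where x: "S x \<noteq> {}" "\<And>y. S y \<noteq> {} \<Longrightarrow> card (S x) \<le> card (S y)"
    using ex_has_least_nat[of "\<lambda>x. S x \<noteq> {}" "src G \<gamma>0" "\<lambda>x. card (S x)"] by blast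
  have xV: "x \<in> V"
    using x(1) hit U(2) by (fastforce simp: S_def)
  define p where "p i = inv_into (U i) (src G) x" for i
  have p: "p i \<in> U i" "src G (p i) = x" if "i \<in> I" for i
    using inv_into_into[of x "src G" "U i"] f_inv_into_f[of x "src G" "U i"] U(2)[OF that] xV
    by (auto simp: p_def)
  have p_eq: "\<gamma> \<in> U i \<longleftrightarrow> p i = \<gamma>" if "i \<in> I" "src G \<gamma> = x" for i \<gamma>
    using bisection_src_eq[OF U(1)[OF that(1)], of "p i" \<gamma>] p[OF that(1)] that(2) by auto
  \<comment> \<open>Indices are grouped by the arrow \<open>p i\<close> in which \<open>U i\<close>
    meets the fibre over \<open>x\<close>. Over the open set \<open>V'\<close> defined below, all
    bisections of a group coincide.\<close>
  define P where "P = {(i, j) \<in> I \<times> I. p i = p j}"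
  have "finite P" by (rule finite_subset[of _ "I \<times> I"]) (use I in \<open>auto simp: P_def\<close>)
  obtain i0 where i0: "i0 \<in> I" using x(1) hit by (auto simp: S_def)
  then have "P \<noteq> {}" by (auto simp: P_def)
  define V' where "V' = (\<Inter>(i, j)\<in>P. src G ` (U i \<inter> U j))"
  have oV': "openin (gtop G) V'" unfolding V'_def
  proof (rule openin_INT2[OF \<open>finite P\<close> \<open>P \<noteq> {}\<close>])
    fix r assume "r \<in> P"
    then obtain i j where "r = (i, j)" "i \<in> I" "j \<in> I" by (auto simp: P_def)
    then show "openin (gtop G) (case r of (i, j) \<Rightarrow> src G ` (U i \<inter> U j))"
      using open_map_src[of "U i \<inter> U j"] U(1) bisection_open by auto
  qed
  have xV': "x \<in> V'"
    unfolding V'_def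
  proof clarify
    fix i j assume "(i, j) \<in> P"
    then have ij: "i \<in> I" "j \<in> I" "p i = p j" by (auto simp: P_def)
    then have "p i \<in> U i \<inter> U j" "src G (p i) = x" using p[of i] p[of j] by auto
    then show "x \<in> src G ` (U i \<inter> U j)" by blast
  qed
  have V'sub: "V' \<subseteq> src G ` U i" if "i \<in> I" for i
    using that by (auto simp: V'_def P_def)
  have same: "g \<in> U j" if "i \<in> I" "j \<in> I" "p i = p j" "src G g \<in> V'" "g \<in> U i" for g i j
  proof -
    have "(i, j) \<in> P" using that by (simp add: P_def)
    then have "src G g \<in> src G ` (U i \<inter> U j)" using that(4) by (auto simp: V'_def)
    then obtain k where "k \<in> U i" "k \<in> U j" "src G g = src G k" by blast
    then show ?thesis using bisection_src_eq[OF U(1)[OF that(1)] that(5)] by metis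
  qed
  have "\<forall>\<gamma>\<in>S x. \<exists>i\<in>I. p i = \<gamma>"
    using hit p_eq by (fastforce simp: S_def)
  \<comment> \<open>One representative per group suffices, as grouped bisections agree over
    \<open>V'\<close>. Groups whose arrow has value 0 are dropped.\<close>
  then obtain \<iota> where \<iota>: "\<And>\<gamma>. \<gamma> \<in> S x \<Longrightarrow> \<iota> \<gamma> \<in> I \<and> p (\<iota> \<gamma>) = \<gamma>" by metis
  define U' where "U' \<gamma> = U (\<iota> \<gamma>) \<inter> {g \<in> arrows G. src G g \<in> V'}" for \<gamma>
  have U': "open_bisection G (U' \<gamma>)" if "\<gamma> \<in> S x" for \<gamma>
    using bisection_subset[OF U(1)[OF conjunct1[OF \<iota>[OF that]]], of "U' \<gamma>"]
      openin_src_vimage[OF oV'] bisection_open[OF U(1)[OF conjunct1[OF \<iota>[OF that]]]]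
    by (auto simp: U'_def)
  have srcU': "src G ` U' \<gamma> = V'" if \<gamma>: "\<gamma> \<in> S x" for \<gamma>
  proof
    show "V' \<subseteq> src G ` U' \<gamma>"
    proof
      fix y assume y: "y \<in> V'"
      then obtain g where "g \<in> U (\<iota> \<gamma>)" "y = src G g" using V'sub \<iota>[OF \<gamma>] by blast
      then show "y \<in> src G ` U' \<gamma>" using y \<iota>[OF \<gamma>] bisection_arrows[OF U(1)] by (auto simp: U'_def)
    qed
  qed (auto simp: U'_def)
  have val_p: "val \<gamma> = (\<Sum>i\<in>{i\<in>I. p i = \<gamma>}. q i)" if "src G \<gamma> = x" for \<gamma>
    unfolding val_def using p_eq that by (intro sum.cong) auto
  \<comment> \<open>Summing \<open>q\<close> over a whole group gives the value of
    \<open>val\<close> at its arrow over \<open>x\<close>, and dropped groups contribute 0. Over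
    \<open>V'\<close> the same function \<open>val\<close> is thus expressed by the new
    bisections.\<close>
  have val_eq: "val g = (\<Sum>\<gamma>\<in>{\<gamma>\<in>S x. g \<in> U' \<gamma>}. val \<gamma>)" if g: "g \<in> arrows G" "src G g \<in> V'" for g
  proof -
    let ?J = "{i\<in>I. g \<in> U i}"
    have finJ: "finite ?J" using I by simp
    have "val g = (\<Sum>\<gamma>\<in>p ` ?J. \<Sum>i\<in>{i\<in>?J. p i = \<gamma>}. q i)"
      unfolding val_def by (rule sum.image_gen[OF finJ])
    also have "\<dots> = (\<Sum>\<gamma>\<in>p ` ?J. val \<gamma>)"
    proof (rule sum.cong[OF refl])
      fix \<gamma> assume "\<gamma> \<in> p ` ?J"
      then obtain j where j: "j \<in> I" "g \<in> U j" "\<gamma> = p j" by blast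
      have "{i\<in>?J. p i = \<gamma>} = {i\<in>I. p i = \<gamma>}" using same[OF j(1) _ _ g(2) j(2)] j(3) by auto
      then show "(\<Sum>i\<in>{i\<in>?J. p i = \<gamma>}. q i) = val \<gamma>" using val_p[of \<gamma>] p j by simp
    qed
    also have "\<dots> = (\<Sum>\<gamma>\<in>{\<gamma>\<in>S x. g \<in> U' \<gamma>}. val \<gamma>)"
    proof (rule sum.mono_neutral_right)
      show "finite (p ` ?J)" using finJ by blast
      show "{\<gamma>\<in>S x. g \<in> U' \<gamma>} \<subseteq> p ` ?J"
      proof
        fix \<gamma> assume "\<gamma> \<in> {\<gamma>\<in>S x. g \<in> U' \<gamma>}"
        then have "\<iota> \<gamma> \<in> ?J" "\<gamma> = p (\<iota> \<gamma>)" using \<iota>[of \<gamma>] by (auto simp: U'_def)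
        then show "\<gamma> \<in> p ` ?J" by blast
      qed
      show "\<forall>\<gamma>\<in>p ` ?J - {\<gamma>\<in>S x. g \<in> U' \<gamma>}. val \<gamma> = 0"
      proof
        fix \<gamma> assume \<gamma>: "\<gamma> \<in> p ` ?J - {\<gamma>\<in>S x. g \<in> U' \<gamma>}"
        then obtain j where j: "j \<in> I" "g \<in> U j" "\<gamma> = p j" by blast
        show "val \<gamma> = 0"
        proof (rule ccontr)
          assume "val \<gamma> \<noteq> 0"
          then have \<gamma>S: "\<gamma> \<in> S x" using p[OF j(1)] j(3) bisection_arrows[OF U(1)[OF j(1)]] by (simp add: S_def)
          have "p j = p (\<iota> \<gamma>)" using \<iota>[OF \<gamma>S] j(3) by metis
          then have "g \<in> U (\<iota> \<gamma>)" using same[OF j(1) conjunct1[OF \<iota>[OF \<gamma>S]] _ g(2) j(2)] by blast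
          then have "g \<in> U' \<gamma>" using g by (simp add: U'_def)
          then show False using \<gamma> \<gamma>S by blast
        qed
      qed
    qed
    finally show ?thesis .
  qed
  define n where "n = card (S x)"
  have n: "n > 0" using x(1) finS by (simp add: n_def card_gt_0_iff)
  obtain e where e: "bij_betw e {1..n} (S x)"
    using ex_bij_betw_nat_finite_1[OF finS] n_def by blast
  then have eS: "e k \<in> S x" if "k \<in> {1..n}" for k using that by (auto simp: bij_betw_def)
  have einj: "e j = e k \<longleftrightarrow> j = k" if "j \<in> {1..n}" "k \<in> {1..n}" for j k
    by (rule inj_on_eq_iff[OF bij_betw_imp_inj_on[OF e] that])
  have val_blocks: "(\<Sum>k\<in>K. val (e k)) = val g"
    if K: "K \<subseteq> {1..n}" "K \<noteq> {}" and g: "g \<in> (\<Inter>k\<in>K. U' (e k)) - (\<Union>k\<in>{1..n} - K. U' (e k))" for K g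
  proof -
    obtain k0 where "k0 \<in> K" using K by blast
    then have "g \<in> U' (e k0)" using g by blast
    then have gA: "g \<in> arrows G" "src G g \<in> V'" by (auto simp: U'_def)
    have "{\<gamma>\<in>S x. g \<in> U' \<gamma>} = e ` K"
    proof (intro equalityI subsetI)
      fix \<gamma> assume \<gamma>: "\<gamma> \<in> {\<gamma>\<in>S x. g \<in> U' \<gamma>}"
      then obtain k where k: "k \<in> {1..n}" "\<gamma> = e k"
        using bij_betw_imp_surj_on[OF e] by blast
      then have "k \<in> K" using g \<gamma> by blast
      then show "\<gamma> \<in> e ` K" using k by blast
    next
      fix \<gamma> assume "\<gamma> \<in> e ` K"
      then obtain k where "k \<in> K" "\<gamma> = e k" by blast
      then show "\<gamma> \<in> {\<gamma>\<in>S x. g \<in> U' \<gamma>}" using g eS K by blast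
    qed
    then have "val g = (\<Sum>\<gamma>\<in>e ` K. val \<gamma>)" using val_eq[OF gA] by simp
    also have "\<dots> = (\<Sum>k\<in>K. val (e k))"
      by (subst sum.reindex[OF inj_on_subset[OF bij_betw_imp_inj_on[OF e] K(1)]]) (simp add: o_def)
    finally show ?thesis by simp
  qed
  show ?thesis unfolding cond_S0_def
  proof (intro exI[of _ n] exI[of _ "\<lambda>k. U' (e k)"] conjI ballI)
    show "n > 0" by (rule n)
    show "open_bisection G (U' (e k))" if "k \<in> {1..n}" for k using U' eS that by blast
    show "src G ` U' (e j) = src G ` U' (e k)" if "j \<in> {1..n}" "k \<in> {1..n}" for j k
      using srcU' eS that by simp
    \<comment> \<open>The arrow \<open>e k\<close> itself is isolated: each new bisection contains
      exactly one arrow over \<open>x\<close>, and these arrows are distinct.\<close>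
    show "U' (e k) - (\<Union>j\<in>{1..n} - {k}. U' (e j)) \<noteq> {}" if k: "k \<in> {1..n}" for k
    proof -
      have ek: "e k \<in> arrows G" "src G (e k) = x" using eS[OF k] by (auto simp: S_def)
      then have "e k \<in> U' (e k)" using \<iota>[OF eS[OF k]] p_eq[of "\<iota> (e k)" "e k"] xV' by (simp add: U'_def)
      moreover have "e k \<notin> U' (e j)" if "j \<in> {1..n} - {k}" for j
      proof
        assume "e k \<in> U' (e j)"
        then have "e k \<in> U (\<iota> (e j))" by (simp add: U'_def)
        then have "e j = e k" using \<iota>[OF eS, of j] p_eq[of "\<iota> (e j)" "e k"] ek(2) that by auto
        then show False using einj[of j k] k that by blast
      qed
      ultimately show ?thesis by blast
    qed
    show "gtop G interior_of (U' (e k) - (\<Union>j\<in>{1..n} - {k}. U' (e j))) = {}" if k: "k \<in> {1..n}" for k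
    proof -
      let ?A = "U' (e k) - (\<Union>j\<in>{1..n} - {k}. U' (e j))"
      let ?O = "gtop G interior_of ?A"
      have "src G ` ?O \<subseteq> src G ` {\<gamma> \<in> arrows G. val \<gamma> \<noteq> 0}"
      proof (rule image_mono, rule subsetI)
        fix g assume "g \<in> ?O"
        then have g: "g \<in> ?A" using interior_of_subset by fast
        then have "val g = val (e k)" using val_blocks[of "{k}" g] k by simp
        then show "g \<in> {\<gamma> \<in> arrows G. val \<gamma> \<noteq> 0}" using eS[OF k] g by (simp add: S_def U'_def)
      qed
      then have "src G ` ?O = {}" by (intro emp open_map_src) simp_all
      then show ?thesis by simp
    qed
    show "fun_vs.span {\<Sum>i\<in>K. std_basis i | K. K \<subseteq> {1..n} \<and> card K > 1 \<and>
        (\<Inter>i\<in>K. U' (e i)) - (\<Union>j\<in>{1..n} - K. U' (e j)) \<noteq> {}} \<noteq> rat_space n"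
    \<comment> \<open>The orthogonal vector has the nonzero weights \<open>val (e k)\<close> as
      coordinates. Its pairing with the vector of \<open>K\<close> is \<open>val g\<close> for any
      \<open>g\<close> contained in exactly the bisections of \<open>K\<close>.\<close>
    proof (rule span_ne_rat_space[of 1 n "\<lambda>k. val (e k)"])
      show one: "1 \<in> {1..n}" using n by simp
      show "val (e 1) \<noteq> 0" using eS[OF one] by (simp add: S_def)
      fix v :: "nat \<Rightarrow> rat"
      assume "v \<in> {\<Sum>i\<in>K. std_basis i | K. K \<subseteq> {1..n} \<and> card K > 1 \<and>
        (\<Inter>i\<in>K. U' (e i)) - (\<Union>j\<in>{1..n} - K. U' (e j)) \<noteq> {}}"
      then obtain K g where K: "v = (\<Sum>i\<in>K. std_basis i)" "K \<subseteq> {1..n}" "card K > 1"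
        and g: "g \<in> (\<Inter>i\<in>K. U' (e i)) - (\<Union>j\<in>{1..n} - K. U' (e j))" by blast
      have finK: "finite K" using K(2) finite_subset by blast
      have "K \<noteq> {}" using K(3) by auto
      have "(\<Sum>k=1..n. val (e k) * v k) = (\<Sum>k=1..n. if k \<in> K then val (e k) else 0)"
        unfolding K(1) by (intro sum.cong) (auto simp: sum_std_basis[OF finK])
      also have "\<dots> = (\<Sum>k\<in>K. val (e k))"
        using K(2) by (simp add: sum.inter_restrict[symmetric] Int_absorb1)
      also have "\<dots> = val g" by (rule val_blocks[OF K(2) \<open>K \<noteq> {}\<close> g])
      also have "\<dots> = 0"
      proof (rule ccontr)
        assume vg: "val g \<noteq> 0"
        obtain a b where ab: "a \<in> K" "b \<in> K" "a \<noteq> b"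
          using K(3) finK by (metis card_le_Suc0_iff_eq One_nat_def not_le)
        let ?y = "src G g"
        \<comment> \<open>\<open>pt\<close> transports the fibrewise support at \<open>x\<close>
          along the bisections to the fibre over \<open>?y\<close>, and its image contains
          \<open>S ?y\<close>. Minimality of \<open>S x\<close> makes \<open>pt\<close> injective,
          while \<open>e a\<close> and \<open>e b\<close> both go to \<open>g\<close>.\<close>
        define pt where "pt \<gamma> = inv_into (U' \<gamma>) (src G) ?y" for \<gamma>
        have pt: "pt \<gamma> = k" if "\<gamma> \<in> S x" "k \<in> U' \<gamma>" "src G k = ?y" for \<gamma> k
          using inv_into_f_f[of "src G" "U' \<gamma>" k] U'[OF that(1)] that
          by (auto simp: pt_def open_bisection_def)
        have "g \<in> U' (e a)" using g ab(1) by blast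
        then have gA: "g \<in> arrows G" "?y \<in> V'" by (auto simp: U'_def)
        have "S ?y \<subseteq> pt ` S x"
        proof
          fix k assume k: "k \<in> S ?y"
          then have kA: "k \<in> arrows G" "src G k = ?y" "val k \<noteq> 0" by (auto simp: S_def)
          have "{\<gamma>\<in>S x. k \<in> U' \<gamma>} \<noteq> {}"
          proof
            assume e: "{\<gamma>\<in>S x. k \<in> U' \<gamma>} = {}"
            have "val k = 0" by (subst val_eq) (use kA gA(2) in \<open>simp_all only: e sum.empty\<close>)
            then show False using kA(3) by blast
          qed
          then obtain \<gamma> where "\<gamma> \<in> S x" "k \<in> U' \<gamma>" by blast
          then show "k \<in> pt ` S x" using pt[of \<gamma> k] kA(2) by blast
        qed
        then have "card (S ?y) \<le> card (pt ` S x)" using finS by (intro card_mono) auto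
        moreover have "S ?y \<noteq> {}" using vg gA by (auto simp: S_def)
        ultimately have "card (S x) \<le> card (pt ` S x)" using x(2)[of ?y] by simp
        then have "card (pt ` S x) = card (S x)" using card_image_le[OF finS, of pt x] by simp
        then have inj: "inj_on pt (S x)" by (rule eq_card_imp_inj_on[OF finS])
        have ab_n: "a \<in> {1..n}" "b \<in> {1..n}" using ab K(2) by auto
        have "g \<in> U' (e b)" using g ab(2) by blast
        then have "pt (e a) = g" "pt (e b) = g"
          using pt[OF eS[OF ab_n(1)] \<open>g \<in> U' (e a)\<close>] pt[OF eS[OF ab_n(2)]] by auto
        then have "e a = e b" using inj_onD[OF inj _ eS[OF ab_n(1)] eS[OF ab_n(2)]] by simp
        then show False using einj[OF ab_n] ab(3) by blast
      qed
      finally show "(\<Sum>k=1..n. val (e k) * v k) = 0" .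
    qed
  qed
qed

text \<open>Rational weights \<open>\<phi> (f g)\<close> replace the complex values
  \<open>f g\<close>. Where the rational sum over the bisections through an arrow is nonzero, so is
  the complex one, and the germ expansion then forces \<open>f\<close> to be nonzero there. The
  rational combination thus inherits from \<open>f\<close> that the sources of its support have
  empty interior.\<close>

theorem cond_S0_of_uniform_limit:
  assumes fin: "\<And>x. x \<in> units G \<Longrightarrow> finite {c \<in> gtop G closure_of units G. src G c = x}"
    and f: "Cc_uniform_limit f"
    and g0: "g0 \<in> arrows G" "f g0 \<noteq> 0"
    and emp: "\<And>W. openin (gtop G) W \<Longrightarrow> W \<subseteq> src G ` {g \<in> arrows G. f g \<noteq> 0} \<Longrightarrow> W = {}"
  shows "cond_S0 G"
proof -
  define x where "x = src G g0"
  obtain F where F: "finite F" "g0 \<in> F" "F \<subseteq> src_fibre G x"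
    and clo: "\<And>g h. g \<in> F \<Longrightarrow> h \<in> arrows G \<Longrightarrow> inseparable h g \<Longrightarrow> h \<in> F"
    using finite_inseparable_closed_set[OF fin g0(1)] unfolding x_def by metis
  have FA: "g \<in> arrows G" "src G g = x" if "g \<in> F" for g
    using F(3) that by (auto simp: src_fibre_def)
  have "\<forall>g\<in>F. \<exists>U. open_bisection G U \<and> g \<in> U"
    using bisection_base[OF openin_topspace] FA(1) by metis
  then obtain V where V: "\<And>g. g \<in> F \<Longrightarrow> open_bisection G (V g) \<and> g \<in> V g" by metis
  obtain \<phi> :: "complex \<Rightarrow> rat" where \<phi>: "\<And>z w. \<phi> (z + w) = \<phi> z + \<phi> w" "\<phi> (f g0) \<noteq> 0"
    using rational_functional[OF g0(2)] by blast
  have \<phi>0: "\<phi> 0 = 0" using \<phi>(1)[of 0 0] by simp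
  \<comment> \<open>The finitely many patterns in which the bisections through an arrow give a
    nonzero sum. The modulus of such a sum is the tolerance for which the germ expansion keeps
    \<open>f\<close> away from 0.\<close>
  define \<B> where "\<B> = {B. B \<subseteq> F \<and> B \<noteq> {} \<and> (\<Sum>g\<in>B. f g) \<noteq> 0}"
  have fin\<B>: "finite \<B>" using F(1) by (simp add: \<B>_def)
  have "\<exists>W. openin (gtop G) W \<and> x \<in> W \<and>
      (\<forall>\<gamma>\<in>arrows G. src G \<gamma> \<in> W \<longrightarrow> {g\<in>F. \<gamma> \<in> V g} = B \<longrightarrow> f \<gamma> \<noteq> 0)" if B: "B \<in> \<B>" for B
  proof -
    obtain g1 where g1: "g1 \<in> B" "g1 \<in> F" using B by (auto simp: \<B>_def)
    have "eventually (\<lambda>\<gamma>. dist (f \<gamma> - (\<Sum>g\<in>{g\<in>F. \<gamma> \<in> V g}. f g)) 0 < cmod (\<Sum>g\<in>B. f g)) (nhdsin (gtop G) g1)"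
      using B by (intro tendstoD[OF uniform_limit_germ_expansion[OF f F(1,3) clo V g1(2)]]) (auto simp: \<B>_def)
    then obtain S where S: "openin (gtop G) S" "g1 \<in> S"
      "\<And>\<gamma>. \<gamma> \<in> S \<Longrightarrow> cmod (f \<gamma> - (\<Sum>g\<in>{g\<in>F. \<gamma> \<in> V g}. f g)) < cmod (\<Sum>g\<in>B. f g)"
      unfolding eventually_nhdsin_arrow[OF FA(1)[OF g1(2)]] by auto
    show ?thesis
    \<comment> \<open>A neighbourhood of \<open>g1\<close> is turned into one of its source: an
      arrow with pattern \<open>B\<close> lies in \<open>V g1\<close>, so over this set it must
      already belong to \<open>S\<close>.\<close>
    proof (intro exI[of _ "src G ` (S \<inter> V g1)"] conjI ballI impI)
      show "openin (gtop G) (src G ` (S \<inter> V g1))"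
        using S(1) V[OF g1(2)] bisection_open by (intro open_map_src) blast
      show "x \<in> src G ` (S \<inter> V g1)" using S(2) V[OF g1(2)] FA(2)[OF g1(2)] by blast
      fix \<gamma> assume \<gamma>: "\<gamma> \<in> arrows G" "src G \<gamma> \<in> src G ` (S \<inter> V g1)" "{g\<in>F. \<gamma> \<in> V g} = B"
      then obtain k where k: "k \<in> S" "k \<in> V g1" "src G \<gamma> = src G k" by blast
      have "\<gamma> \<in> V g1" using g1 \<gamma>(3) by blast
      then have "\<gamma> = k" using bisection_src_eq[of "V g1" \<gamma> k] V[OF g1(2)] k by blast
      then show "f \<gamma> \<noteq> 0" using S(3)[of \<gamma>] k(1) \<gamma>(3) by auto
    qed
  qed
  then have "\<forall>B\<in>\<B>. \<exists>W. openin (gtop G) W \<and> x \<in> W \<and>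
      (\<forall>\<gamma>\<in>arrows G. src G \<gamma> \<in> W \<longrightarrow> {g\<in>F. \<gamma> \<in> V g} = B \<longrightarrow> f \<gamma> \<noteq> 0)" by (rule ballI)
  from bchoice[OF this] obtain W where W': "\<forall>B\<in>\<B>. openin (gtop G) (W B) \<and> x \<in> W B \<and>
      (\<forall>\<gamma>\<in>arrows G. src G \<gamma> \<in> W B \<longrightarrow> {g\<in>F. \<gamma> \<in> V g} = B \<longrightarrow> f \<gamma> \<noteq> 0)" ..
  have W: "openin (gtop G) (W B)" "x \<in> W B"
    "\<And>\<gamma>. \<gamma> \<in> arrows G \<Longrightarrow> src G \<gamma> \<in> W B \<Longrightarrow> {g\<in>F. \<gamma> \<in> V g} = B \<Longrightarrow> f \<gamma> \<noteq> 0"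
    if "B \<in> \<B>" for B
    using bspec[OF W' that] by blast+
  \<comment> \<open>Over \<open>Z\<close> all bisections are present and every nonzero pattern is
    controlled. The factor \<open>arrows G\<close> keeps the second intersection open even for an
    empty family.\<close>
  define Z where "Z = (\<Inter>g\<in>F. src G ` V g) \<inter> (arrows G \<inter> (\<Inter>B\<in>\<B>. W B))"
  have "openin (gtop G) (\<Inter>g\<in>F. src G ` V g)"
    using F(1,2) V bisection_open open_map_src by (intro openin_INT2) blast+
  moreover have "openin (gtop G) (arrows G \<inter> (\<Inter>B\<in>\<B>. W B))"
    using fin\<B> W(1) by (cases "\<B> = {}") (auto intro!: openin_INT2 openin_Int)
  ultimately have Z: "openin (gtop G) Z" unfolding Z_def by (rule openin_Int)
  have xA: "x \<in> arrows G" using g0 by (simp add: x_def unit_arrow)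
  have "x \<in> src G ` V g" if "g \<in> F" for g using V[OF that] FA(2)[OF that] by blast
  then have xZ: "x \<in> Z" using W(2) xA by (simp add: Z_def)
  define U where "U g = V g \<inter> {\<gamma> \<in> arrows G. src G \<gamma> \<in> Z}" for g
  define q where "q g = \<phi> (f g)" for g
  have sumq: "(\<Sum>g\<in>B. q g) = \<phi> (\<Sum>g\<in>B. f g)" for B
    unfolding q_def by (rule additive_sum[OF \<phi>(1), symmetric])
  show ?thesis
  proof (rule cond_S0_of_rational_combination[where I = F and U = U and q = q and V = Z and ?\<gamma>0.0 = g0])
    show "finite F" by (rule F(1))
    show "open_bisection G (U g)" if "g \<in> F" for g
    proof (rule bisection_subset)
      show "open_bisection G (V g)" using V that by blast
      then show "openin (gtop G) (U g)"
        unfolding U_def using bisection_open openin_src_vimage[OF Z] by blast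
    qed (auto simp: U_def)
    show "src G ` U g = Z" if g: "g \<in> F" for g
    proof
      show "Z \<subseteq> src G ` U g"
      proof
        fix y assume y: "y \<in> Z"
        then have "y \<in> src G ` V g" using g by (simp add: Z_def)
        then obtain \<gamma> where \<gamma>: "\<gamma> \<in> V g" "y = src G \<gamma>" by blast
        then have "\<gamma> \<in> arrows G" using V[OF g] bisection_arrows by blast
        then show "y \<in> src G ` U g" using \<gamma> y by (auto simp: U_def)
      qed
    qed (auto simp: U_def)
    show "g0 \<in> arrows G" by (rule g0(1))
    have "{g\<in>F. g0 \<in> U g} = {g0}"
    proof (intro equalityI subsetI)
      fix g assume g: "g \<in> {g\<in>F. g0 \<in> U g}"
      then have "g0 \<in> V g" "g \<in> F" by (auto simp: U_def)
      then show "g \<in> {g0}" using bisection_src_eq[of "V g" g g0] V[of g] FA(2)[of g] x_def by auto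
    next
      fix g assume "g \<in> {g0}"
      then show "g \<in> {g\<in>F. g0 \<in> U g}" using F(2) V[OF F(2)] g0(1) xZ x_def by (simp add: U_def)
    qed
    then show "(\<Sum>g\<in>{g\<in>F. g0 \<in> U g}. q g) \<noteq> 0" using \<phi>(2) by (simp add: q_def)
    fix O' assume O': "openin (gtop G) O'" "O' \<subseteq> src G ` {\<gamma> \<in> arrows G. (\<Sum>g\<in>{g\<in>F. \<gamma> \<in> U g}. q g) \<noteq> 0}"
    have "f \<gamma> \<noteq> 0" if \<gamma>: "\<gamma> \<in> arrows G" "(\<Sum>g\<in>{g\<in>F. \<gamma> \<in> U g}. q g) \<noteq> 0" for \<gamma>
    proof -
      let ?B = "{g\<in>F. \<gamma> \<in> U g}"
      have ne: "?B \<noteq> {}"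
      proof
        assume e: "?B = {}"
        show False using \<gamma>(2) unfolding e by simp
      qed
      then have sZ: "src G \<gamma> \<in> Z" by (auto simp: U_def)
      then have BV: "{g\<in>F. \<gamma> \<in> V g} = ?B" using \<gamma>(1) by (auto simp: U_def)
      have "(\<Sum>g\<in>?B. f g) \<noteq> 0" using \<gamma>(2) \<phi>0 unfolding sumq by metis
      then have B: "?B \<in> \<B>" using ne unfolding \<B>_def by blast
      then have "src G \<gamma> \<in> W ?B" using sZ unfolding Z_def by blast
      then show ?thesis using W(3)[OF B \<gamma>(1) _ BV] by blast
    qed
    then have "{\<gamma> \<in> arrows G. (\<Sum>g\<in>{g\<in>F. \<gamma> \<in> U g}. q g) \<noteq> 0} \<subseteq> {g \<in> arrows G. f g \<noteq> 0}" by blast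
    then show "O' = {}" using O' by (intro emp) blast+
  qed
qed

section \<open>Bump functions on bisections\<close>

lemma locally_compact_units: "locally_compact_space (units_top G)"
  unfolding locally_compact_space_def topspace_units
proof
  fix x assume x: "x \<in> units G"
  have "locally_compact_space (gtop G)" using top_gpd by (simp add: topological_groupoid_def)
  then obtain U K where UK: "openin (gtop G) U" "compactin (gtop G) K" "x \<in> U" "U \<subseteq> K"
    using bspec[OF _ unit_arrow[OF x], of "\<lambda>x. \<exists>U K. openin (gtop G) U \<and> compactin (gtop G) K \<and> x \<in> U \<and> U \<subseteq> K"]
    unfolding locally_compact_space_def by blast
  have "U \<subseteq> arrows G" using UK(1) openin_subset by blast
  \<comment> \<open>The range map is open, continuous and the identity on units, so it carries a
    compact neighbourhood of \<open>x\<close> in \<open>G\<close> to one in the unit space.\<close>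
  then have "openin (units_top G) (rng G ` U)"
    using open_map_rng[OF UK(1)] openin_units_iff by auto
  moreover have "continuous_map (gtop G) (units_top G) (rng G)"
    using top_gpd by (simp add: topological_groupoid_def)
  then have "compactin (units_top G) (rng G ` K)" using UK(2) image_compactin by blast
  moreover have "x \<in> rng G ` U" using UK(3) x by (intro image_eqI[of _ _ x]) auto
  ultimately show "\<exists>U K. openin (units_top G) U \<and> compactin (units_top G) K \<and> x \<in> U \<and> U \<subseteq> K"
    using UK(4) by blast
qed

text \<open>The unit space is locally compact Hausdorff, hence completely regular. A function equal
  to 0 at \<open>x\<close> and to 1 outside a neighbourhood \<open>A\<close> contained in
  \<open>K\<close> is subtracted from 1.\<close>

lemma compactly_supported_bump:
  assumes "openin (units_top G) V" "x \<in> V"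
  obtains \<phi> :: "'g \<Rightarrow> real" and K where "continuous_map (units_top G) euclidean \<phi>" "\<phi> x \<noteq> 0"
    "compactin (units_top G) K" "K \<subseteq> V" "\<And>y. y \<in> units G \<Longrightarrow> \<phi> y \<noteq> 0 \<Longrightarrow> y \<in> K"
proof -
  have x: "x \<in> units G" using assms openin_subset by fastforce
  have "neighbourhood_base_of (compactin (units_top G)) (units_top G)"
    using locally_compact_units Hausdorff_units locally_compact_space_neighbourhood_base by blast
  then obtain A K where AK: "openin (units_top G) A" "compactin (units_top G) K" "x \<in> A" "A \<subseteq> K" "K \<subseteq> V"
    using assms unfolding neighbourhood_base_of by meson
  have "completely_regular_space (units_top G)"
    using locally_compact_units Hausdorff_units
    by (intro locally_compact_regular_imp_completely_regular_space) auto
  moreover have "closedin (units_top G) (units G - A)"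
    using AK(1) by (metis closedin_def Diff_subset double_diff openin_subset topspace_units order_refl)
  moreover have "x \<in> topspace (units_top G) - (units G - A)" unfolding topspace_units using x AK(3) by simp
  ultimately obtain f :: "'g \<Rightarrow> real" where f: "continuous_map (units_top G) (top_of_set {0..1}) f"
    "f x = 0" "f ` (units G - A) \<subseteq> {1}"
    unfolding completely_regular_space_def by meson
  show ?thesis
  proof (rule that)
    have "continuous_map (units_top G) euclidean f" using f(1) by (simp add: continuous_map_in_subtopology)
    then show "continuous_map (units_top G) euclidean (\<lambda>y. 1 - f y)"
      by (intro continuous_map_diff) auto
    show "1 - f x \<noteq> 0" using f(2) by simp
    show "compactin (units_top G) K" "K \<subseteq> V" using AK by auto
    show "y \<in> K" if "y \<in> units G" "1 - f y \<noteq> 0" for y using that f(3) AK(4) by auto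
  qed
qed

text \<open>The source map is a homeomorphism from \<open>U\<close> onto an open set of units, with
  inverse \<open>t\<close>. Thus \<open>t\<close> carries \<open>K\<close> to a compact set in
  \<open>U\<close>, which is also closed in \<open>U\<close> because \<open>K\<close> is closed in
  the Hausdorff unit space.\<close>

lemma bump_in_Cc_on:
  assumes U: "open_bisection G U" and \<phi>: "continuous_map (units_top G) euclidean (\<phi> :: 'g \<Rightarrow> real)"
    and K: "compactin (units_top G) K" "K \<subseteq> src G ` U" "\<And>y. y \<in> units G \<Longrightarrow> \<phi> y \<noteq> 0 \<Longrightarrow> y \<in> K"
  shows "(\<lambda>g. if g \<in> U then complex_of_real (\<phi> (src G g)) else 0) \<in> Cc_on G U"
    (is "?h \<in> _")
proof -
  have oU: "openin (gtop G) U" and UA: "U \<subseteq> arrows G"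
    using bisection_open[OF U] openin_subset by auto
  have inj: "inj_on (src G) U" using U by (simp add: open_bisection_def)
  have tU: "topspace (subtopology (gtop G) U) = U" using UA by (simp add: topspace_subtopology Int_absorb1)
  have srcc: "continuous_map (gtop G) (units_top G) (src G)"
    using top_gpd by (simp add: topological_groupoid_def)
  have "continuous_map (gtop G) euclidean (\<lambda>g. \<phi> (src G g))"
    using continuous_map_compose[OF srcc \<phi>] by (simp add: o_def)
  then have "continuous_map (gtop G) euclidean (\<lambda>g. complex_of_real (\<phi> (src G g)))"
    using continuous_map_compose[of "gtop G" euclidean "\<lambda>g. \<phi> (src G g)" euclidean complex_of_real]
    by (simp add: o_def continuous_on_of_real)
  then have "continuous_map (subtopology (gtop G) U) euclidean (\<lambda>g. complex_of_real (\<phi> (src G g)))"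
    by (rule continuous_map_from_subtopology)
  then have cont: "continuous_map (subtopology (gtop G) U) euclidean ?h"
    by (rule continuous_map_eq) (simp add: tU)
  let ?V = "src G ` U"
  have VA: "?V \<subseteq> arrows G" using UA unit_arrow by auto
  define t where "t = inv_into U (src G)"
  have t: "t (src G g) = g" if "g \<in> U" for g using inj that by (simp add: t_def)
  have "continuous_map (subtopology (gtop G) ?V) (subtopology (gtop G) U) t"
    unfolding continuous_map_def
  proof (intro conjI allI impI)
    show "t \<in> topspace (subtopology (gtop G) ?V) \<rightarrow> topspace (subtopology (gtop G) U)"
      using t UA by (auto simp: tU topspace_subtopology)
    fix S assume "openin (subtopology (gtop G) U) S"
    then have S: "openin (gtop G) S" "S \<subseteq> U" using oU openin_open_subtopology by blast+
    have "{y \<in> topspace (subtopology (gtop G) ?V). t y \<in> S} = src G ` S"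
    proof (intro equalityI subsetI)
      fix y assume "y \<in> {y \<in> topspace (subtopology (gtop G) ?V). t y \<in> S}"
      then obtain g where "g \<in> U" "y = src G g" "t y \<in> S" by (auto simp: topspace_subtopology)
      then show "y \<in> src G ` S" using t by auto
    next
      fix y assume "y \<in> src G ` S"
      then obtain g where "g \<in> S" "y = src G g" by blast
      then show "y \<in> {y \<in> topspace (subtopology (gtop G) ?V). t y \<in> S}"
        using S(2) t VA by (auto simp: topspace_subtopology)
    qed
    moreover have "openin (subtopology (gtop G) ?V) (src G ` S)"
      using open_map_src[OF S(1)] S(2) open_map_src[OF oU] openin_open_subtopology by blast
    ultimately show "openin (subtopology (gtop G) ?V) {y \<in> topspace (subtopology (gtop G) ?V). t y \<in> S}"
      by simp
  qed
  moreover have "compactin (subtopology (gtop G) ?V) K"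
    using K(1,2) by (auto simp: compactin_subtopology)
  ultimately have "compactin (subtopology (gtop G) U) (t ` K)" by (rule image_compactin[rotated])
  moreover have tK: "t ` K = {g \<in> U. src G g \<in> K}"
  proof (intro equalityI subsetI)
    fix g assume "g \<in> t ` K"
    then obtain y where y: "y \<in> K" "g = t y" by blast
    then obtain k where "k \<in> U" "y = src G k" using K(2) by blast
    then show "g \<in> {g \<in> U. src G g \<in> K}" using t y by auto
  next
    fix g assume g: "g \<in> {g \<in> U. src G g \<in> K}"
    then have "g = t (src G g)" using t by simp
    then show "g \<in> t ` K" using g by blast
  qed
  ultimately have comp: "compactin (subtopology (gtop G) U) {g \<in> U. src G g \<in> K}" by simp
  have "closedin (units_top G) K" using K(1) Hausdorff_units compactin_imp_closedin by blast
  then have "closedin (gtop G) {g \<in> topspace (gtop G). src G g \<in> K}"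
    by (rule closedin_continuous_map_preimage[OF srcc])
  then have clo: "closedin (subtopology (gtop G) U) {g \<in> U. src G g \<in> K}"
    unfolding closedin_subtopology using UA
    by (intro exI[of _ "{g \<in> topspace (gtop G). src G g \<in> K}"]) auto
  have "{g \<in> U. ?h g \<noteq> 0} \<subseteq> {g \<in> U. src G g \<in> K}"
    using K(3) UA src_in by (auto split: if_splits)
  then have "subtopology (gtop G) U closure_of {g \<in> U. ?h g \<noteq> 0} \<subseteq> {g \<in> U. src G g \<in> K}"
    using clo by (rule closure_of_minimal)
  then have "compactin (subtopology (gtop G) U) (subtopology (gtop G) U closure_of {g \<in> U. ?h g \<noteq> 0})"
    using closed_compactin[OF comp] closedin_closure_of by blast
  then show ?thesis using cont unfolding Cc_on_def by simp
qed

lemma Cc_on_subset_Cc: "open_bisection G U \<Longrightarrow> Cc_on G U \<subseteq> Cc G"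
  unfolding Cc_def by (intro subsetI fun_vs.span_base) blast

text \<open>Each \<open>src G ` A i\<close> is nowhere dense in the common source \<open>V\<close>.\<close>

lemma src_isolated_parts_empty_interior:
  assumes K: "finite K" "K \<subseteq> I"
    and U: "\<And>i. i \<in> I \<Longrightarrow> open_bisection G (U i)" "\<And>i. i \<in> I \<Longrightarrow> src G ` U i = V"
    and A: "\<And>i. i \<in> I \<Longrightarrow> A i = U i - (\<Union>j\<in>I - {i}. U j)" "\<And>i. i \<in> I \<Longrightarrow> gtop G interior_of A i = {}"
    and W: "openin (gtop G) W" "W \<subseteq> (\<Union>k\<in>K. src G ` A k)"
  shows "W = {}"
  using K W
proof (induction K arbitrary: W rule: finite_induct)
  case empty
  then show ?case by simp
next
  case (insert k K)
  have k: "k \<in> I" using insert.prems by blast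
  have WV: "W \<subseteq> V"
  proof
    fix y assume "y \<in> W"
    then obtain j where j: "j \<in> insert k K" "y \<in> src G ` A j" using insert.prems(3) by blast
    then have "j \<in> I" using insert.prems(1) by blast
    then have "src G ` A j \<subseteq> V" using U(2) unfolding A(1)[OF \<open>j \<in> I\<close>] by blast
    then show "y \<in> V" using j(2) by blast
  qed
  \<comment> \<open>\<open>?N\<close> is the part of \<open>U k\<close> outside \<open>A k\<close>.
    Its sources are not sources of \<open>A k\<close>, so the induction hypothesis shows that
    \<open>W\<close> misses them.\<close>
  let ?N = "U k \<inter> (\<Union>j\<in>I - {k}. U j)"
  have "openin (gtop G) (\<Union>j\<in>I - {k}. U j)" using U(1) bisection_open by (intro openin_Union) blast
  then have oN: "openin (gtop G) (src G ` ?N)"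
    using U(1)[OF k] bisection_open by (intro open_map_src openin_Int) auto
  have "W \<inter> src G ` ?N \<subseteq> (\<Union>j\<in>K. src G ` A j)"
  proof
    fix y assume y: "y \<in> W \<inter> src G ` ?N"
    then obtain g where g: "g \<in> ?N" "y = src G g" by blast
    have "y \<notin> src G ` A k"
    proof
      assume "y \<in> src G ` A k"
      then obtain a where a: "a \<in> A k" "y = src G a" by blast
      have aU: "a \<in> U k" "a \<notin> (\<Union>j\<in>I - {k}. U j)" using a(1) unfolding A(1)[OF k] by blast+
      have "src G a = src G g" using a(2) g(2) by simp
      then have "a = g" using bisection_src_eq[OF U(1)[OF k] aU(1)] g(1) by blast
      then show False using aU(2) g(1) by blast
    qed
    then show "y \<in> (\<Union>j\<in>K. src G ` A j)" using y insert.prems(3) by blast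
  qed
  moreover have "openin (gtop G) (W \<inter> src G ` ?N)" using insert.prems(2) oN by blast
  ultimately have empty: "W \<inter> src G ` ?N = {}" using insert.IH insert.prems(1) by blast
  \<comment> \<open>What \<open>U k\<close> has over \<open>W\<close> is open and now lies in
    \<open>A k\<close>, hence is empty. As \<open>W\<close> is contained in the source of
    \<open>U k\<close>, it is empty too.\<close>
  let ?S = "U k \<inter> {g \<in> arrows G. src G g \<in> W}"
  have "openin (gtop G) ?S"
    using bisection_open[OF U(1)[OF k]] openin_src_vimage[OF insert.prems(2)] by blast
  moreover have "?S \<subseteq> A k" unfolding A(1)[OF k] using empty by blast
  ultimately have "?S \<subseteq> gtop G interior_of A k" using interior_of_maximal by blast
  then have S: "?S = {}" using A(2)[OF k] by blast
  show ?case
  proof (rule ccontr)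
    assume "W \<noteq> {}"
    then obtain y where y: "y \<in> W" by blast
    then have "y \<in> src G ` U k" using WV U(2)[OF k] by blast
    then obtain g where "g \<in> U k" "y = src G g" by blast
    then have "g \<in> ?S" using y bisection_arrows[OF U(1)[OF k]] by blast
    then show False using S by blast
  qed
qed

text \<open>Annihilating weights cancel wherever at least two of the bisections meet, which leaves
  only the isolated parts. As the function lies in \<open>Cc G\<close>, it refutes the vanishing of
  the singular ideal and of its intersection with \<open>Cc G\<close> alike.\<close>

theorem singular_function_of_cond_S0:
  assumes "cond_S0 G"
  obtains h g0 where "h \<in> Cc G" "g0 \<in> arrows G" "h g0 \<noteq> 0"
    "\<And>W. openin (gtop G) W \<Longrightarrow> W \<subseteq> src G ` {g \<in> arrows G. h g \<noteq> 0} \<Longrightarrow> W = {}"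
proof -
  obtain n U where "n > 0" and U: "\<forall>i\<in>{1..n}. open_bisection G (U i)"
      "\<forall>i\<in>{1..n}. \<forall>j\<in>{1..n}. src G ` U i = src G ` U j"
    and iso: "\<forall>i\<in>{1..n}. U i - (\<Union>j\<in>{1..n} - {i}. U j) \<noteq> {} \<and>
       gtop G interior_of (U i - (\<Union>j\<in>{1..n} - {i}. U j)) = {}"
    and sp: "fun_vs.span {\<Sum>i\<in>I. std_basis i | I.
       I \<subseteq> {1..n} \<and> card I > 1 \<and> (\<Inter>i\<in>I. U i) - (\<Union>j\<in>{1..n} - I. U j) \<noteq> {}} \<noteq> rat_space n"
    using assms unfolding cond_S0_def by (elim exE conjE) (rule that)
  let ?S = "{\<Sum>i\<in>I. std_basis i :: nat \<Rightarrow> rat | I.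
       I \<subseteq> {1..n} \<and> card I > 1 \<and> (\<Inter>i\<in>I. U i) - (\<Union>j\<in>{1..n} - I. U j) \<noteq> {}}"
  have subS: "?S \<subseteq> rat_space n"
  proof
    fix v assume "v \<in> ?S"
    then obtain I where I: "v = (\<Sum>i\<in>I. std_basis i)" "I \<subseteq> {1..n}" by blast
    then have "finite I" using finite_subset by blast
    then show "v \<in> rat_space n" using I by (auto simp: rat_space_def sum_std_basis)
  qed
  obtain q :: "nat \<Rightarrow> rat" and k where q: "k \<in> {1..n}" "q k \<noteq> 0"
    "\<forall>I. (\<Sum>i\<in>I. std_basis i) \<in> ?S \<longrightarrow> (\<Sum>i\<in>I. q i) = 0"
    by (rule ex_annihilator[OF subS sp]) (rule that)
  define V where "V = src G ` U k"
  have UV: "open_bisection G (U i)" "src G ` U i = V" if "i \<in> {1..n}" for i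
    using U that q(1) unfolding V_def by blast+
  define A where "A i = U i - (\<Union>j\<in>{1..n} - {i}. U j)" for i
  \<comment> \<open>The bump will be centred at the source of an isolated arrow of
    \<open>U k\<close>, the bisection with \<open>q k \<noteq> 0\<close>, so that the combination
    has a single nonzero term at \<open>g0\<close>.\<close>
  obtain g0 where g0: "g0 \<in> A k" using iso q(1) unfolding A_def by blast
  then have g0U: "g0 \<in> U k" by (simp add: A_def)
  have g0A: "g0 \<in> arrows G" using g0U UV(1)[OF q(1)] bisection_arrows by blast
  have "openin (units_top G) V"
    unfolding openin_units_iff V_def
    using open_map_src[OF bisection_open[OF UV(1)[OF q(1)]]] bisection_arrows[OF UV(1)[OF q(1)]] by auto
  moreover have "src G g0 \<in> V" using g0U by (simp add: V_def)
  ultimately obtain \<phi> K where \<phi>: "continuous_map (units_top G) euclidean (\<phi> :: 'g \<Rightarrow> real)" "\<phi> (src G g0) \<noteq> 0"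
    "compactin (units_top G) K" "K \<subseteq> V" "\<And>y. y \<in> units G \<Longrightarrow> \<phi> y \<noteq> 0 \<Longrightarrow> y \<in> K"
    by (rule compactly_supported_bump) blast
  define b where "b i = (\<lambda>g. if g \<in> U i then complex_of_real (\<phi> (src G g)) else 0)" for i
  have b: "b i \<in> Cc G" if "i \<in> {1..n}" for i
    using bump_in_Cc_on[OF UV(1)[OF that] \<phi>(1,3) _ \<phi>(5)] \<phi>(4) UV(2)[OF that]
      Cc_on_subset_Cc[OF UV(1)[OF that]] unfolding b_def by blast
  define h where "h = (\<Sum>i\<in>{1..n}. fun_scale (of_rat (q i)) (b i))"
  \<comment> \<open>The bump depends only on the source, so it factors out and leaves the sum of the
    weights of the bisections through \<open>g\<close>.\<close>
  have h_eq: "h g = complex_of_real (\<phi> (src G g)) * of_rat (\<Sum>i\<in>{i\<in>{1..n}. g \<in> U i}. q i)" for g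
  proof -
    have "(\<Sum>i\<in>B. fun_scale (of_rat (q i)) (b i)) g = (\<Sum>i\<in>B. of_rat (q i) * b i g)" if "finite B" for B
      using that by (induction B rule: finite_induct) (auto simp: fun_scale_def)
    then have "h g = (\<Sum>i\<in>{1..n}. of_rat (q i) * b i g)" by (simp add: h_def)
    also have "\<dots> = (\<Sum>i\<in>{1..n}. if g \<in> U i then complex_of_real (\<phi> (src G g)) * of_rat (q i) else 0)"
      by (intro sum.cong) (auto simp: b_def)
    also have "\<dots> = (\<Sum>i\<in>{i\<in>{1..n}. g \<in> U i}. complex_of_real (\<phi> (src G g)) * of_rat (q i))"
      by (rule sum.inter_filter[symmetric]) simp
    finally show ?thesis by (simp add: of_rat_sum sum_distrib_left)
  qed
  have supp: "\<exists>i\<in>{1..n}. g \<in> A i" if "h g \<noteq> 0" for g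
  proof -
    let ?I = "{i\<in>{1..n}. g \<in> U i}"
    have nz: "(\<Sum>i\<in>?I. q i) \<noteq> 0" using that unfolding h_eq by (metis mult_zero_right of_rat_0)
    have "\<not> card ?I > 1"
    proof
      assume "card ?I > 1"
      moreover have "g \<in> (\<Inter>i\<in>?I. U i) - (\<Union>j\<in>{1..n} - ?I. U j)" by blast
      ultimately have "(\<Sum>i\<in>?I. std_basis i) \<in> ?S" by blast
      then show False using q(3)[rule_format] nz by blast
    qed
    moreover have "?I \<noteq> {}"
    proof
      assume e: "?I = {}"
      show False using nz unfolding e by simp
    qed
    moreover have "finite ?I" by simp
    ultimately have "card ?I = 1" by (metis card_gt_0_iff linorder_neqE_nat less_one not_gr_zero)
    then obtain i where i: "?I = {i}" by (rule card_1_singletonE)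
    then have "i \<in> {1..n}" "g \<in> A i" unfolding A_def by blast+
    then show ?thesis by blast
  qed
  show ?thesis
  proof (rule that)
    show "h \<in> Cc G" unfolding h_def Cc_def
      by (intro fun_vs.span_sum fun_vs.span_scale) (use b in \<open>simp add: Cc_def\<close>)
    show "g0 \<in> arrows G" by (rule g0A)
    have "{i\<in>{1..n}. g0 \<in> U i} = {k}" using g0 q(1) unfolding A_def by blast
    then show "h g0 \<noteq> 0" using q(2) \<phi>(2) unfolding h_eq by simp
    fix W assume W: "openin (gtop G) W" "W \<subseteq> src G ` {g \<in> arrows G. h g \<noteq> 0}"
    have "W \<subseteq> (\<Union>i\<in>{1..n}. src G ` A i)"
    proof
      fix y assume "y \<in> W"
      then obtain g where "y = src G g" "h g \<noteq> 0" using W(2) by blast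
      then show "y \<in> (\<Union>i\<in>{1..n}. src G ` A i)" using supp by blast
    qed
    then show "W = {}"
    proof (rule src_isolated_parts_empty_interior[rotated -1])
      show "A i = U i - (\<Union>j\<in>{1..n} - {i}. U j)" for i by (rule A_def)
      show "gtop G interior_of A i = {}" if "i \<in> {1..n}" for i using iso that unfolding A_def by blast
    qed (use UV W(1) in auto)
  qed
qed

section \<open>The reduced norm and its completion\<close>

lemma convolution_eq:
  assumes g: "g \<in> arrows G"
  shows "convolution G f \<xi> g = (\<Sum>\<^sub>\<infinity>h\<in>src_fibre G (src G g). f (gmult G g (ginv G h)) * \<xi> h)"
proof -
  \<comment> \<open>A factorisation of \<open>g\<close> is determined by its second factor
    \<open>h\<close>, which ranges over the source fibre of \<open>g\<close>.\<close>
  let ?p = "\<lambda>h. (gmult G g (ginv G h), h)"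
  let ?B = "{(g1, g2) \<in> composable G. gmult G g1 g2 = g}"
  have "bij_betw ?p (src_fibre G (src G g)) ?B"
  proof (rule bij_betw_imageI)
    show "inj_on ?p (src_fibre G (src G g))" by (auto simp: inj_on_def)
    show "?p ` src_fibre G (src G g) = ?B"
    proof (intro equalityI subsetI)
      fix z assume "z \<in> ?p ` src_fibre G (src G g)"
      then obtain h where h: "h \<in> arrows G" "src G h = src G g" "z = ?p h" by (auto simp: src_fibre_def)
      then show "z \<in> ?B" using g mult_inv_cancel[of g h] by (simp add: composable_def)
    next
      fix z assume "z \<in> ?B"
      then obtain k h where z: "z = (k, h)" "k \<in> arrows G" "h \<in> arrows G" "src G k = rng G h" "gmult G k h = g"
        by (auto simp: composable_def)
      then have "h \<in> src_fibre G (src G g)" by (auto simp: src_fibre_def)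
      moreover have "z = ?p h" using mult_cancel_inv[of k h] z by simp
      ultimately show "z \<in> ?p ` src_fibre G (src G g)" by blast
    qed
  qed
  from infsum_reindex_bij_betw[OF this, of "\<lambda>(g1, g2). f g1 * \<xi> g2"]
  show ?thesis by (simp add: convolution_def)
qed

lemma convolution_outside:
  assumes "g \<notin> arrows G" shows "convolution G f \<xi> g = 0"
proof -
  have e: "{(g1, g2) \<in> composable G. gmult G g1 g2 = g} = {}"
    using assms mult_in by (auto simp: composable_def)
  show ?thesis unfolding convolution_def e by simp
qed

lemma convolution_outside_fibre:
  assumes "\<xi> \<in> ell2 (src_fibre G x)" "g \<notin> src_fibre G x"
  shows "convolution G f \<xi> g = 0"
proof (cases "g \<in> arrows G")
  case True
  then have "src G g \<noteq> x" using assms(2) by (simp add: src_fibre_def)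
  then have "\<xi> h = 0" if "h \<in> src_fibre G (src G g)" for h
    using that by (intro ell2_outside[OF assms(1)]) (auto simp: src_fibre_def)
  then show ?thesis unfolding convolution_eq[OF True] by (intro infsum_0) simp
qed (rule convolution_outside)

text \<open>Convolution by \<open>f\<close> acts on a source fibre as the matrix with entries
  \<open>f (gmult G g (ginv G h))\<close>. Finite rows make its sums finite for arbitrary vectors,
  so additivity in \<open>f\<close> raises no question of convergence.\<close>

definition finite_rows :: "('g \<Rightarrow> complex) \<Rightarrow> bool"
  where "finite_rows f \<longleftrightarrow> (\<forall>g\<in>arrows G. finite {h \<in> src_fibre G (src G g). f (gmult G g (ginv G h)) \<noteq> 0})"

lemma finite_rows_summable:
  assumes "finite_rows f" "g \<in> arrows G"
  shows "(\<lambda>h. f (gmult G g (ginv G h)) * \<xi> h) summable_on src_fibre G (src G g)"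
proof (rule finite_nonzero_values_imp_summable_on)
  show "finite {h \<in> src_fibre G (src G g). f (gmult G g (ginv G h)) * \<xi> h \<noteq> 0}"
    by (rule finite_subset[of _ "{h \<in> src_fibre G (src G g). f (gmult G g (ginv G h)) \<noteq> 0}"])
      (use assms in \<open>auto simp: finite_rows_def\<close>)
qed

lemma finite_rows_add:
  assumes "finite_rows f" "finite_rows k" shows "finite_rows (f + k)"
  unfolding finite_rows_def
proof
  fix g assume "g \<in> arrows G"
  then have "finite ({h \<in> src_fibre G (src G g). f (gmult G g (ginv G h)) \<noteq> 0} \<union>
      {h \<in> src_fibre G (src G g). k (gmult G g (ginv G h)) \<noteq> 0})"
    using assms by (simp add: finite_rows_def)
  then show "finite {h \<in> src_fibre G (src G g). (f + k) (gmult G g (ginv G h)) \<noteq> 0}"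
    by (rule rev_finite_subset) auto
qed

lemma finite_rows_scale:
  assumes "finite_rows f" shows "finite_rows (fun_scale c f)"
  unfolding finite_rows_def
proof
  fix g assume "g \<in> arrows G"
  then have "finite {h \<in> src_fibre G (src G g). f (gmult G g (ginv G h)) \<noteq> 0}"
    using assms by (simp add: finite_rows_def)
  then show "finite {h \<in> src_fibre G (src G g). (fun_scale c f) (gmult G g (ginv G h)) \<noteq> 0}"
    by (rule rev_finite_subset) (auto simp: fun_scale_def)
qed

text \<open>All quotients \<open>gmult G g (ginv G h)\<close> have the range of \<open>g\<close>,
  and \<open>U\<close> has at most one arrow of that range. A function carried by \<open>U\<close>
  thus has at most one nonzero entry in each row of its matrix.\<close>

lemma bisection_quotient_unique:
  assumes U: "open_bisection G U" and g: "g \<in> arrows G"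
    and h: "h \<in> src_fibre G (src G g)" "gmult G g (ginv G h) \<in> U"
    and k: "k \<in> src_fibre G (src G g)" "gmult G g (ginv G k) \<in> U"
  shows "h = k"
proof -
  have hk: "h \<in> arrows G" "k \<in> arrows G" "src G h = src G g" "src G k = src G g"
    using h(1) k(1) by (auto simp: src_fibre_def)
  have "gmult G g (ginv G h) = gmult G g (ginv G k)"
    by (rule bisection_rng_eq[OF U h(2) k(2)]) (use g hk in simp)
  then show ?thesis using arrows_mult_inv_eq[OF g hk(1,2,3,4)] by blast
qed

lemma finite_rows_Cc_on:
  assumes U: "open_bisection G U" and f: "f \<in> Cc_on G U" shows "finite_rows f"
  unfolding finite_rows_def
proof
  fix g assume g: "g \<in> arrows G"
  let ?H = "{h \<in> src_fibre G (src G g). f (gmult G g (ginv G h)) \<noteq> 0}"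
  have fU: "k \<in> U" if "f k \<noteq> 0" for k using f that by (auto simp: Cc_on_def)
  show "finite ?H"
  proof (cases "?H = {}")
    case False
    then obtain h where h: "h \<in> ?H" by blast
    have "?H \<subseteq> {h}"
      using bisection_quotient_unique[OF U g _ fU _ fU] h by blast
    then show ?thesis using finite_subset by blast
  next
    case True
    show ?thesis unfolding True by simp
  qed
qed

lemma finite_rows_Cc: "f \<in> Cc G \<Longrightarrow> finite_rows f"
  unfolding Cc_def
proof (induction rule: fun_vs.span_induct_alt)
  case base
  then show ?case by (simp add: finite_rows_def)
next
  case (step c k l)
  then show ?case using finite_rows_add finite_rows_scale finite_rows_Cc_on by blast
qed

lemma convolution_add:
  assumes "finite_rows f" "finite_rows k"
  shows "convolution G (f + k) \<xi> = convolution G f \<xi> + convolution G k \<xi>"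
proof
  fix g
  show "convolution G (f + k) \<xi> g = (convolution G f \<xi> + convolution G k \<xi>) g"
  proof (cases "g \<in> arrows G")
    case True
    show ?thesis
      using infsum_add[OF finite_rows_summable[OF assms(1) True] finite_rows_summable[OF assms(2) True]]
      by (simp add: convolution_eq[OF True] algebra_simps)
  qed (simp add: convolution_outside)
qed

lemma convolution_scale: "convolution G (fun_scale c f) \<xi> = fun_scale c (convolution G f \<xi>)"
proof
  fix g
  show "convolution G (fun_scale c f) \<xi> g = fun_scale c (convolution G f \<xi>) g"
  proof (cases "g \<in> arrows G")
    case True
    show ?thesis
      by (simp add: convolution_eq[OF True] fun_scale_def mult.assoc infsum_cmult_right')
  qed (simp add: convolution_outside fun_scale_def)
qed

lemma convolution_zero [simp]: "convolution G 0 \<xi> = 0"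
  using convolution_scale[of 0 0 \<xi>] by simp

lemma convolution_diff:
  assumes "f \<in> Cc G" "k \<in> Cc G"
  shows "convolution G (f - k) \<xi> = convolution G f \<xi> - convolution G k \<xi>"
proof -
  have eq: "p - r = p + fun_scale (-1) r" for p r :: "'g \<Rightarrow> complex" by (auto simp: fun_scale_def)
  show ?thesis
    unfolding eq convolution_add[OF finite_rows_Cc[OF assms(1)] finite_rows_scale[OF finite_rows_Cc[OF assms(2)]]]
      convolution_scale ..
qed

lemma Cc_on_bounded:
  assumes U: "open_bisection G U" and f: "f \<in> Cc_on G U"
  obtains M where "M \<ge> 0" "\<And>g. cmod (f g) \<le> M"
proof -
  let ?K = "subtopology (gtop G) U closure_of {g \<in> U. f g \<noteq> 0}"
  have "compactin euclidean (f ` ?K)"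
    using f image_compactin unfolding Cc_on_def by blast
  then have "bounded (f ` ?K)" by (simp add: compact_imp_bounded)
  then obtain M where M: "\<And>g. g \<in> ?K \<Longrightarrow> cmod (f g) \<le> M" unfolding bounded_iff by blast
  have "{g \<in> U. f g \<noteq> 0} \<subseteq> ?K"
    using closure_of_subset[of "{g \<in> U. f g \<noteq> 0}" "subtopology (gtop G) U"]
      openin_subset[OF bisection_open[OF U]] by auto
  moreover have "f g = 0" if "g \<notin> U" for g using f that by (simp add: Cc_on_def)
  ultimately have "cmod (f g) \<le> max M 0" for g using M[of g] by (cases "f g = 0") fastforce+
  then show ?thesis using that[of "max M 0"] by simp
qed

text \<open>For a function carried by a bisection the matrix has at most one nonzero entry in each
  row and each column, so its operator norm is bounded by any bound for the entries.\<close>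

lemma Cc_on_convolution_bound:
  assumes U: "open_bisection G U" and f: "f \<in> Cc_on G U"
    and M: "M \<ge> 0" "\<And>g. cmod (f g) \<le> M" and \<xi>: "\<xi> \<in> ell2 (src_fibre G x)"
  shows "convolution G f \<xi> \<in> ell2 (src_fibre G x)"
    "ell2_norm (src_fibre G x) (convolution G f \<xi>) \<le> M * ell2_norm (src_fibre G x) \<xi>"
proof -
  have fU: "k \<in> U" if "f k \<noteq> 0" for k using f that by (auto simp: Cc_on_def)
  have L2: "L2_set (\<lambda>g. cmod (convolution G f \<xi> g)) S \<le> M * ell2_norm (src_fibre G x) \<xi>"
    if S: "finite S" "S \<subseteq> src_fibre G x" for S
  proof -
    have SA: "g \<in> arrows G" "src G g = x" if "g \<in> S" for g using S(2) that by (auto simp: src_fibre_def)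
    define S' where "S' = {g \<in> S. \<exists>h\<in>src_fibre G x. f (gmult G g (ginv G h)) \<noteq> 0}"
    have "\<forall>g\<in>S'. \<exists>h. h \<in> src_fibre G x \<and> f (gmult G g (ginv G h)) \<noteq> 0" by (auto simp: S'_def)
    \<comment> \<open>\<open>\<tau> g\<close> is the column of the nonzero entry in row
      \<open>g\<close>. Distinct rows use distinct columns because the source map is injective on
      \<open>U\<close>, which allows reindexing the sum of squares.\<close>
    from bchoice[OF this] obtain \<tau> where
      \<tau>: "\<And>g. g \<in> S' \<Longrightarrow> \<tau> g \<in> src_fibre G x \<and> f (gmult G g (ginv G (\<tau> g))) \<noteq> 0" by blast
    have S'S: "S' \<subseteq> S" by (auto simp: S'_def)
    have conv1: "convolution G f \<xi> g = f (gmult G g (ginv G (\<tau> g))) * \<xi> (\<tau> g)" if g: "g \<in> S'" for g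
    proof -
      have gA: "g \<in> arrows G" "src G g = x" using SA S'S g by blast+
      show ?thesis unfolding convolution_eq[OF gA(1)]
      proof (rule infsum_supported_single)
        show "\<tau> g \<in> src_fibre G (src G g)" using \<tau>[OF g] gA(2) by simp
        fix h assume h: "h \<in> src_fibre G (src G g)" "h \<noteq> \<tau> g"
        have "f (gmult G g (ginv G h)) = 0"
        proof (rule ccontr)
          assume "f (gmult G g (ginv G h)) \<noteq> 0"
          then have "h = \<tau> g"
            using bisection_quotient_unique[OF U gA(1) h(1) fU, of "\<tau> g"] \<tau>[OF g] gA(2) fU by blast
          then show False using h(2) by blast
        qed
        then show "f (gmult G g (ginv G h)) * \<xi> h = 0" by simp
      qed
    qed
    have conv0: "convolution G f \<xi> g = 0" if g: "g \<in> S - S'" for g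
    proof -
      have gA: "g \<in> arrows G" "src G g = x" using SA g by blast+
      have "f (gmult G g (ginv G h)) = 0" if "h \<in> src_fibre G x" for h
        using g that by (auto simp: S'_def)
      then show ?thesis unfolding convolution_eq[OF gA(1)] gA(2) by (intro infsum_0) simp
    qed
    have inj: "inj_on \<tau> S'"
    proof (rule inj_onI)
      fix g k assume gk: "g \<in> S'" "k \<in> S'" "\<tau> g = \<tau> k"
      let ?h = "\<tau> g"
      have A: "g \<in> arrows G" "src G g = x" "k \<in> arrows G" "src G k = x" "?h \<in> arrows G" "src G ?h = x"
        using gk SA S'S \<tau>[OF gk(1)] by (auto simp: src_fibre_def)
      have "gmult G g (ginv G ?h) \<in> U" "gmult G k (ginv G ?h) \<in> U"
        using \<tau>[OF gk(1)] \<tau>[OF gk(2)] gk(3) fU by auto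
      then have eq: "gmult G g (ginv G ?h) = gmult G k (ginv G ?h)"
        by (rule bisection_src_eq[OF U]) (use A in simp)
      have "gmult G (gmult G g (ginv G ?h)) ?h = g" "gmult G (gmult G k (ginv G ?h)) ?h = k"
        using A by (simp_all only: mult_inv_cancel)
      then show "g = k" unfolding eq by simp
    qed
    have finS': "finite S'" using S(1) S'S finite_subset by blast
    have "L2_set (\<lambda>g. cmod (convolution G f \<xi> g)) S = L2_set (\<lambda>g. cmod (convolution G f \<xi> g)) S'"
      unfolding L2_set_def using S(1) S'S conv0
      by (intro arg_cong[where f = sqrt] sum.mono_neutral_right) auto
    also have "\<dots> \<le> L2_set (\<lambda>g. M * cmod (\<xi> (\<tau> g))) S'"
      by (rule L2_set_mono) (auto simp: conv1 norm_mult intro: mult_right_mono M(2))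
    also have "\<dots> = M * L2_set (\<lambda>g. cmod (\<xi> (\<tau> g))) S'"
      using M(1) by (simp add: L2_set_right_distrib)
    also have "L2_set (\<lambda>g. cmod (\<xi> (\<tau> g))) S' = L2_set (\<lambda>h. cmod (\<xi> h)) (\<tau> ` S')"
      unfolding L2_set_def by (simp add: sum.reindex[OF inj])
    also have "\<dots> \<le> ell2_norm (src_fibre G x) \<xi>"
      using finS' \<tau> by (intro L2_set_le_ell2_norm[OF \<xi>]) auto
    finally show ?thesis using M(1) by (simp add: mult_left_mono)
  qed
  show "convolution G f \<xi> \<in> ell2 (src_fibre G x)"
    "ell2_norm (src_fibre G x) (convolution G f \<xi>) \<le> M * ell2_norm (src_fibre G x) \<xi>"
    using ell2_normI[OF convolution_outside_fibre[OF \<xi>] L2] by blast+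
qed

text \<open>The bound is uniform in the unit \<open>x\<close>, so both suprema that define
  \<open>red_norm\<close> are over bounded sets.\<close>

lemma Cc_convolution_bound:
  assumes "f \<in> Cc G"
  shows "\<exists>M\<ge>0. \<forall>x. \<forall>\<xi>\<in>ell2 (src_fibre G x). convolution G f \<xi> \<in> ell2 (src_fibre G x) \<and>
    ell2_norm (src_fibre G x) (convolution G f \<xi>) \<le> M * ell2_norm (src_fibre G x) \<xi>"
    (is "?P f")
proof -
  \<comment> \<open>\<open>finite_rows\<close> is carried through the induction because additivity
    of convolution depends on it.\<close>
  have "finite_rows f \<and> ?P f"
    using assms unfolding Cc_def
  proof (induction rule: fun_vs.span_induct_alt)
    case base
    have "?P 0"
      by (intro exI[of _ 0] conjI allI ballI)
        (simp_all only: convolution_zero ell2_zero order_refl mult_zero_left)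
    then show ?case by (simp add: finite_rows_def)
  next
    case (step c k l)
    from step.hyps obtain U where U: "open_bisection G U" "k \<in> Cc_on G U" by blast
    obtain M where M: "M \<ge> 0" "\<And>g. cmod (k g) \<le> M" using Cc_on_bounded[OF U] by blast
    obtain N where N: "N \<ge> 0" "\<And>x \<xi>. \<xi> \<in> ell2 (src_fibre G x) \<Longrightarrow> convolution G l \<xi> \<in> ell2 (src_fibre G x) \<and>
      ell2_norm (src_fibre G x) (convolution G l \<xi>) \<le> N * ell2_norm (src_fibre G x) \<xi>"
      using step.IH by blast
    have l: "finite_rows l" using step.IH by blast
    have "?P (fun_scale c k + l)"
    proof (intro exI[of _ "cmod c * M + N"] conjI allI ballI)
      show "0 \<le> cmod c * M + N" using M N by simp
      fix x \<xi> assume \<xi>: "\<xi> \<in> ell2 (src_fibre G x)"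
      let ?k = "fun_scale c (convolution G k \<xi>)" and ?l = "convolution G l \<xi>"
      have eq: "convolution G (fun_scale c k + l) \<xi> = ?k + ?l"
        using finite_rows_scale[OF finite_rows_Cc_on[OF U]] l by (simp add: convolution_add convolution_scale)
      note K = Cc_on_convolution_bound[OF U M \<xi>]
      note L = N(2)[OF \<xi>]
      show "convolution G (fun_scale c k + l) \<xi> \<in> ell2 (src_fibre G x)"
        unfolding eq using K(1) L by (intro ell2_add ell2_scale) auto
      have "ell2_norm (src_fibre G x) (?k + ?l) \<le> ell2_norm (src_fibre G x) ?k + ell2_norm (src_fibre G x) ?l"
        using K(1) L by (intro ell2_add ell2_scale) auto
      also have "ell2_norm (src_fibre G x) ?k \<le> cmod c * ell2_norm (src_fibre G x) (convolution G k \<xi>)"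
        by (rule ell2_scale(2)[OF K(1)])
      also have "\<dots> \<le> cmod c * (M * ell2_norm (src_fibre G x) \<xi>)"
        using K(2) by (simp add: mult_left_mono)
      finally show "ell2_norm (src_fibre G x) (convolution G (fun_scale c k + l) \<xi>)
          \<le> (cmod c * M + N) * ell2_norm (src_fibre G x) \<xi>"
        unfolding eq using L by (simp add: algebra_simps)
    qed
    then show ?case using finite_rows_add[OF finite_rows_scale[OF finite_rows_Cc_on[OF U]] l] by blast
  qed
  then show ?thesis by blast
qed

lemma convolution_delta:
  assumes "x \<in> units G"
  shows "convolution G f (delta x) = (\<lambda>g. if g \<in> src_fibre G x then f g else 0)"
proof
  fix g
  have xx: "x \<in> src_fibre G x" using assms unit_arrow by (simp add: src_fibre_def)
  show "convolution G f (delta x) g = (if g \<in> src_fibre G x then f g else 0)"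
  proof (cases "g \<in> src_fibre G x")
    case True
    then have g: "g \<in> arrows G" "src G g = x" by (auto simp: src_fibre_def)
    have "convolution G f (delta x) g = f (gmult G g (ginv G x)) * delta x x"
      unfolding convolution_eq[OF g(1)]
      by (rule infsum_supported_single) (use xx g in \<open>auto simp: delta_def\<close>)
    then show ?thesis using True g assms by (simp add: delta_def mult_unit_right)
  next
    case False
    then show ?thesis using convolution_outside_fibre[OF ell2_delta(1)[OF xx]] by simp
  qed
qed

end

section \<open>The reduced norm and its Cauchy sequences\<close>

locale nonempty_etale_gpd = etale_gpd +
  assumes units_nonempty: "units G \<noteq> {}"
begin

lemma ell2_unit_ball_nonempty: "{\<xi> \<in> ell2 A. ell2_norm A \<xi> \<le> 1} \<noteq> {}"
  by (rule ex_in_conv[THEN iffD1], rule exI[of _ 0]) (simp only: mem_Collect_eq ell2_zero, simp)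

lemma ell2_norm_convolution_le:
  assumes f: "f \<in> Cc G" and x: "x \<in> units G"
    and \<xi>: "\<xi> \<in> ell2 (src_fibre G x)" "ell2_norm (src_fibre G x) \<xi> \<le> 1"
  shows "ell2_norm (src_fibre G x) (convolution G f \<xi>) \<le> red_norm G f"
proof -
  obtain M where M: "M \<ge> 0" "\<And>x \<xi>. \<xi> \<in> ell2 (src_fibre G x) \<Longrightarrow>
    ell2_norm (src_fibre G x) (convolution G f \<xi>) \<le> M * ell2_norm (src_fibre G x) \<xi>"
    using Cc_convolution_bound[OF f] by blast
  have le: "ell2_norm (src_fibre G y) (convolution G f \<eta>) \<le> M"
    if "\<eta> \<in> ell2 (src_fibre G y)" "ell2_norm (src_fibre G y) \<eta> \<le> 1" for y \<eta>
    using M(2)[OF that(1)] mult_left_mono[OF that(2) M(1)] by simp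
  have "ell2_norm (src_fibre G x) (convolution G f \<xi>) \<le> ell2_opnorm (src_fibre G x) (convolution G f)"
    unfolding ell2_opnorm_def using \<xi> le by (intro cSUP_upper bdd_aboveI2[of _ _ M]) auto
  also have "\<dots> \<le> red_norm G f"
    unfolding red_norm_def
  proof (rule cSUP_upper[OF x], rule bdd_aboveI2)
    show "ell2_opnorm (src_fibre G y) (convolution G f) \<le> M" for y
      unfolding ell2_opnorm_def by (rule cSUP_least[OF ell2_unit_ball_nonempty]) (use le in auto)
  qed
  finally show ?thesis .
qed

text \<open>Existence of units is essential here, as a real supremum over the empty set carries no
  bound.\<close>

lemma red_norm_le:
  assumes "\<And>x \<xi>. x \<in> units G \<Longrightarrow> \<xi> \<in> ell2 (src_fibre G x) \<Longrightarrow> ell2_norm (src_fibre G x) \<xi> \<le> 1 \<Longrightarrow>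
    ell2_norm (src_fibre G x) (convolution G f \<xi>) \<le> c"
  shows "red_norm G f \<le> c"
  unfolding red_norm_def ell2_opnorm_def using assms
  by (intro cSUP_least[OF units_nonempty] cSUP_least[OF ell2_unit_ball_nonempty]) auto

lemma red_norm_nonneg: "f \<in> Cc G \<Longrightarrow> 0 \<le> red_norm G f"
proof -
  assume f: "f \<in> Cc G"
  obtain x where x: "x \<in> units G" using units_nonempty by blast
  have "ell2_norm (src_fibre G x) (convolution G f 0) \<le> red_norm G f"
    by (rule ell2_norm_convolution_le[OF f x ell2_zero(1)]) (simp only: ell2_zero(2) zero_le_one)
  then show ?thesis using ell2_norm_nonneg order_trans by blast
qed

lemma Cc_diff: "f \<in> Cc G \<Longrightarrow> k \<in> Cc G \<Longrightarrow> f - k \<in> Cc G"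
  and Cc_zero: "0 \<in> Cc G"
  unfolding Cc_def by (rule fun_vs.span_diff fun_vs.span_zero; assumption)+

lemma red_norm_zero: "red_norm G 0 = 0"
proof (rule antisym)
  show "red_norm G 0 \<le> 0" by (rule red_norm_le) (simp only: convolution_zero ell2_zero order_refl)
qed (rule red_norm_nonneg[OF Cc_zero])

lemma red_norm_minus_commute:
  assumes "f \<in> Cc G" "k \<in> Cc G"
  shows "red_norm G (f - k) = red_norm G (k - f)"
proof -
  have "red_norm G (f - k) \<le> red_norm G (k - f)" if fk: "f \<in> Cc G" "k \<in> Cc G" for f k
  proof (rule red_norm_le)
    fix x \<xi> assume "x \<in> units G" "\<xi> \<in> ell2 (src_fibre G x)" "ell2_norm (src_fibre G x) \<xi> \<le> 1"
    from ell2_norm_convolution_le[OF Cc_diff[OF fk(2,1)] this]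
    show "ell2_norm (src_fibre G x) (convolution G (f - k) \<xi>) \<le> red_norm G (k - f)"
      unfolding convolution_diff[OF fk] convolution_diff[OF fk(2,1)] by (simp only: ell2_norm_minus)
  qed
  then show ?thesis using assms by (intro antisym) auto
qed

lemma red_norm_triangle:
  assumes "f \<in> Cc G" "k \<in> Cc G" "l \<in> Cc G"
  shows "red_norm G (f - l) \<le> red_norm G (f - k) + red_norm G (k - l)"
proof (rule red_norm_le)
  fix x \<xi> assume \<xi>: "x \<in> units G" "\<xi> \<in> ell2 (src_fibre G x)" "ell2_norm (src_fibre G x) \<xi> \<le> 1"
  have in_ell2: "convolution G p \<xi> \<in> ell2 (src_fibre G x)" if "p \<in> Cc G" for p
    using Cc_convolution_bound[OF that] \<xi>(2) by blast
  have "f - l = (f - k) + (k - l)" by simp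
  then have "convolution G (f - l) \<xi> = convolution G (f - k) \<xi> + convolution G (k - l) \<xi>"
    using convolution_add[OF finite_rows_Cc finite_rows_Cc] Cc_diff assms by metis
  then have "ell2_norm (src_fibre G x) (convolution G (f - l) \<xi>)
      \<le> ell2_norm (src_fibre G x) (convolution G (f - k) \<xi>) + ell2_norm (src_fibre G x) (convolution G (k - l) \<xi>)"
    using ell2_add(2) in_ell2 Cc_diff assms by metis
  also have "\<dots> \<le> red_norm G (f - k) + red_norm G (k - l)"
    using \<xi> assms by (intro add_mono ell2_norm_convolution_le Cc_diff)
  finally show "ell2_norm (src_fibre G x) (convolution G (f - l) \<xi>) \<le> red_norm G (f - k) + red_norm G (k - l)" .
qed

lemma L2_set_le_red_norm:
  assumes "f \<in> Cc G" "k \<in> Cc G" "x \<in> units G" "\<xi> \<in> ell2 (src_fibre G x)"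
    "ell2_norm (src_fibre G x) \<xi> \<le> 1" "finite S" "S \<subseteq> src_fibre G x"
  shows "L2_set (\<lambda>g. cmod (convolution G f \<xi> g - convolution G k \<xi> g)) S \<le> red_norm G (f - k)"
proof -
  have d: "f - k \<in> Cc G" using assms by (intro Cc_diff)
  have "convolution G (f - k) \<xi> \<in> ell2 (src_fibre G x)" using Cc_convolution_bound[OF d] assms(4) by blast
  from L2_set_le_ell2_norm[OF this assms(6,7)] ell2_norm_convolution_le[OF d assms(3,4,5)]
  show ?thesis unfolding convolution_diff[OF assms(1,2)] by simp
qed

text \<open>The value \<open>f g\<close> is the coordinate at \<open>g\<close> of the image of the
  unit vector at \<open>src G g\<close>, so it is bounded by the operator norm on that
  fibre.\<close>

lemma cmod_le_red_norm:
  assumes "f \<in> Cc G" "k \<in> Cc G" "g \<in> arrows G"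
  shows "cmod (f g - k g) \<le> red_norm G (f - k)"
proof -
  let ?x = "src G g"
  have x: "?x \<in> units G" "?x \<in> src_fibre G ?x" "{g} \<subseteq> src_fibre G ?x"
    using assms(3) unit_arrow by (auto simp: src_fibre_def)
  have "L2_set (\<lambda>h. cmod (convolution G f (delta ?x) h - convolution G k (delta ?x) h)) {g} \<le> red_norm G (f - k)"
    by (rule L2_set_le_red_norm[OF assms(1,2) x(1) ell2_delta[OF x(2)] _ x(3)]) simp
  then show ?thesis using x(3) by (simp add: convolution_delta[OF x(1)])
qed

lemma red_CauchyD:
  assumes "F \<in> red_Cauchy G"
  shows "F n \<in> Cc G" "\<epsilon> > 0 \<Longrightarrow> \<exists>N. \<forall>m\<ge>N. \<forall>n\<ge>N. red_norm G (F m - F n) < \<epsilon>"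
  using assms by (auto simp: red_Cauchy_def)

lemma const_red_Cauchy: "h \<in> Cc G \<Longrightarrow> (\<lambda>n. h) \<in> red_Cauchy G"
proof -
  assume "h \<in> Cc G"
  moreover have "red_norm G (h - h) = 0" unfolding diff_self by (rule red_norm_zero)
  ultimately show ?thesis unfolding red_Cauchy_def by simp
qed

lemma equiv_red: "equiv (red_Cauchy G) (red_equiv G)"
proof (rule equivI)
  show "red_equiv G \<subseteq> red_Cauchy G \<times> red_Cauchy G" by (auto simp: red_equiv_def)
  show "refl_on (red_Cauchy G) (red_equiv G)"
  proof (rule refl_onI)
    fix F assume "F \<in> red_Cauchy G"
    moreover have "red_norm G (F n - F n) = 0" for n unfolding diff_self by (rule red_norm_zero)
    ultimately show "(F, F) \<in> red_equiv G" by (simp add: red_equiv_def)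
  qed
  show "sym (red_equiv G)"
  proof (rule symI)
    fix F F' assume FF': "(F, F') \<in> red_equiv G"
    then have "red_norm G (F' n - F n) = red_norm G (F n - F' n)" for n
      using red_norm_minus_commute red_CauchyD(1) by (auto simp: red_equiv_def)
    then show "(F', F) \<in> red_equiv G" using FF' by (simp add: red_equiv_def)
  qed
  show "trans (red_equiv G)"
  proof (rule transI)
    fix F F' F'' assume FF: "(F, F') \<in> red_equiv G" "(F', F'') \<in> red_equiv G"
    then have C: "F n \<in> Cc G" "F' n \<in> Cc G" "F'' n \<in> Cc G" for n
      using red_CauchyD(1) by (auto simp: red_equiv_def)
    have "(\<lambda>n. red_norm G (F n - F' n) + red_norm G (F' n - F'' n)) \<longlonglongrightarrow> 0 + 0"
      using FF by (intro tendsto_add) (auto simp: red_equiv_def)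
    then have "(\<lambda>n. red_norm G (F n - F'' n)) \<longlonglongrightarrow> 0"
      using red_norm_triangle[OF C] red_norm_nonneg[OF Cc_diff[OF C(1,3)]]
      by (intro tendsto_sandwich[of "\<lambda>_. 0" "\<lambda>n. red_norm G (F n - F'' n)" sequentially
            "\<lambda>n. red_norm G (F n - F' n) + red_norm G (F' n - F'' n)" 0]) auto
    then show "(F, F'') \<in> red_equiv G" using FF by (simp add: red_equiv_def)
  qed
qed

lemma red_Cauchy_pointwise:
  assumes F: "F \<in> red_Cauchy G" and g: "g \<in> arrows G"
  shows "(\<lambda>n. F n g) \<longlonglongrightarrow> lim (\<lambda>n. F n g)"
proof -
  have "Cauchy (\<lambda>n. F n g)"
  proof (rule metric_CauchyI)
    fix \<epsilon> :: real assume "\<epsilon> > 0"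
    then obtain N where N: "\<forall>m\<ge>N. \<forall>n\<ge>N. red_norm G (F m - F n) < \<epsilon>" using red_CauchyD(2)[OF F] by blast
    have "dist (F m g) (F n g) < \<epsilon>" if "m \<ge> N" "n \<ge> N" for m n
      using cmod_le_red_norm[OF red_CauchyD(1)[OF F, of m] red_CauchyD(1)[OF F, of n] g] N that
      unfolding dist_norm by fastforce
    then show "\<exists>N. \<forall>m\<ge>N. \<forall>n\<ge>N. dist (F m g) (F n g) < \<epsilon>" by blast
  qed
  then show ?thesis using Cauchy_convergent_iff convergent_LIMSEQ_iff by blast
qed

lemma tendsto_L2_set:
  assumes "\<And>g. g \<in> S \<Longrightarrow> (\<lambda>m. u m g) \<longlonglongrightarrow> v g"
  shows "(\<lambda>m. L2_set (\<lambda>g. cmod (u m g)) S) \<longlonglongrightarrow> L2_set (\<lambda>g. cmod (v g)) S"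
  unfolding L2_set_def by (intro tendsto_intros assms)

text \<open>In the Cauchy estimate on a finite set the second index tends to infinity. This turns
  the coordinatewise limit into a bound on every finite part, and so into convergence in
  norm.\<close>

lemma red_Cauchy_ell2_limit:
  assumes F: "F \<in> red_Cauchy G" and x: "x \<in> units G"
    and \<eta>: "\<And>g. g \<notin> src_fibre G x \<Longrightarrow> \<eta> g = 0" "\<And>g. g \<in> src_fibre G x \<Longrightarrow> (\<lambda>n. F n g) \<longlonglongrightarrow> \<eta> g"
  shows "\<eta> \<in> ell2 (src_fibre G x)"
    "(\<lambda>n. ell2_norm (src_fibre G x) (convolution G (F n) (delta x) - \<eta>)) \<longlonglongrightarrow> 0"
proof -
  let ?A = "src_fibre G x"
  have xA: "x \<in> ?A" using x unit_arrow by (simp add: src_fibre_def)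
  let ?D = "\<lambda>n. convolution G (F n) (delta x)"
  have D: "?D n g = F n g" if "g \<in> ?A" for n g using that by (simp add: convolution_delta[OF x])
  have main: "\<exists>N. \<forall>n\<ge>N. ?D n - \<eta> \<in> ell2 ?A \<and> ell2_norm ?A (?D n - \<eta>) \<le> \<epsilon>" if \<epsilon>: "\<epsilon> > 0" for \<epsilon>
  proof -
    obtain N where N: "\<forall>m\<ge>N. \<forall>n\<ge>N. red_norm G (F m - F n) < \<epsilon>" using red_CauchyD(2)[OF F \<epsilon>] by blast
    have "?D n - \<eta> \<in> ell2 ?A \<and> ell2_norm ?A (?D n - \<eta>) \<le> \<epsilon>" if n: "n \<ge> N" for n
    proof -
      have out: "(?D n - \<eta>) g = 0" if "g \<notin> ?A" for g
        using that \<eta>(1) by (simp add: convolution_delta[OF x])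
      have le: "L2_set (\<lambda>g. cmod ((?D n - \<eta>) g)) S \<le> \<epsilon>" if S: "finite S" "S \<subseteq> ?A" for S
      proof -
        have "(\<lambda>m. L2_set (\<lambda>g. cmod (?D n g - ?D m g)) S) \<longlonglongrightarrow> L2_set (\<lambda>g. cmod (?D n g - \<eta> g)) S"
          using S(2) D \<eta>(2) by (intro tendsto_L2_set tendsto_diff tendsto_const) (auto simp: subset_iff)
        moreover have "L2_set (\<lambda>g. cmod (?D n g - ?D m g)) S \<le> \<epsilon>" if "m \<ge> N" for m
          using L2_set_le_red_norm[OF red_CauchyD(1)[OF F, of n] red_CauchyD(1)[OF F, of m] x ell2_delta[OF xA] S]
            N n that by fastforce
        ultimately have "L2_set (\<lambda>g. cmod (?D n g - \<eta> g)) S \<le> \<epsilon>" by (intro LIMSEQ_le_const2) blast+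
        then show ?thesis by simp
      qed
      show ?thesis using ell2_normI[OF out le] by blast
    qed
    then show ?thesis by blast
  qed
  obtain N where N: "?D N - \<eta> \<in> ell2 ?A" using main[of 1] by auto
  have "?D N \<in> ell2 ?A" using Cc_convolution_bound[OF red_CauchyD(1)[OF F]] ell2_delta(1)[OF xA] by blast
  then have "?D N + fun_scale (-1) (?D N - \<eta>) \<in> ell2 ?A" using N by (intro ell2_add ell2_scale)
  moreover have "?D N + fun_scale (-1) (?D N - \<eta>) = \<eta>" by (auto simp: fun_scale_def)
  ultimately show "\<eta> \<in> ell2 ?A" by metis
  show "(\<lambda>n. ell2_norm ?A (?D n - \<eta>)) \<longlonglongrightarrow> 0"
  proof (rule LIMSEQ_I)
    fix r :: real assume r: "r > 0"
    then obtain N where N: "\<forall>n\<ge>N. ell2_norm ?A (?D n - \<eta>) \<le> r / 2" using main[of "r / 2"] by auto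
    have "norm (ell2_norm ?A (?D n - \<eta>) - 0) < r" if "n \<ge> N" for n
      using spec[OF N, of n] that r by (simp add: abs_of_nonneg[OF ell2_norm_nonneg])
    then show "\<exists>N. \<forall>n\<ge>N. norm (ell2_norm ?A (?D n - \<eta>) - 0) < r" by blast
  qed
qed

section \<open>Elements of the completion as functions\<close>

lemma Cred_class:
  assumes "a \<in> Cred G" "F \<in> a"
  shows "F \<in> red_Cauchy G" "a = red_equiv G `` {F}"
proof -
  obtain F0 where F0: "F0 \<in> red_Cauchy G" "a = red_equiv G `` {F0}"
    using assms(1) unfolding Cred_def by (rule quotientE)
  then have FF: "(F0, F) \<in> red_equiv G" using assms(2) by blast
  then show "F \<in> red_Cauchy G" by (simp add: red_equiv_def)
  show "a = red_equiv G `` {F}" using F0(2) equiv_class_eq[OF equiv_red FF] by simp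
qed

lemma Cred_nonempty: assumes "a \<in> Cred G" obtains F where "F \<in> a"
proof -
  obtain F0 where F0: "F0 \<in> red_Cauchy G" "a = red_equiv G `` {F0}"
    using assms unfolding Cred_def by (rule quotientE)
  then show ?thesis using that equiv_class_self[OF equiv_red F0(1)] by blast
qed

lemma Cred_of_in: "h \<in> Cc G \<Longrightarrow> Cred_of G h \<in> Cred G" "h \<in> Cc G \<Longrightarrow> (\<lambda>n. h) \<in> Cred_of G h"
  unfolding Cred_of_def Cred_def
  using const_red_Cauchy equiv_class_self[OF equiv_red] by (auto intro: quotientI)

text \<open>The definite description in \<open>reg_rep\<close> has to be resolved. The
  coordinatewise limit \<eta> is the same for every representing sequence, is the norm limit along
  each of them, and equals any other candidate since norm convergence implies convergence of
  coordinates.\<close>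

lemma Cred_fun_tendsto:
  assumes a: "a \<in> Cred G" and F: "F \<in> a" and g: "g \<in> arrows G"
  shows "(\<lambda>n. F n g) \<longlonglongrightarrow> Cred_fun G a g"
proof -
  define x where "x = src G g"
  let ?A = "src_fibre G x"
  have x: "x \<in> units G" and gA: "g \<in> ?A" using g by (auto simp: x_def src_fibre_def)
  note FC = Cred_class(1)[OF a F]
  define \<eta> where "\<eta> k = (if k \<in> ?A then lim (\<lambda>n. F n k) else 0)" for k
  have lim: "(\<lambda>n. F' n k) \<longlonglongrightarrow> \<eta> k" if F': "F' \<in> a" and k: "k \<in> ?A" for F' k
  proof -
    have kA: "k \<in> arrows G" using k by (simp add: src_fibre_def)
    have e: "(F, F') \<in> red_equiv G" using F' Cred_class(2)[OF a F] by blast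
    have "(\<lambda>n. F n k - F' n k) \<longlonglongrightarrow> 0"
    proof (rule Lim_null_comparison)
      show "(\<lambda>n. red_norm G (F n - F' n)) \<longlonglongrightarrow> 0" using e by (simp add: red_equiv_def)
      show "\<forall>\<^sub>F n in sequentially. cmod (F n k - F' n k) \<le> red_norm G (F n - F' n)"
        using cmod_le_red_norm[OF red_CauchyD(1)[OF FC] red_CauchyD(1)[OF Cred_class(1)[OF a F']] kA]
        by (intro always_eventually) blast
    qed
    from tendsto_diff[OF red_Cauchy_pointwise[OF FC kA] this]
    show ?thesis using k by (simp add: \<eta>_def)
  qed
  have \<eta>0: "\<eta> k = 0" if "k \<notin> ?A" for k using that by (simp add: \<eta>_def)
  have "reg_rep G x a (delta x) = \<eta>"
    unfolding reg_rep_def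
  proof (rule the_equality)
    show "\<eta> \<in> ell2 ?A \<and> (\<forall>F\<in>a. (\<lambda>n. ell2_norm ?A (convolution G (F n) (delta x) - \<eta>)) \<longlonglongrightarrow> 0)"
    proof (intro conjI ballI)
      show "\<eta> \<in> ell2 ?A" by (rule red_Cauchy_ell2_limit(1)[OF FC x \<eta>0 lim[OF F]])
      show "(\<lambda>n. ell2_norm ?A (convolution G (F' n) (delta x) - \<eta>)) \<longlonglongrightarrow> 0" if F': "F' \<in> a" for F'
        by (rule red_Cauchy_ell2_limit(2)[OF Cred_class(1)[OF a F'] x \<eta>0 lim[OF F']])
    qed
    fix \<zeta> assume \<zeta>: "\<zeta> \<in> ell2 ?A \<and> (\<forall>F\<in>a. (\<lambda>n. ell2_norm ?A (convolution G (F n) (delta x) - \<zeta>)) \<longlonglongrightarrow> 0)"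
    show "\<zeta> = \<eta>"
    proof
      fix k
      show "\<zeta> k = \<eta> k"
      proof (cases "k \<in> ?A")
        case True
        have "(\<lambda>n. F n k - \<zeta> k) \<longlonglongrightarrow> 0"
        proof (rule Lim_null_comparison)
          show "(\<lambda>n. ell2_norm ?A (convolution G (F n) (delta x) - \<zeta>)) \<longlonglongrightarrow> 0" using \<zeta> F by blast
          have "cmod (F n k - \<zeta> k) \<le> ell2_norm ?A (convolution G (F n) (delta x) - \<zeta>)" for n
          proof -
            have xA: "x \<in> ?A" using x unit_arrow by (simp add: src_fibre_def)
            have "convolution G (F n) (delta x) \<in> ell2 ?A"
              using Cc_convolution_bound[OF red_CauchyD(1)[OF FC]] ell2_delta(1)[OF xA] by blast
            then have "convolution G (F n) (delta x) + fun_scale (-1) \<zeta> \<in> ell2 ?A"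
              using \<zeta> by (intro ell2_add ell2_scale) auto
            moreover have "convolution G (F n) (delta x) + fun_scale (-1) \<zeta> = convolution G (F n) (delta x) - \<zeta>"
              by (auto simp: fun_scale_def)
            ultimately have "convolution G (F n) (delta x) - \<zeta> \<in> ell2 ?A" by metis
            from cmod_le_ell2_norm[OF this, of k] show ?thesis
              using True by (simp add: convolution_delta[OF x])
          qed
          then show "\<forall>\<^sub>F n in sequentially. cmod (F n k - \<zeta> k) \<le> ell2_norm ?A (convolution G (F n) (delta x) - \<zeta>)"
            by (intro always_eventually) blast
        qed
        then have "(\<lambda>n. F n k) \<longlonglongrightarrow> \<zeta> k" by (simp add: Lim_null[symmetric])
        then show ?thesis using lim[OF F True] LIMSEQ_unique by blast
      next
        case False
        then show ?thesis using \<zeta> \<eta>0 ell2_outside by metis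
      qed
    qed
  qed
  then have "Cred_fun G a g = (\<Sum>\<^sub>\<infinity>k\<in>?A. \<eta> k * cnj (delta g k))"
    by (simp add: Cred_fun_def ell2_inner_def x_def)
  also have "\<dots> = \<eta> g * cnj (delta g g)"
    by (rule infsum_supported_single[OF gA]) (simp add: delta_def)
  also have "\<dots> = \<eta> g" by (simp add: delta_def)
  finally show ?thesis using lim[OF F gA] by simp
qed

lemma Cred_fun_uniform_limit:
  assumes a: "a \<in> Cred G"
  shows "Cc_uniform_limit (Cred_fun G a)"
  unfolding Cc_uniform_limit_def
proof (intro allI impI)
  fix \<epsilon> :: real assume \<epsilon>: "\<epsilon> > 0"
  obtain F where F: "F \<in> a" using Cred_nonempty[OF a] .
  note FC = Cred_class(1)[OF a F]
  obtain N where N: "\<forall>m\<ge>N. \<forall>n\<ge>N. red_norm G (F m - F n) < \<epsilon>" using red_CauchyD(2)[OF FC \<epsilon>] by blast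
  have "cmod (Cred_fun G a g - F N g) \<le> \<epsilon>" if g: "g \<in> arrows G" for g
  proof (rule LIMSEQ_le_const2)
    show "(\<lambda>m. cmod (F m g - F N g)) \<longlonglongrightarrow> cmod (Cred_fun G a g - F N g)"
      by (intro tendsto_intros Cred_fun_tendsto[OF a F g])
    show "\<exists>M. \<forall>m\<ge>M. cmod (F m g - F N g) \<le> \<epsilon>"
      using cmod_le_red_norm[OF red_CauchyD(1)[OF FC] red_CauchyD(1)[OF FC] g] N
      by (intro exI[of _ N]) (meson less_imp_le order_refl order_trans)
  qed
  then show "\<exists>h\<in>Cc G. \<forall>g\<in>arrows G. cmod (Cred_fun G a g - h g) \<le> \<epsilon>"
    using red_CauchyD(1)[OF FC, of N] by blast
qed

lemma Cred_fun_of: "h \<in> Cc G \<Longrightarrow> g \<in> arrows G \<Longrightarrow> Cred_fun G (Cred_of G h) g = h g"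
  using Cred_fun_tendsto[OF Cred_of_in] LIMSEQ_unique tendsto_const by blast

text \<open>Since \<open>f\<close> has finite rows, finitely many values of \<open>convolution G f \<xi>\<close> only see
  finitely many values of \<open>\<xi>\<close>.\<close>

lemma convolution_truncate:
  assumes f: "f \<in> Cc G" and S: "finite S" "S \<subseteq> src_fibre G x"
  obtains T where "finite T" "T \<subseteq> src_fibre G x"
    "\<And>g. g \<in> S \<Longrightarrow> convolution G f \<xi> g = convolution G f (\<lambda>h. if h \<in> T then \<xi> h else 0) g"
proof -
  let ?H = "\<lambda>g. {h \<in> src_fibre G x. f (gmult G g (ginv G h)) \<noteq> 0}"
  have SA: "g \<in> arrows G" "src G g = x" if "g \<in> S" for g using S(2) that by (auto simp: src_fibre_def)
  have "finite (?H g)" if "g \<in> S" for g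
    using finite_rows_Cc[OF f] SA[OF that] unfolding finite_rows_def by blast
  then have fin: "finite (\<Union>g\<in>S. ?H g)" using S(1) by blast
  have "convolution G f \<xi> g = convolution G f (\<lambda>h. if h \<in> (\<Union>g\<in>S. ?H g) then \<xi> h else 0) g" if g: "g \<in> S" for g
    unfolding convolution_eq[OF SA(1)[OF g]] SA(2)[OF g]
    by (rule infsum_cong) (use g in auto)
  with fin show ?thesis by (intro that[of "\<Union>g\<in>S. ?H g"]) auto
qed

lemma convolution_finite_support:
  assumes "finite T" "T \<subseteq> src_fibre G x" "g \<in> src_fibre G x"
  shows "convolution G f (\<lambda>h. if h \<in> T then \<xi> h else 0) g = (\<Sum>h\<in>T. f (gmult G g (ginv G h)) * \<xi> h)"
proof -
  have g: "g \<in> arrows G" "src G g = x" using assms(3) by (auto simp: src_fibre_def)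
  show ?thesis unfolding convolution_eq[OF g(1)] g(2)
    by (rule infsumI, rule has_sum_finite_neutralI[OF assms(1,2)]) auto
qed

text \<open>Vanishing of the function means that every matrix entry tends to 0 along a representing
  sequence. On finitely many rows and columns the operators of \<open>F m\<close> therefore
  disappear in the limit, and the Cauchy estimate for \<open>F n - F m\<close> becomes a uniform
  bound for \<open>F n\<close> alone.\<close>

lemma Cred_eq_zero:
  assumes a: "a \<in> Cred G" and z: "\<And>g. g \<in> arrows G \<Longrightarrow> Cred_fun G a g = 0"
  shows "a = Cred_zero G"
proof -
  obtain F where F: "F \<in> a" using Cred_nonempty[OF a] .
  note FC = Cred_class(1)[OF a F]
  have F0: "(\<lambda>n. F n g) \<longlonglongrightarrow> 0" if "g \<in> arrows G" for g
    using Cred_fun_tendsto[OF a F that] z[OF that] by simp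
  have "\<exists>N. \<forall>n\<ge>N. red_norm G (F n) \<le> \<epsilon>" if \<epsilon>: "\<epsilon> > 0" for \<epsilon>
  proof -
    obtain N where N: "\<forall>m\<ge>N. \<forall>n\<ge>N. red_norm G (F m - F n) < \<epsilon>" using red_CauchyD(2)[OF FC \<epsilon>] by blast
    have "red_norm G (F n) \<le> \<epsilon>" if n: "n \<ge> N" for n
    proof (rule red_norm_le)
      fix x \<xi> assume x: "x \<in> units G" and \<xi>: "\<xi> \<in> ell2 (src_fibre G x)" "ell2_norm (src_fibre G x) \<xi> \<le> 1"
      let ?A = "src_fibre G x"
      have le: "L2_set (\<lambda>g. cmod (convolution G (F n) \<xi> g)) S \<le> \<epsilon>" if S: "finite S" "S \<subseteq> ?A" for S
      proof -
        obtain T where T: "finite T" "T \<subseteq> ?A"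
          "\<And>g. g \<in> S \<Longrightarrow> convolution G (F n) \<xi> g = convolution G (F n) (\<lambda>h. if h \<in> T then \<xi> h else 0) g"
          using convolution_truncate[OF red_CauchyD(1)[OF FC] S] by metis
        \<comment> \<open>Cutting \<open>\<xi>\<close> down to \<open>T\<close> leaves the rows of
          \<open>F n\<close> in \<open>S\<close> unchanged and keeps the vector in the unit ball. It
          also makes convolution with every \<open>F m\<close> a finite sum, although
          \<open>T\<close> was chosen for \<open>F n\<close> alone.\<close>
        define \<xi>' where "\<xi>' = (\<lambda>h. if h \<in> T then \<xi> h else 0)"
        have out': "\<xi>' h = 0" if "h \<notin> ?A" for h using that T(2) by (auto simp: \<xi>'_def)
        have le': "L2_set (\<lambda>h. cmod (\<xi>' h)) R \<le> 1" if R: "finite R" "R \<subseteq> ?A" for R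
        proof -
          have "L2_set (\<lambda>h. cmod (\<xi>' h)) R \<le> L2_set (\<lambda>h. cmod (\<xi> h)) R"
            by (rule L2_set_mono) (auto simp: \<xi>'_def)
          then show ?thesis using L2_set_le_ell2_norm[OF \<xi>(1) R] \<xi>(2) by simp
        qed
        note \<xi>' = ell2_normI[OF out' le']
        have "(\<lambda>m. convolution G (F m) \<xi>' g) \<longlonglongrightarrow> 0" if g: "g \<in> S" for g
        proof -
          have gA: "g \<in> ?A" using S(2) g by blast
          have "(\<lambda>m. \<Sum>h\<in>T. F m (gmult G g (ginv G h)) * \<xi> h) \<longlonglongrightarrow> (\<Sum>h\<in>T. 0 * \<xi> h)"
          proof (intro tendsto_sum tendsto_mult tendsto_const F0)
            fix h assume "h \<in> T"
            then have "h \<in> ?A" using T(2) by blast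
            then show "gmult G g (ginv G h) \<in> arrows G" using gA by (simp add: src_fibre_def)
          qed
          then show ?thesis unfolding \<xi>'_def convolution_finite_support[OF T(1,2) gA] by simp
        qed
        then have "(\<lambda>m. L2_set (\<lambda>g. cmod (convolution G (F n) \<xi>' g - convolution G (F m) \<xi>' g)) S)
            \<longlonglongrightarrow> L2_set (\<lambda>g. cmod (convolution G (F n) \<xi>' g - 0)) S"
          by (intro tendsto_L2_set tendsto_diff tendsto_const)
        moreover have "L2_set (\<lambda>g. cmod (convolution G (F n) \<xi>' g - convolution G (F m) \<xi>' g)) S \<le> \<epsilon>"
          if "m \<ge> N" for m
          using L2_set_le_red_norm[OF red_CauchyD(1)[OF FC, of n] red_CauchyD(1)[OF FC, of m] x \<xi>' S]
            N n that by fastforce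
        ultimately have "L2_set (\<lambda>g. cmod (convolution G (F n) \<xi>' g - 0)) S \<le> \<epsilon>"
          by (intro LIMSEQ_le_const2) blast+
        moreover have "L2_set (\<lambda>g. cmod (convolution G (F n) \<xi> g)) S = L2_set (\<lambda>g. cmod (convolution G (F n) \<xi>' g - 0)) S"
          by (rule L2_set_cong) (simp_all add: T(3) \<xi>'_def)
        ultimately show ?thesis by simp
      qed
      show "ell2_norm ?A (convolution G (F n) \<xi>) \<le> \<epsilon>"
        using ell2_normI(2)[OF convolution_outside_fibre[OF \<xi>(1)] le] by blast
    qed
    then show ?thesis by blast
  qed
  then have ex: "\<exists>N. \<forall>n\<ge>N. red_norm G (F n) \<le> \<epsilon>" if "\<epsilon> > 0" for \<epsilon> using that by blast
  have "(\<lambda>n. red_norm G (F n)) \<longlonglongrightarrow> 0"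
  proof (rule LIMSEQ_I)
    fix r :: real assume "r > 0"
    then obtain N where "\<forall>n\<ge>N. red_norm G (F n) \<le> r / 2" using ex[of "r / 2"] by auto
    then show "\<exists>N. \<forall>n\<ge>N. norm (red_norm G (F n) - 0) < r"
      using \<open>r > 0\<close> red_norm_nonneg[OF red_CauchyD(1)[OF FC]] by (intro exI[of _ N]) fastforce
  qed
  then have "(F, \<lambda>n. 0) \<in> red_equiv G"
    using FC const_red_Cauchy[OF Cc_zero] unfolding red_equiv_def by simp
  then have "red_equiv G `` {F} = red_equiv G `` {\<lambda>n. 0}" by (rule equiv_class_eq[OF equiv_red])
  then show ?thesis using Cred_class(2)[OF a F] by (simp add: Cred_zero_def Cred_of_def)
qed

text \<open>The units form an open set, so interior in the unit space can be tested by open sets of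
  \<open>G\<close>.\<close>

lemma singular_ideal_iff:
  "a \<in> singular_ideal G \<longleftrightarrow> a \<in> Cred G \<and>
    (\<forall>W. openin (gtop G) W \<longrightarrow> W \<subseteq> src G ` {g \<in> arrows G. Cred_fun G a g \<noteq> 0} \<longrightarrow> W = {})"
proof -
  have sub: "src G ` open_supp G a \<subseteq> units G" by (auto simp: open_supp_def)
  have "units_top G interior_of (src G ` open_supp G a) = {} \<longleftrightarrow>
      (\<forall>W. openin (gtop G) W \<longrightarrow> W \<subseteq> src G ` open_supp G a \<longrightarrow> W = {})"
    using sub unfolding interior_of_eq_empty openin_units_iff by blast
  then show ?thesis by (simp add: singular_ideal_def open_supp_def)
qed

lemma Cred_zero_singular: "Cred_zero G \<in> singular_ideal G"
  unfolding singular_ideal_iff Cred_zero_def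
proof (intro conjI allI impI)
  show "Cred_of G 0 \<in> Cred G" by (rule Cred_of_in(1)[OF Cc_zero])
  fix W assume "W \<subseteq> src G ` {g \<in> arrows G. Cred_fun G (Cred_of G 0) g \<noteq> 0}"
  moreover have "{g \<in> arrows G. Cred_fun G (Cred_of G 0) g \<noteq> 0} = {}" using Cred_fun_of[OF Cc_zero] by auto
  ultimately show "W = {}" by auto
qed

lemma cond_S0_imp_singular_Cc:
  assumes "cond_S0 G"
  obtains h where "h \<in> Cc G" "Cred_of G h \<in> singular_ideal G" "Cred_of G h \<noteq> Cred_zero G"
proof -
  obtain h g0 where h: "h \<in> Cc G" "g0 \<in> arrows G" "h g0 \<noteq> 0"
    "\<And>W. openin (gtop G) W \<Longrightarrow> W \<subseteq> src G ` {g \<in> arrows G. h g \<noteq> 0} \<Longrightarrow> W = {}"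
    using singular_function_of_cond_S0[OF assms] by metis
  have "{g \<in> arrows G. Cred_fun G (Cred_of G h) g \<noteq> 0} = {g \<in> arrows G. h g \<noteq> 0}"
    using Cred_fun_of[OF h(1)] by auto
  then have "Cred_of G h \<in> singular_ideal G"
    unfolding singular_ideal_iff using Cred_of_in(1)[OF h(1)] h(4) by simp
  moreover have "Cred_of G h \<noteq> Cred_zero G"
    using Cred_fun_of[OF h(1,2)] Cred_fun_of[OF Cc_zero h(2)] h(3) unfolding Cred_zero_def by auto
  ultimately show ?thesis using that h(1) by blast
qed

lemma not_cond_S0_imp_singular_ideal_zero:
  assumes fin: "\<And>x. x \<in> units G \<Longrightarrow> finite {c \<in> gtop G closure_of units G. src G c = x}"
    and S0: "\<not> cond_S0 G"
  shows "singular_ideal G = {Cred_zero G}"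
proof -
  have "a = Cred_zero G" if a: "a \<in> singular_ideal G" for a
  proof (rule Cred_eq_zero)
    show aC: "a \<in> Cred G" using a singular_ideal_iff by blast
    fix g assume g: "g \<in> arrows G"
    show "Cred_fun G a g = 0"
    proof (rule ccontr)
      assume "Cred_fun G a g \<noteq> 0"
      then have "cond_S0 G"
        using cond_S0_of_uniform_limit[OF fin Cred_fun_uniform_limit[OF aC] g] a singular_ideal_iff by blast
      then show False using S0 by blast
    qed
  qed
  then show ?thesis using Cred_zero_singular by blast
qed

end

theorem theorem3:
  fixes G :: "'g topgroupoid"
  assumes "etale_groupoid G"
    and "\<not> Hausdorff_space (gtop G)"
    and "finite_to_one_on (src G) (gtop G closure_of units G) \<or>
         finite_to_one_on (rng G) (gtop G closure_of units G)"
  shows "(singular_ideal G \<inter> Cred_of G ` Cc G = {Cred_zero G} \<longleftrightarrow>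
            singular_ideal G = {Cred_zero G}) \<and>
         (singular_ideal G = {Cred_zero G} \<longleftrightarrow> \<not> cond_S0 G)"
proof -
  interpret etale_gpd G using assms(1) by unfold_locales
  \<comment> \<open>The empty space is Hausdorff, so a non-Hausdorff groupoid has arrows and
    therefore units.\<close>
  have "arrows G \<noteq> {}"
  proof
    assume "arrows G = {}"
    then show False using assms(2) unfolding Hausdorff_space_def by simp
  qed
  then have "units G \<noteq> {}" using src_in by fastforce
  then interpret nonempty_etale_gpd G by unfold_locales
  \<comment> \<open>Range and source agree on the closure of the units, so the two finiteness
    hypotheses coincide.\<close>
  have "{c \<in> gtop G closure_of units G. rng G c = x} = {c \<in> gtop G closure_of units G. src G c = x}" for x
    using closure_units_isotropy by auto
  then have fin: "finite {c \<in> gtop G closure_of units G. src G c = x}" for x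
    using assms(3) unfolding finite_to_one_on_def by metis
  have zero: "Cred_zero G \<in> Cred_of G ` Cc G" unfolding Cred_zero_def using Cc_zero by blast
  \<comment> \<open>The implications \<open>1\<close>, \<open>3\<close> and \<open>2\<close>, in
    this order, close a cycle through the three conditions.\<close>
  have 1: "singular_ideal G = {Cred_zero G}" if "\<not> cond_S0 G"
    using not_cond_S0_imp_singular_ideal_zero[OF fin that] by blast
  have 2: "\<not> cond_S0 G" if J: "singular_ideal G \<inter> Cred_of G ` Cc G = {Cred_zero G}"
  proof
    assume "cond_S0 G"
    then obtain h where "h \<in> Cc G" "Cred_of G h \<in> singular_ideal G" "Cred_of G h \<noteq> Cred_zero G"
      by (rule cond_S0_imp_singular_Cc)
    then show False using J by blast
  qed
  have 3: "singular_ideal G \<inter> Cred_of G ` Cc G = {Cred_zero G}" if "singular_ideal G = {Cred_zero G}"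
    using that zero by blast
  from 1 2 3 show ?thesis by blast
qed

end
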